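(* Let $N\ge 7$ and $\frac{N(N-2)}{4}<\lambda<\left(\frac{N-1}{2}\right)^2$. Then the equation $$-\Delta_{\mathbb{B}^N}u-\lambda u=|u|^{2^*-2}u,\qquad u\in H^1(\mathbb{B}^N),$$ has infinitely many distinct nontrivial radial sign-changing (weak) solutions.
   Context: $\mathbb{B}^N=\{x\in\mathbb{R}^N:|x|<1\}$ with the hyperbolic metric $g_{ij}=\left(\frac{2}{1-|x|^2}\right)^2\delta_{ij}$; $dV_{\mathbb{B}^N}=\left(\frac{2}{1-|x|^2}\right)^N dx$; $|\nabla_{\mathbb{B}^N}u|_g^2=\left(\frac{1-|x|^2}{2}\right)^2|\nabla u|^2$; $\Delta_{\mathbb{B}^N}u=\left(\frac{1-|x|^2}{2}\right)^2\Delta u+(N-2)\frac{1-|x|^2}{2}\,x\cdot\nabla u$. $H^1(\mathbb{B}^N)$ is the completion of $C_c^\infty(\mathbb{B}^N)$ under $\left(\int(|\nabla_{\mathbb{B}^N}u|_g^2+u^2)\,dV_{\mathbb{B}^N}\right)^{1/2}$; $2^*=\frac{2N}{N-2}$. Radial means $u(x)$ depends only on $|x|$; sign-changing means $u$ takes both strictly positive and strictly negative values. *)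

theory Defs
  imports "HOL-Analysis.Analysis"
begin

text \<open>Poincare ball model of hyperbolic space on a Euclidean space of dimension N = DIM('a).\<close>

definition hyp_ball :: "'a::euclidean_space set" where
  "hyp_ball = ball 0 1"

text \<open>Conformal factor 2/(1-|x|^2), so g_ij = (hyp_conf x)^2 delta_ij.\<close>
definition hyp_conf :: "'a::euclidean_space \<Rightarrow> real" where
  "hyp_conf x = 2 / (1 - (norm x)\<^sup>2)"

definition hyp_vol :: "'a::euclidean_space measure" where
  "hyp_vol = density (restrict_space lebesgue hyp_ball)
               (\<lambda>x. ennreal (hyp_conf x ^ DIM('a)))"

coinductive smooth_on :: "'a::euclidean_space set \<Rightarrow> ('a \<Rightarrow> real) \<Rightarrow> bool" where
  "open S \<Longrightarrow> continuous_on S f \<Longrightarrow> f differentiable_on S \<Longrightarrow>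
   (\<forall>v. smooth_on S (\<lambda>x. frechet_derivative f (at x) v)) \<Longrightarrow> smooth_on S f"

definition egrad :: "('a::euclidean_space \<Rightarrow> real) \<Rightarrow> 'a \<Rightarrow> 'a" where
  "egrad f x = (\<Sum>b\<in>Basis. frechet_derivative f (at x) b *\<^sub>R b)"

definition test_fun :: "('a::euclidean_space \<Rightarrow> real) \<Rightarrow> bool" where
  "test_fun \<phi> \<longleftrightarrow> smooth_on hyp_ball \<phi> \<and>
     compact (closure {x. \<phi> x \<noteq> 0}) \<and> closure {x. \<phi> x \<noteq> 0} \<subseteq> hyp_ball"

text \<open>u belongs to H^1(B^N) (the completion of the test functions under the norm
  (int |grad_B u|_g^2 + u^2 dV)^(1/2)) with (Euclidean) weak gradient G: u is the
  H^1-limit of a sequence of test functions whose Euclidean gradients converge to G.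
  Note |grad_B f|_g^2 = ((1-|x|^2)/2)^2 |grad f|^2.\<close>
definition H1_with_grad :: "('a::euclidean_space \<Rightarrow> real) \<Rightarrow> ('a \<Rightarrow> 'a) \<Rightarrow> bool" where
  "H1_with_grad u G \<longleftrightarrow> u \<in> borel_measurable hyp_vol \<and> G \<in> borel_measurable hyp_vol \<and>
     (\<exists>\<phi> :: nat \<Rightarrow> 'a \<Rightarrow> real. (\<forall>k. test_fun (\<phi> k)) \<and>
        (\<lambda>k. \<integral>\<^sup>+ x. ennreal (((1 - (norm x)\<^sup>2) / 2)\<^sup>2 * (norm (egrad (\<phi> k) x - G x))\<^sup>2
                              + (\<phi> k x - u x)\<^sup>2) \<partial>hyp_vol) \<longlonglongrightarrow> 0)"

definition in_H1 :: "('a::euclidean_space \<Rightarrow> real) \<Rightarrow> bool" where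
  "in_H1 u \<longleftrightarrow> (\<exists>G. H1_with_grad u G)"

definition crit_exp :: "nat \<Rightarrow> real" where
  "crit_exp N = 2 * real N / (real N - 2)"

text \<open>Weak solution of  -Delta_B u - lambda u = |u|^(2*-2) u,  u in H^1(B^N):
  for every test function phi,
  int <grad_B u, grad_B phi>_g dV - lambda int u phi dV = int |u|^(2*-2) u phi dV,
  where <grad_B u, grad_B phi>_g = ((1-|x|^2)/2)^2 (grad u . grad phi).\<close>
definition weak_solution :: "real \<Rightarrow> ('a::euclidean_space \<Rightarrow> real) \<Rightarrow> bool" where
  "weak_solution lam u \<longleftrightarrow> (\<exists>G. H1_with_grad u G \<and>
     (\<forall>\<phi>. test_fun \<phi> \<longrightarrow>
        integrable hyp_vol (\<lambda>x. ((1 - (norm x)\<^sup>2) / 2)\<^sup>2 * (G x \<bullet> egrad \<phi> x)) \<and>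
        integrable hyp_vol (\<lambda>x. u x * \<phi> x) \<and>
        integrable hyp_vol (\<lambda>x. \<bar>u x\<bar> powr (crit_exp DIM('a) - 2) * u x * \<phi> x) \<and>
        (\<integral>x. ((1 - (norm x)\<^sup>2) / 2)\<^sup>2 * (G x \<bullet> egrad \<phi> x) \<partial>hyp_vol)
          - lam * (\<integral>x. u x * \<phi> x \<partial>hyp_vol)
        = (\<integral>x. \<bar>u x\<bar> powr (crit_exp DIM('a) - 2) * u x * \<phi> x \<partial>hyp_vol)))"

definition radial :: "('a::euclidean_space \<Rightarrow> real) \<Rightarrow> bool" where
  "radial u \<longleftrightarrow> (\<forall>x\<in>hyp_ball. \<forall>y\<in>hyp_ball. norm x = norm y \<longrightarrow> u x = u y)"

definition nontrivial :: "('a::euclidean_space \<Rightarrow> real) \<Rightarrow> bool" where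
  "nontrivial u \<longleftrightarrow> \<not> (AE x in hyp_vol. u x = 0)"

definition sign_changing :: "('a::euclidean_space \<Rightarrow> real) \<Rightarrow> bool" where
  "sign_changing u \<longleftrightarrow> emeasure hyp_vol {x \<in> space hyp_vol. u x > 0} > 0 \<and>
                         emeasure hyp_vol {x \<in> space hyp_vol. u x < 0} > 0"

end

theory Submission
  imports Defs
begin

text \<open>
  A radial solution is a function w of the hyperbolic distance r to the origin with
  w'' + (N - 1) coth r w' + \<lambda> w + |w|^q w = 0, q = 4 / (N - 2), w'(0) = 0, and is determined by
  w(0). The proof shoots in w(0).

  (1) In Emden--Fowler variables y = (sinh r)^m w, t = ln (tanh (r / 2)), m = (N - 2) / 2, the
  equation becomes y'' = (m^2 - \<phi>) y - |y|^q y with \<phi> = (\<lambda> - N (N - 2) / 4) / sinh^2 t. Because \<phi>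
  increases, the energy is increasing, and it tends to 0 at t = -\<infinity>, so it is positive and the orbit
  stays outside the homoclinic loop of the autonomous equation. A bubble at time t raises the energy
  to at least c exp (2 t), and with this energy the next bubble, of opposite sign, comes within time
  (2 / \<mu>) |t| + C, for any \<mu> < m. As m > 2 exactly when N \<ge> 7, one can take \<mu> > 2; and as the first
  bubble moves to t = -\<infinity> when w(0) grows, the number of sign changes tends to infinity with w(0).

  (2) As \<lambda> < ((N - 1) / 2)^2, at infinity either w decays faster than exp (- c r) for some
  c > (N - 1) / 2, or w keeps its sign from some radius on, uniformly for neighbouring initial values.
  If only the second case occurred for all large initial values, the limiting Pruefer angle, counted
  in half turns, would be locally constant in w(0), contradicting (1). Hence fast solutions exist for
  arbitrarily large initial values.

  (3) Fast solutions lie in H^1 (approximation by smooth cutoffs times polynomials in |x|^2) and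
  solve the equation weakly, by the divergence theorem for the field conf^(N-2) grad u.
\<close>

section \<open>Calculus on the real line\<close>

lemma continuous_on_atLeastI:
  fixes f :: "real \<Rightarrow> 'b::topological_space"
  assumes "\<And>b. continuous_on {a..b} f"
  shows "continuous_on {a..} f"
proof -
  have "continuous (at x within {a..}) f" if "a \<le> x" for x
  proof -
    have "continuous (at x within {a..x + 1}) f"
      using assms[of "x + 1"] that by (auto simp: continuous_on_eq_continuous_within)
    moreover have "at x within {a..x + 1} = at x within {a..}"
      by (rule at_within_nhd[of _ "{..<x + 1}"]) auto
    ultimately show ?thesis by (simp add: continuous_within)
  qed
  then show ?thesis by (auto simp: continuous_on_eq_continuous_within)
qed

lemma continuous_on_indefinite_integral:
  fixes f :: "real \<Rightarrow> 'b::banach"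
  assumes "continuous_on {a..} f"
  shows "continuous_on {a..} (\<lambda>x. integral {a..x} f)"
  by (intro continuous_on_atLeastI indefinite_integral_continuous_1 integrable_continuous_real
      continuous_on_subset[OF assms]) auto

lemma has_real_derivative_indefinite_integral:
  fixes f :: "real \<Rightarrow> real"
  assumes "continuous_on {a..} f" "a < x"
  shows "((\<lambda>x. integral {a..x} f) has_real_derivative f x) (at x)"
proof -
  have "((\<lambda>x. integral {a..x} f) has_real_derivative f x) (at x within {a..x + 1})"
    by (intro integral_has_real_derivative continuous_on_subset[OF assms(1)]) (use assms in auto)
  moreover have "at x within {a..x + 1} = at x"
    by (rule at_within_interior) (use assms in auto)
  ultimately show ?thesis by simp
qed

lemma abs_integral_le_exp:
  fixes f :: "real \<Rightarrow> real"
  assumes cont: "continuous_on {0..r} f" and "0 \<le> r" "0 < k" "0 \<le> C"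
    and bound: "\<And>s. s \<in> {0..r} \<Longrightarrow> \<bar>f s\<bar> \<le> C * exp (k * s)"
  shows "\<bar>integral {0..r} f\<bar> \<le> C / k * exp (k * r)"
proof -
  have exp_integral: "((\<lambda>s. C * exp (k * s)) has_integral (C / k * exp (k * r) - C / k * exp (k * 0))) {0..r}"
    by (rule fundamental_theorem_of_calculus)
       (use assms in \<open>auto intro!: derivative_eq_intros simp: has_real_derivative_iff_has_vector_derivative[symmetric]\<close>)
  have "norm (integral {0..r} f) \<le> integral {0..r} (\<lambda>s. C * exp (k * s))"
    by (rule Henstock_Kurzweil_Integration.integral_norm_bound_integral)
       (use bound integrable_continuous_real[OF cont] exp_integral in auto)
  also have "\<dots> = C / k * exp (k * r) - C / k" using exp_integral by (simp only: integral_unique) simp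
  also have "\<dots> \<le> C / k * exp (k * r)" using assms by simp
  finally show ?thesis by simp
qed

lemma abs_integral_weighted_le:
  fixes p g :: "real \<Rightarrow> real"
  assumes "continuous_on {a..b} p" "continuous_on {a..b} g"
    and "\<And>x. x \<in> {a..b} \<Longrightarrow> 0 \<le> p x" "\<And>x. x \<in> {a..b} \<Longrightarrow> p x \<le> P"
  shows "\<bar>integral {a..b} (\<lambda>x. p x * g x)\<bar> \<le> P * integral {a..b} (\<lambda>x. \<bar>g x\<bar>)"
proof -
  have "norm (integral {a..b} (\<lambda>x. p x * g x)) \<le> integral {a..b} (\<lambda>x. P * \<bar>g x\<bar>)"
    by (rule Henstock_Kurzweil_Integration.integral_norm_bound_integral)
       (use assms in \<open>auto intro!: integrable_continuous_real continuous_intros mult_right_mono simp: abs_mult\<close>)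
  then show ?thesis by simp
qed

lemma first_root:
  fixes f :: "real \<Rightarrow> real"
  assumes "continuous_on {a..b} f" "a \<le> b" "f a < 0" "f b \<ge> 0"
  obtains t where "a < t" "t \<le> b" "f t = 0" "\<And>s. a \<le> s \<Longrightarrow> s < t \<Longrightarrow> f s < 0"
proof -
  define S where "S = {a..b} \<inter> f -` {0..}"
  have "closed S" unfolding S_def
    by (rule continuous_closed_preimage[OF assms(1)]) auto
  have "b \<in> S" using assms by (auto simp: S_def)
  have "bdd_below S" by (rule bdd_belowI[of _ a]) (auto simp: S_def)
  define t where "t = Inf S"
  have "t \<in> S"
    unfolding t_def by (rule closed_contains_Inf) (use \<open>closed S\<close> \<open>b \<in> S\<close> \<open>bdd_below S\<close> in auto)
  have neg: "f s < 0" if "a \<le> s" "s < t" for s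
  proof (rule ccontr)
    assume "\<not> f s < 0"
    then have "s \<in> S" using that \<open>t \<in> S\<close> by (auto simp: S_def)
    then have "t \<le> s" unfolding t_def by (rule cInf_lower) (rule \<open>bdd_below S\<close>)
    then show False using that by simp
  qed
  have "a < t" using \<open>t \<in> S\<close> assms(3) by (auto simp: S_def order.order_iff_strict)
  have "\<exists>x\<ge>a. x \<le> t \<and> f x = 0"
    by (rule IVT') (use \<open>t \<in> S\<close> assms \<open>a < t\<close> in \<open>auto simp: S_def intro: continuous_on_subset\<close>)
  then have "f t = 0" using neg by (metis less_irrefl order_le_less)
  then show ?thesis using that[of t] \<open>a < t\<close> \<open>t \<in> S\<close> neg by (auto simp: S_def)
qed

lemma last_root:
  fixes f :: "real \<Rightarrow> real"
  assumes "continuous_on {a..b} f" "a \<le> b" "f a \<ge> 0" "f b < 0"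
  obtains t where "a \<le> t" "t < b" "f t = 0" "\<And>s. t < s \<Longrightarrow> s \<le> b \<Longrightarrow> f s < 0"
proof -
  have "continuous_on {-b..-a} (\<lambda>s. f (-s))"
    by (rule continuous_on_compose2[OF assms(1)]) (auto intro!: continuous_intros)
  then obtain t where t: "-b < t" "t \<le> -a" "f (-t) = 0" "\<And>s. -b \<le> s \<Longrightarrow> s < t \<Longrightarrow> f (-s) < 0"
    using first_root[of "-b" "-a" "\<lambda>s. f (-s)"] assms by auto
  have "f s < 0" if "-t < s" "s \<le> b" for s using t(4)[of "-s"] that by auto
  then show ?thesis using that[of "-t"] t by auto
qed

lemma has_real_derivative_abs_powr_mult:
  fixes a u :: real
  assumes "a > 0"
  shows "((\<lambda>u. \<bar>u\<bar> powr a * u) has_real_derivative (a + 1) * \<bar>u\<bar> powr a) (at u)"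
proof (cases "u = 0")
  case True
  have "((\<lambda>h. \<bar>h\<bar> powr a) \<longlongrightarrow> 0 powr a) (at (0::real))"
    using assms by (auto intro!: tendsto_eq_intros)
  moreover have "\<forall>\<^sub>F h in at (0::real). \<bar>h\<bar> powr a = (\<bar>h\<bar> powr a * h) / h"
    by (auto simp: eventually_at_filter)
  ultimately have "((\<lambda>h. (\<bar>h\<bar> powr a * h) / h) \<longlongrightarrow> 0 powr a) (at (0::real))"
    by (rule Lim_transform_eventually)
  then show ?thesis using True by (simp add: DERIV_def)
next
  case False
  have "((\<lambda>u. \<bar>u\<bar>) has_real_derivative sgn u) (at u)"
    using has_derivative_norm[OF False]
    by (simp add: has_field_derivative_def mult.commute[of _ "sgn u"] flip: real_norm_def)
  then have "((\<lambda>u. \<bar>u\<bar> powr a) has_real_derivative a * \<bar>u\<bar> powr (a - 1) * sgn u) (at u)"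
    using False by (intro DERIV_chain2[OF has_real_derivative_powr]) auto
  moreover have "\<bar>u\<bar> powr (a - 1) * (sgn u * u) = \<bar>u\<bar> powr a"
    using False by (simp add: powr_diff sgn_mult_self_eq mult.commute[of "sgn u"] flip: abs_sgn)
  ultimately show ?thesis
    by (intro DERIV_cong[OF DERIV_mult[OF _ DERIV_ident]]) (auto simp: algebra_simps)
qed

lemma abs_powr_plus_2: "\<bar>u\<bar> powr (a + 2) = \<bar>u\<bar> powr a * (u::real)\<^sup>2"
  by (cases "u = 0") (auto simp: powr_add)

lemma has_real_derivative_abs_powr_primitive:
  fixes a u :: real
  assumes "a > 0"
  shows "((\<lambda>u. \<bar>u\<bar> powr (a + 2) / (a + 2)) has_real_derivative \<bar>u\<bar> powr a * u) (at u)"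
proof -
  have "((\<lambda>u. (\<bar>u\<bar> powr a * u) * u / (a + 2)) has_real_derivative \<bar>u\<bar> powr a * u) (at u)"
    using assms
    by (intro DERIV_cong[OF DERIV_cdivide[OF DERIV_mult[OF has_real_derivative_abs_powr_mult DERIV_ident]]])
       (auto simp: field_simps)
  then show ?thesis by (simp add: abs_powr_plus_2 power2_eq_square mult.assoc)
qed

lemma exp_decay_from_tail:
  fixes f :: "real \<Rightarrow> real"
  assumes cont: "continuous_on {0..} f" and tail: "\<And>r. r \<ge> R \<Longrightarrow> \<bar>f r\<bar> \<le> C * exp (- k * r)"
  shows "\<exists>C'. \<forall>r\<ge>0. \<bar>f r\<bar> \<le> C' * exp (- k * r)"
proof -
  have "continuous_on {0..R} (\<lambda>r. f r * exp (k * r))"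
    by (intro continuous_intros continuous_on_subset[OF cont]) auto
  from continuous_on_compact_bound[OF compact_Icc this]
  obtain M where M: "\<And>r. r \<in> {0..R} \<Longrightarrow> \<bar>f r * exp (k * r)\<bar> \<le> M" by auto
  have "\<bar>f r\<bar> \<le> max M C * exp (- k * r)" if "r \<ge> 0" for r
  proof (cases "r \<ge> R")
    case True
    have "C * exp (- k * r) \<le> max M C * exp (- k * r)" by (intro mult_right_mono) auto
    then show ?thesis using tail[OF True] by linarith
  next
    case False
    have "\<bar>f r\<bar> = \<bar>f r * exp (k * r)\<bar> * exp (- k * r)"
      by (simp add: abs_mult mult.assoc flip: exp_add)
    also have "\<dots> \<le> max M C * exp (- k * r)"
      using M[of r] False that by (intro mult_right_mono) auto
    finally show ?thesis .
  qed
  then show ?thesis by blast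
qed

section \<open>Nonlinear flux systems\<close>

text \<open>The equation (p w')' + p H(w) = 0 on the half-line, as a first order system for w and the
  flux z = - p w'. At 0 the weight p may vanish and only continuity is asked for.\<close>

locale flux_weight =
  fixes p p' :: "real \<Rightarrow> real"
  assumes cont_p: "continuous_on {0..} p"
    and p_0: "p 0 \<ge> 0"
    and p_pos: "r > 0 \<Longrightarrow> p r > 0"
    and p_deriv: "r > 0 \<Longrightarrow> (p has_real_derivative p' r) (at r)"
    and p'_nonneg: "r > 0 \<Longrightarrow> p' r \<ge> 0"
begin

lemma p_nonneg: "r \<ge> 0 \<Longrightarrow> p r \<ge> 0"
  using p_pos[of r] p_0 by (cases "r = 0") auto

lemma p_mono: "0 \<le> r \<Longrightarrow> r \<le> s \<Longrightarrow> p r \<le> p s"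
proof (rule DERIV_nonneg_imp_increasing_open[where f = p])
  fix x assume "0 \<le> r" "r < x"
  then show "\<exists>y. (p has_real_derivative y) (at x) \<and> 0 \<le> y"
    using p_deriv[of x] p'_nonneg[of x] by auto
qed (auto intro: continuous_on_subset[OF cont_p])

definition flux :: "(real \<Rightarrow> real) \<Rightarrow> real \<Rightarrow> real" where
  "flux g s = integral {0..s} (\<lambda>x. p x * g x)"

definition green :: "(real \<Rightarrow> real) \<Rightarrow> real \<Rightarrow> real" where
  "green g r = integral {0..r} (\<lambda>s. flux g s / p s)"

lemma flux_0 [simp]: "flux g 0 = 0" and green_0 [simp]: "green g 0 = 0"
  by (simp_all add: flux_def green_def)

lemma abs_flux_quotient_le:
  assumes "continuous_on {0..s} g" "0 \<le> s"
  shows "\<bar>flux g s / p s\<bar> \<le> integral {0..s} (\<lambda>x. \<bar>g x\<bar>)"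
proof (cases "s = 0")
  case False
  have "\<bar>flux g s\<bar> \<le> p s * integral {0..s} (\<lambda>x. \<bar>g x\<bar>)" unfolding flux_def
    by (rule abs_integral_weighted_le)
       (use assms in \<open>auto intro: continuous_on_subset[OF cont_p] p_mono p_nonneg\<close>)
  then show ?thesis using p_pos[of s] False assms(2) by (simp add: abs_mult divide_le_eq mult.commute)
qed simp

lemma abs_flux_quotient_le_const:
  assumes "continuous_on {0..s} g" "0 \<le> s" "\<And>x. x \<in> {0..s} \<Longrightarrow> \<bar>g x\<bar> \<le> C"
  shows "\<bar>flux g s / p s\<bar> \<le> C * s"
proof -
  have "norm (integral {0..s} (\<lambda>x. \<bar>g x\<bar>)) \<le> C * (s - 0)"
    by (rule integral_bound) (use assms in \<open>auto intro!: continuous_intros\<close>)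
  then show ?thesis using abs_flux_quotient_le[OF assms(1,2)] by simp
qed

lemma abs_flux_quotient_le_exp:
  assumes "continuous_on {0..s} g" "0 \<le> s" "0 < k" "0 \<le> C"
    "\<And>x. x \<in> {0..s} \<Longrightarrow> \<bar>g x\<bar> \<le> C * exp (k * x)"
  shows "\<bar>flux g s / p s\<bar> \<le> C / k * exp (k * s)"
proof -
  have "\<bar>integral {0..s} (\<lambda>x. \<bar>g x\<bar>)\<bar> \<le> C / k * exp (k * s)"
    by (rule abs_integral_le_exp) (use assms in \<open>auto intro!: continuous_intros\<close>)
  then show ?thesis using abs_flux_quotient_le[OF assms(1,2)] by linarith
qed

lemma continuous_on_flux: "continuous_on {0..} g \<Longrightarrow> continuous_on {0..} (flux g)"
  unfolding flux_def by (intro continuous_on_indefinite_integral continuous_intros cont_p)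

lemma continuous_on_flux_quotient:
  assumes "continuous_on {0..} g"
  shows "continuous_on {0..} (\<lambda>s. flux g s / p s)"
proof -
  have "continuous (at s within {0..}) (\<lambda>s. flux g s / p s)" if "s > 0" for s
    using continuous_on_flux[OF assms] cont_p p_pos[OF that] that
    by (intro continuous_at_within_divide) (auto simp: continuous_on_eq_continuous_within)
  moreover have "continuous (at 0 within {0..}) (\<lambda>s. flux g s / p s)"
  proof -
    obtain C where C: "\<And>x. x \<in> {0..1} \<Longrightarrow> \<bar>g x\<bar> \<le> C"
      using continuous_on_compact_bound[OF compact_Icc continuous_on_subset[OF assms, of "{0..1}"]]
      by (auto simp: subset_eq)
    have "\<forall>\<^sub>F s::real in at 0 within {0..}. s \<in> {0..1}"
      unfolding eventually_at by (rule exI[of _ 1]) (auto simp: dist_real_def)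
    then have "\<forall>\<^sub>F s in at 0 within {0..}. norm (flux g s / p s) \<le> C * s"
    proof eventually_elim
      case (elim s)
      have "\<bar>flux g s / p s\<bar> \<le> C * s"
        by (rule abs_flux_quotient_le_const) (use elim C
            in \<open>auto intro: continuous_on_subset[OF assms]\<close>)
      then show ?case by simp
    qed
    moreover have "((\<lambda>s. C * s) \<longlongrightarrow> 0) (at 0 within {0..})" by (auto intro!: tendsto_eq_intros)
    ultimately show ?thesis by (auto simp: continuous_within intro: Lim_null_comparison)
  qed
  ultimately have "continuous (at s within {0..}) (\<lambda>s. flux g s / p s)" if "s \<ge> 0" for s
    using that by (cases "s = 0") auto
  then show ?thesis by (auto simp: continuous_on_eq_continuous_within)
qed

lemma continuous_on_green: "continuous_on {0..} g \<Longrightarrow> continuous_on {0..} (green g)"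
  unfolding green_def by (intro continuous_on_indefinite_integral continuous_on_flux_quotient)

lemma flux_diff:
  assumes "continuous_on {0..} f" "continuous_on {0..} g"
  shows "flux (\<lambda>x. f x - g x) s = flux f s - flux g s"
  unfolding flux_def right_diff_distrib
  by (intro integral_diff integrable_continuous_real continuous_on_mult
      continuous_on_subset[OF cont_p] continuous_on_subset[OF assms(1)]
        continuous_on_subset[OF assms(2)]) auto

lemma green_diff:
  assumes "continuous_on {0..} f" "continuous_on {0..} g"
  shows "green (\<lambda>x. f x - g x) r = green f r - green g r"
  unfolding green_def flux_diff[OF assms] diff_divide_distrib
  by (intro integral_diff integrable_continuous_real
      continuous_on_subset[OF continuous_on_flux_quotient[OF assms(1)]]
      continuous_on_subset[OF continuous_on_flux_quotient[OF assms(2)]]) auto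

lemma abs_green_le_exp:
  assumes "continuous_on {0..} g" "0 \<le> r" "0 < k" "0 \<le> C"
    "\<And>x. x \<ge> 0 \<Longrightarrow> \<bar>g x\<bar> \<le> C * exp (k * x)"
  shows "\<bar>green g r\<bar> \<le> C / k\<^sup>2 * exp (k * r)"
proof -
  have "\<bar>green g r\<bar> \<le> C / k / k * exp (k * r)" unfolding green_def
  proof (rule abs_integral_le_exp)
    show "continuous_on {0..r} (\<lambda>s. flux g s / p s)"
      by (rule continuous_on_subset[OF continuous_on_flux_quotient[OF assms(1)]]) simp
    show "\<bar>flux g s / p s\<bar> \<le> C / k * exp (k * s)" if "s \<in> {0..r}" for s
      by (rule abs_flux_quotient_le_exp) (use assms that in \<open>auto intro: continuous_on_subset\<close>)
  qed (use assms in auto)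
  then show ?thesis by (simp add: power2_eq_square)
qed

definition flux_solution :: "(real \<Rightarrow> real) \<Rightarrow> (real \<Rightarrow> real) \<Rightarrow> (real \<Rightarrow> real) \<Rightarrow> bool" where
  "flux_solution H w z \<longleftrightarrow> continuous_on {0..} w \<and> continuous_on {0..} z \<and> z 0 = 0 \<and>
     (\<forall>r>0. (w has_real_derivative - z r / p r) (at r) \<and>
         (z has_real_derivative p r * H (w r)) (at r))"

definition velocity :: "(real \<Rightarrow> real) \<Rightarrow> real \<Rightarrow> real" where
  "velocity z r = z r / p r"

lemma flux_solutionD:
  assumes "flux_solution H w z"
  shows "continuous_on {0..} w" "continuous_on {0..} z" "z 0 = 0"
    "r > 0 \<Longrightarrow> (w has_real_derivative - velocity z r) (at r)"
    "r > 0 \<Longrightarrow> (z has_real_derivative p r * H (w r)) (at r)"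
  using assms by (auto simp: flux_solution_def velocity_def)

lemma velocity_0: "flux_solution H w z \<Longrightarrow> velocity z 0 = 0"
  by (simp add: flux_solution_def velocity_def)

lemma flux_solution_cong:
  assumes "flux_solution H w z" "\<And>r. r \<ge> 0 \<Longrightarrow> H (w r) = H' (w r)"
  shows "flux_solution H' w z"
  using assms by (auto simp: flux_solution_def)

lemma flux_solution_flux_eq:
  assumes sol: "flux_solution H w z" and "r \<ge> 0"
  shows "z r = flux (\<lambda>x. H (w x)) r"
proof -
  have "((\<lambda>x. p x * H (w x)) has_integral (z r - z 0)) {0..r}"
    by (rule fundamental_theorem_of_calculus_interior)
       (use flux_solutionD[OF sol] assms(2) in
         \<open>auto simp: has_real_derivative_iff_has_vector_derivative intro: continuous_on_subset\<close>)
  then show ?thesis using flux_solutionD(3)[OF sol] by (simp add: flux_def integral_unique)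
qed

lemma flux_solution_green_eq:
  assumes sol: "flux_solution H w z" and "r \<ge> 0"
  shows "w r = w 0 - green (\<lambda>x. H (w x)) r"
proof -
  have "((\<lambda>x. - velocity z x) has_integral (w r - w 0)) {0..r}"
    by (rule fundamental_theorem_of_calculus_interior)
       (use flux_solutionD[OF sol] assms(2) in
         \<open>auto simp: has_real_derivative_iff_has_vector_derivative intro: continuous_on_subset\<close>)
  from has_integral_neg[OF this] have "integral {0..r} (velocity z) = w 0 - w r"
    by (simp add: integral_unique)
  moreover have "integral {0..r} (velocity z) = green (\<lambda>x. H (w x)) r"
    unfolding green_def
    by (rule integral_cong) (use flux_solution_flux_eq[OF sol] in \<open>auto simp: velocity_def\<close>)
  ultimately show ?thesis by simp
qed

lemma flux_solutionI:
  assumes H: "continuous_on UNIV H" and w: "continuous_on {0..} w"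
    and fixed: "\<And>r. r \<ge> 0 \<Longrightarrow> w r = a - green (\<lambda>x. H (w x)) r"
  shows "flux_solution H w (flux (\<lambda>x. H (w x)))"
proof -
  have Hw: "continuous_on {0..} (\<lambda>x. H (w x))"
    by (rule continuous_on_compose2[OF H w]) auto
  have "(w has_real_derivative - flux (\<lambda>x. H (w x)) r / p r) (at r)" if "r > 0" for r
  proof -
    have "((\<lambda>r. a - green (\<lambda>x. H (w x)) r) has_real_derivative 0 - flux (\<lambda>x. H (w x)) r / p r) (at r)"
      unfolding green_def
      by (intro DERIV_diff DERIV_const has_real_derivative_indefinite_integral
          continuous_on_flux_quotient Hw that)
    from has_field_derivative_transform_within_open[OF this, of "{0<..}" w] show ?thesis
      using that fixed by simp
  qed
  moreover have "(flux (\<lambda>x. H (w x)) has_real_derivative p r * H (w r)) (at r)" if "r > 0" for r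
    unfolding flux_def
    by (intro has_real_derivative_indefinite_integral continuous_intros cont_p Hw that)
  ultimately show ?thesis using w continuous_on_flux[OF Hw] by (simp add: flux_solution_def)
qed

lemma abs_velocity_le:
  assumes sol: "flux_solution H w z" and H: "continuous_on UNIV H" and "r \<ge> 0"
    and C: "\<And>x. x \<in> {0..r} \<Longrightarrow> \<bar>H (w x)\<bar> \<le> C"
  shows "\<bar>velocity z r\<bar> \<le> C * r"
proof -
  have "continuous_on {0..r} (\<lambda>x. H (w x))"
    by (rule continuous_on_compose2[OF H continuous_on_subset[OF flux_solutionD(1)[OF sol]]]) auto
  then show ?thesis unfolding velocity_def flux_solution_flux_eq[OF sol \<open>r \<ge> 0\<close>]
    by (rule abs_flux_quotient_le_const) (use assms in auto)
qed

lemma continuous_on_velocity: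
  assumes sol: "flux_solution H w z" and H: "continuous_on UNIV H"
  shows "continuous_on {0..} (velocity z)"
proof -
  have "continuous_on {0..} (\<lambda>s. flux (\<lambda>x. H (w x)) s / p s)"
    by (intro continuous_on_flux_quotient continuous_on_compose2[OF H flux_solutionD(1)[OF sol]]) auto
  then show ?thesis
    by (rule continuous_on_eq) (use flux_solution_flux_eq[OF sol] in \<open>auto simp: velocity_def\<close>)
qed

lemma velocity_deriv:
  assumes sol: "flux_solution H w z" and r: "r > 0"
  shows "(velocity z has_real_derivative H (w r) - p' r / p r * velocity z r) (at r)"
  unfolding velocity_def[abs_def]
  by (rule DERIV_cong[OF DERIV_divide[OF flux_solutionD(5)[OF sol r] p_deriv[OF r]]])
     (use p_pos[OF r] in \<open>auto simp: field_simps\<close>)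

definition energy :: "(real \<Rightarrow> real) \<Rightarrow> (real \<Rightarrow> real) \<Rightarrow> (real \<Rightarrow> real) \<Rightarrow> real \<Rightarrow> real" where
  "energy G w z r = (velocity z r)\<^sup>2 / 2 + G (w r)"

lemma energy_0: "flux_solution H w z \<Longrightarrow> energy G w z 0 = G (w 0)"
  by (simp add: energy_def velocity_0)

lemma potential_le_energy: "G (w r) \<le> energy G w z r"
  by (simp add: energy_def)

lemma energy_deriv:
  assumes sol: "flux_solution H w z" and r: "r > 0" and G:
    "(G has_real_derivative H (w r)) (at (w r))"
  shows "(energy G w z has_real_derivative - (p' r / p r) * (velocity z r)\<^sup>2) (at r)"
proof -
  have "((\<lambda>r. G (w r)) has_real_derivative H (w r) * (- velocity z r)) (at r)"
    by (rule DERIV_chain2[OF G flux_solutionD(4)[OF sol r]])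
  from DERIV_add[OF DERIV_cdivide[OF DERIV_power[OF velocity_deriv[OF sol r], of 2], of 2] this]
  show ?thesis unfolding energy_def[abs_def]
    by (rule DERIV_cong) (simp add: algebra_simps power2_eq_square diff_divide_distrib)
qed

lemma continuous_on_energy:
  assumes sol: "flux_solution H w z" and "continuous_on UNIV H" "continuous_on UNIV G"
  shows "continuous_on {0..} (energy G w z)"
  unfolding energy_def[abs_def]
  by (intro continuous_intros continuous_on_velocity[OF assms(1,2)]
      continuous_on_compose2[OF assms(3) flux_solutionD(1)[OF sol]]) auto

lemma energy_antimono:
  assumes sol: "flux_solution H w z" and "continuous_on UNIV H" "continuous_on UNIV G"
    and "0 \<le> r" "r \<le> s"
    and G: "\<And>x. x \<in> {r<..<s} \<Longrightarrow> (G has_real_derivative H (w x)) (at (w x))"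
  shows "energy G w z s \<le> energy G w z r"
proof (rule DERIV_nonpos_imp_decreasing_open[where f = "energy G w z"])
  fix x assume x: "r < x" "x < s"
  have "- (p' x / p x) * (velocity z x)\<^sup>2 \<le> 0"
    using p'_nonneg[of x] p_pos[of x] x assms(4) by (simp add: divide_nonneg_pos)
  then show "\<exists>y. (energy G w z has_real_derivative y) (at x) \<and> y \<le> 0"
    using energy_deriv[OF sol _ G, of x] x assms(4) by auto
qed (use assms in \<open>auto intro: continuous_on_subset[OF continuous_on_energy]\<close>)

text \<open>The product p^2 E of the squared weight and the energy increases, as its derivative is 2 p p' G(w).\<close>

lemma energy_pos:
  assumes sol: "flux_solution H w z" and G: "\<And>u. (G has_real_derivative H u) (at u)"
    and nonneg: "\<And>u. G u \<ge> 0" and pos: "G (w 0) > 0" and "r \<ge> 0"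
  shows "energy G w z r > 0"
proof (cases "r = 0")
  case True
  then show ?thesis using energy_0[OF sol] pos by simp
next
  case False
  define M where "M r = (z r)\<^sup>2 / 2 + (p r)\<^sup>2 * G (w r)" for r
  note w = flux_solutionD(1)[OF sol]
  have "continuous_on UNIV G" by (auto intro!: continuous_at_imp_continuous_on DERIV_isCont[OF G])
  then have "continuous_on {0..} (\<lambda>r. G (w r))" by (rule continuous_on_compose2[OF _ w]) auto
  then have "((\<lambda>r. G (w r)) \<longlongrightarrow> G (w 0)) (at 0 within {0..})" by (auto simp: continuous_on_def)
  then have "((\<lambda>r. G (w r)) \<longlongrightarrow> G (w 0)) (at_right 0)" by (rule tendsto_within_subset) auto
  then have "\<forall>\<^sub>F s in at_right 0. G (w s) > 0" using pos by (rule order_tendstoD)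
  moreover have "\<forall>\<^sub>F s in at_right 0. s \<in> {0<..<r}"
    using \<open>r \<ge> 0\<close> False by (intro eventually_at_right_real) auto
  ultimately have "\<forall>\<^sub>F s in at_right 0. G (w s) > 0 \<and> s \<in> {0<..<r}" by (rule eventually_conj)
  then obtain s where s: "G (w s) > 0" "0 < s" "s < r"
    by (auto dest!: eventually_happens'[rotated])
  have "M s \<le> M r"
  proof (rule DERIV_nonneg_imp_nondecreasing[where f = M])
    fix x assume "s \<le> x" "x \<le> r"
    then have x: "x > 0" using s by simp
    have "((\<lambda>r. G (w r)) has_real_derivative H (w x) * (- velocity z x)) (at x)"
      by (rule DERIV_chain2[OF G flux_solutionD(4)[OF sol x]])
    then have "(M has_real_derivative 2 * p x * p' x * G (w x)) (at x)"
      unfolding M_def[abs_def] using p_pos[OF x]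
      by (auto intro!: derivative_eq_intros flux_solutionD(5)[OF sol x] p_deriv[OF x]
          simp: velocity_def power2_eq_square)
    then show "\<exists>y. (M has_real_derivative y) (at x) \<and> 0 \<le> y"
      using p_pos[OF x] p'_nonneg[OF x] nonneg[of "w x"]
      by (intro exI[of _ "2 * p x * p' x * G (w x)"]) simp
  qed (use s in simp)
  moreover have "M s > 0" using s p_pos[of s] by (simp add: M_def add_nonneg_pos)
  moreover have "energy G w z r = M r / (p r)\<^sup>2"
    using p_pos[of r] False \<open>r \<ge> 0\<close> by (simp add: energy_def M_def velocity_def field_simps)
  ultimately show ?thesis using p_pos[of r] False \<open>r \<ge> 0\<close> by simp
qed

end

text \<open>For Lipschitz continuous H the integral operator contracts by the factor 1/2 in the norm
  sup |w(r)| exp (- rate r).\<close>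

locale lipschitz_flux_system = flux_weight +
  fixes H :: "real \<Rightarrow> real" and L :: real
  assumes L_pos: "L > 0" and lipschitz: "\<bar>H a - H b\<bar> \<le> L * \<bar>a - b\<bar>"
begin

definition rate :: real where
  "rate = sqrt (2 * L)"

lemma rate_pos: "rate > 0" and rate_sq: "rate\<^sup>2 = 2 * L"
  using L_pos by (auto simp: rate_def)

lemma continuous_on_H: "continuous_on UNIV H"
proof (rule lipschitz_on_continuous_on)
  show "L-lipschitz_on UNIV H" using lipschitz L_pos
    by (intro lipschitz_onI) (auto simp: dist_real_def)
qed

lemma continuous_on_H_compose: "continuous_on S w \<Longrightarrow> continuous_on S (\<lambda>x. H (w x))"
  by (rule continuous_on_compose2[OF continuous_on_H]) auto

lemma abs_green_diff_le:
  assumes "continuous_on {0..} v" "continuous_on {0..} w" "D \<ge> 0" "r \<ge> 0"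
    and D: "\<And>s. s \<ge> 0 \<Longrightarrow> \<bar>v s - w s\<bar> \<le> D * exp (rate * s)"
  shows "\<bar>green (\<lambda>x. H (v x)) r - green (\<lambda>x. H (w x)) r\<bar> \<le> D / 2 * exp (rate * r)"
proof -
  have "\<bar>green (\<lambda>x. H (v x) - H (w x)) r\<bar> \<le> L * D / rate\<^sup>2 * exp (rate * r)"
  proof (rule abs_green_le_exp)
    fix x :: real assume "x \<ge> 0"
    have "\<bar>H (v x) - H (w x)\<bar> \<le> L * \<bar>v x - w x\<bar>" by (rule lipschitz)
    also have "\<dots> \<le> L * (D * exp (rate * x))" using D[OF \<open>x \<ge> 0\<close>] L_pos by (intro mult_left_mono) auto
    finally show "\<bar>H (v x) - H (w x)\<bar> \<le> L * D * exp (rate * x)" by simp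
  qed (use assms L_pos rate_pos in \<open>auto intro!: continuous_intros continuous_on_H_compose\<close>)
  then show ?thesis using L_pos
    by (simp add: green_diff[OF continuous_on_H_compose continuous_on_H_compose] assms rate_sq)
qed

definition unweight :: "(real \<Rightarrow>\<^sub>C real) \<Rightarrow> real \<Rightarrow> real" where
  "unweight u r = exp (rate * r) * apply_bcontfun u r"

definition weighted_picard :: "real \<Rightarrow> (real \<Rightarrow>\<^sub>C real) \<Rightarrow> real \<Rightarrow> real" where
  "weighted_picard a u r = exp (- rate * max 0 r) * (a - green (\<lambda>x. H (unweight u x)) (max 0 r))"

lemma continuous_on_unweight: "continuous_on S (unweight u)"
  unfolding unweight_def[abs_def] by (intro continuous_intros) auto

lemma weighted_picard_contraction:
  "\<bar>weighted_picard a u r - weighted_picard a v r\<bar> \<le> 1 / 2 * dist u v"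
proof -
  define s where "s = max 0 r"
  have "\<bar>unweight u x - unweight v x\<bar> \<le> dist u v * exp (rate * x)" for x
  proof -
    have "\<bar>unweight u x - unweight v x\<bar> = exp (rate * x) * dist (u x) (v x)"
      by (simp only: unweight_def right_diff_distrib[symmetric] abs_mult abs_exp_cancel dist_real_def)
    then show ?thesis using mult_left_mono[OF dist_bounded[of u x v], of "exp (rate * x)"]
      by (simp add: mult.commute)
  qed
  then have green: "\<bar>green (\<lambda>x. H (unweight u x)) s - green (\<lambda>x. H (unweight v x)) s\<bar>
      \<le> dist u v / 2 * exp (rate * s)"
    by (intro abs_green_diff_le continuous_on_unweight) (auto simp: s_def)
  have "weighted_picard a u r - weighted_picard a v r
      = exp (- rate * s) * (green (\<lambda>x. H (unweight v x)) s - green (\<lambda>x. H (unweight u x)) s)"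
    by (simp add: weighted_picard_def s_def algebra_simps)
  also have "\<bar>\<dots>\<bar> = exp (- rate * s) * \<bar>green (\<lambda>x. H (unweight u x)) s
      - green (\<lambda>x. H (unweight v x)) s\<bar>"
    by (simp add: abs_mult abs_minus_commute)
  also have "\<dots> \<le> exp (- rate * s) * (dist u v / 2 * exp (rate * s))"
    by (intro mult_left_mono green) simp
  also have "\<dots> = 1 / 2 * dist u v" by (simp add: exp_minus)
  finally show ?thesis .
qed

lemma weighted_picard_bcontfun: "weighted_picard a u \<in> bcontfun"
proof (rule bcontfun_normI)
  have max: "continuous_on UNIV (\<lambda>r::real. max 0 r)" by (intro continuous_intros)
  have "continuous_on {0..} (green (\<lambda>x. H (unweight u x)))"
    by (intro continuous_on_green continuous_on_H_compose continuous_on_unweight)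
  then have "continuous_on UNIV (\<lambda>r. green (\<lambda>x. H (unweight u x)) (max 0 r))"
    by (rule continuous_on_compose2[OF _ max]) auto
  then show "continuous_on UNIV (weighted_picard a u)"
    unfolding weighted_picard_def[abs_def] by (intro continuous_intros)
  have at_0: "\<bar>weighted_picard a 0 r\<bar> \<le> \<bar>a\<bar> + \<bar>H 0\<bar> / rate\<^sup>2" for r
  proof -
    define s where "s = max 0 r"
    have "\<bar>green (\<lambda>x. H (unweight 0 x)) s\<bar> \<le> \<bar>H 0\<bar> / rate\<^sup>2 * exp (rate * s)"
      by (rule abs_green_le_exp)
         (use rate_pos in \<open>auto simp: unweight_def s_def mult_le_cancel_left1\<close>)
    moreover have "\<bar>a\<bar> \<le> \<bar>a\<bar> * exp (rate * s)"
      using rate_pos by (simp add: s_def mult_le_cancel_left1)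
    ultimately have "\<bar>a - green (\<lambda>x. H (unweight 0 x)) s\<bar> \<le> (\<bar>a\<bar> + \<bar>H 0\<bar> / rate\<^sup>2) * exp (rate * s)"
      unfolding distrib_right by linarith
    then have "\<bar>a - green (\<lambda>x. H (unweight 0 x)) s\<bar> * exp (- rate * s) \<le> \<bar>a\<bar> + \<bar>H 0\<bar> / rate\<^sup>2"
      by (simp add: exp_minus field_simps)
    then show ?thesis by (simp add: weighted_picard_def s_def[symmetric] abs_mult mult.commute)
  qed
  show "norm (weighted_picard a u r) \<le> \<bar>a\<bar> + \<bar>H 0\<bar> / rate\<^sup>2 + 1 / 2 * dist u 0" for r
    using weighted_picard_contraction[of a u r 0] at_0[of r] unfolding real_norm_def by linarith
qed

lemma picard_fixed_point:
  "\<exists>w. continuous_on {0..} w \<and> (\<forall>r\<ge>0. w r = a - green (\<lambda>x. H (w x)) r)"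
proof -
  note apply_T = Bcontfun_inverse[OF weighted_picard_bcontfun]
  have "dist (Bcontfun (weighted_picard a u)) (Bcontfun (weighted_picard a v))
      \<le> 1 / 2 * dist u v" for u v
    by (rule dist_bound) (use weighted_picard_contraction in \<open>simp add: apply_T dist_real_def\<close>)
  then obtain u where u: "Bcontfun (weighted_picard a u) = u"
    using banach_fix_type[of "1 / 2" "\<lambda>u. Bcontfun (weighted_picard a u)"] by auto
  have "unweight u r = a - green (\<lambda>x. H (unweight u x)) r" if "r \<ge> 0" for r
  proof -
    have "u r = weighted_picard a u r" using apply_T u by metis
    then have "unweight u r = exp (rate * r) * weighted_picard a u r" by (simp only: unweight_def)
    then show ?thesis using that by (simp add: weighted_picard_def exp_minus)
  qed
  then show ?thesis using continuous_on_unweight by blast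
qed

lemma flux_solution_exists: "\<exists>w z. flux_solution H w z \<and> w 0 = a"
proof -
  obtain w where "continuous_on {0..} w" "\<And>r. r \<ge> 0 \<Longrightarrow> w r = a - green (\<lambda>x. H (w x)) r"
    using picard_fixed_point by blast
  with flux_solutionI[OF continuous_on_H this] show ?thesis by fastforce
qed

lemma flux_solution_lipschitz:
  assumes v: "flux_solution H v y" and w: "flux_solution H w z"
    and bound: "\<And>r. r \<ge> 0 \<Longrightarrow> \<bar>v r - w r\<bar> \<le> D * exp (rate * r)" and "r \<ge> 0"
  shows "\<bar>v r - w r\<bar> \<le> 2 * \<bar>v 0 - w 0\<bar> * exp (rate * r)"
proof -
  define ratio where "ratio s = \<bar>v s - w s\<bar> * exp (- rate * s)" for s
  define K where "K = (SUP s\<in>{0..}. ratio s)"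
  have "ratio s \<le> D" if "s \<ge> 0" for s
    using bound[OF that] by (simp add: ratio_def exp_minus field_simps)
  then have "bdd_above (ratio ` {0..})" by (intro bdd_aboveI2) auto
  then have ratio_le: "ratio s \<le> K" if "s \<ge> 0" for s
    unfolding K_def using that by (intro cSUP_upper) auto
  then have K: "\<bar>v s - w s\<bar> \<le> K * exp (rate * s)" if "s \<ge> 0" for s
    using that by (simp add: ratio_def exp_minus field_simps)
  have "ratio s \<le> \<bar>v 0 - w 0\<bar> + K / 2" if "s \<ge> 0" for s
  proof -
    have "0 \<le> K" using ratio_le[of 0] by (simp add: ratio_def)
    from abs_green_diff_le[OF flux_solutionD(1)[OF v] flux_solutionD(1)[OF w] this that K]
    have "\<bar>v s - w s\<bar> \<le> \<bar>v 0 - w 0\<bar> + K / 2 * exp (rate * s)"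
      using flux_solution_green_eq[OF v that] flux_solution_green_eq[OF w that] by linarith
    also have "\<dots> \<le> (\<bar>v 0 - w 0\<bar> + K / 2) * exp (rate * s)"
      using that rate_pos by (simp add: distrib_right mult_le_cancel_left1)
    finally show ?thesis by (simp add: ratio_def exp_minus field_simps)
  qed
  then have "K \<le> \<bar>v 0 - w 0\<bar> + K / 2" unfolding K_def by (intro cSUP_least) auto
  then have "K * exp (rate * r) \<le> 2 * \<bar>v 0 - w 0\<bar> * exp (rate * r)" by (intro mult_right_mono) auto
  then show ?thesis using K[OF \<open>r \<ge> 0\<close>] by linarith
qed

lemma velocity_lipschitz:
  assumes v: "flux_solution H v y" and w: "flux_solution H w z"
    and bound: "\<And>r. r \<ge> 0 \<Longrightarrow> \<bar>v r - w r\<bar> \<le> D * exp (rate * r)" and "r \<ge> 0"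
  shows "\<bar>velocity y r - velocity z r\<bar> \<le> L * D / rate * exp (rate * r)"
proof -
  have Hv: "continuous_on {0..} (\<lambda>x. H (v x))" and Hw: "continuous_on {0..} (\<lambda>x. H (w x))"
    using flux_solutionD(1)[OF v] flux_solutionD(1)[OF w] by (auto intro: continuous_on_H_compose)
  have "\<bar>flux (\<lambda>x. H (v x) - H (w x)) r / p r\<bar> \<le> L * D / rate * exp (rate * r)"
  proof (rule abs_flux_quotient_le_exp)
    show "continuous_on {0..r} (\<lambda>x. H (v x) - H (w x))"
      by (intro continuous_on_diff continuous_on_subset[OF Hv] continuous_on_subset[OF Hw]) auto
    show "\<bar>H (v x) - H (w x)\<bar> \<le> L * D * exp (rate * x)" if "x \<in> {0..r}" for x
    proof -
      have "L * \<bar>v x - w x\<bar> \<le> L * (D * exp (rate * x))"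
        using bound[of x] L_pos that by (intro mult_left_mono) auto
      then show ?thesis using lipschitz[of "v x" "w x"] by (simp only: mult.assoc)
    qed
    show "0 \<le> L * D" using bound[of 0] L_pos by simp
  qed (use rate_pos assms in auto)
  then show ?thesis
    using flux_solution_flux_eq[OF v \<open>r \<ge> 0\<close>] flux_solution_flux_eq[OF w \<open>r \<ge> 0\<close>]
    by (simp add: flux_diff[OF Hv Hw] velocity_def diff_divide_distrib)
qed

end

section \<open>The Emden--Fowler equation\<close>

lemma arsinh_real_nonneg: "x \<ge> 0 \<Longrightarrow> arsinh (x::real) \<ge> 0"
  by (cases "x = 0") (auto simp: less_imp_le)

lemma arsinh_real_le_ln:
  fixes x :: real
  assumes "x \<ge> 0"
  shows "arsinh x \<le> ln (2 * x + 1)"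
proof -
  have "sqrt (x\<^sup>2 + 1) \<le> x + 1"
    using assms by (intro real_le_lsqrt) (auto simp: power2_eq_square algebra_simps)
  then show ?thesis
    using assms arsinh_real_aux[of x] unfolding arsinh_real_def by (intro ln_mono) auto
qed

lemma sinh_real_ge_self: "x \<ge> 0 \<Longrightarrow> x \<le> sinh (x::real)"
proof -
  assume "x \<ge> 0"
  then have "(\<lambda>x::real. sinh x - x) 0 \<le> (\<lambda>x. sinh x - x) x"
    by (rule DERIV_nonneg_imp_nondecreasing)
       (auto intro!: derivative_eq_intros exI simp: cosh_real_ge_1)
  then show ?thesis by simp
qed

lemma coth_real_ge_1: "r > 0 \<Longrightarrow> 1 \<le> cosh r / sinh (r::real)"
  using sinh_le_cosh_real[of r] by simp

lemma eventually_at_bot_ex_less: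
  fixes b :: "'a::unbounded_dense_linorder"
  assumes "eventually P at_bot"
  obtains a where "a < b" "P a"
  using eventually_happens[OF eventually_conj[OF assms eventually_gt_at_bot[of b]]] by auto

text \<open>The equation y'' = (m^2 - phi) y - |y|^q y for negative times. The heights and rates are such
  that, with E the energy, for t \<le> - onset y'^2 dominates 2 E + low_rate^2 y^2 as long as
  |y| \<le> low_height, where low_rate > 2, and 2 E + mid_rate^2 y^2 as long as |y| \<le> height, while
  orbits above height are turned back with frequency return_freq.\<close>

locale emden_fowler_params =
  fixes m mu q :: real
  assumes m_gt_2: "m > 2" and mu_pos: "mu > 0" and exponent_pos: "q > 0"
begin

definition phi :: "real \<Rightarrow> real" where "phi t = mu / (sinh t)\<^sup>2"
definition phi' :: "real \<Rightarrow> real" where "phi' t = - 2 * mu * cosh t / sinh t ^ 3"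
definition height :: real where "height = (m\<^sup>2 * (1 + q / 4)) powr (1 / q)"
definition mid_rate :: real where "mid_rate = sqrt (m\<^sup>2 * q / (4 * (q + 2)))"
definition low_rate :: real where "low_rate = (m + 2) / 2"
definition low_height :: real where "low_height = ((m\<^sup>2 - low_rate\<^sup>2) / 2) powr (1 / q)"
definition phi_bound :: real where "phi_bound = min (mid_rate\<^sup>2) ((m\<^sup>2 - low_rate\<^sup>2) / 2)"
definition onset :: real where "onset = sqrt (mu / phi_bound)"
definition return_freq :: real where "return_freq = sqrt (m\<^sup>2 * q / 4)"
definition max_speed :: real where "max_speed = sqrt (2 + m\<^sup>2 * height\<^sup>2)"

definition gain_const :: real where
  "gain_const = min 1 (mu * height ^ 3 / (2 * max_speed) * exp (- 2 / mid_rate))"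

definition delay_const :: real where
  "delay_const = pi / return_freq
     + 2 * (ln (2 * low_rate * height / sqrt gain_const + 1) / low_rate + height /
         (mid_rate * low_height))"

lemma low_rate_gt: "low_rate > 2" and low_rate_sq_less: "low_rate\<^sup>2 < m\<^sup>2"
proof -
  show "low_rate > 2" using m_gt_2 by (simp add: low_rate_def)
  then show "low_rate\<^sup>2 < m\<^sup>2"
    using m_gt_2 by (intro power_strict_mono) (auto simp: low_rate_def)
qed

lemma height_pos: "height > 0" and low_height_pos: "low_height > 0" and mid_rate_pos: "mid_rate > 0"
  and return_freq_pos: "return_freq > 0" and max_speed_pos: "max_speed > 0"
  and phi_bound_pos: "phi_bound > 0" and onset_pos: "onset > 0"
proof -
  show "height > 0" using m_gt_2 exponent_pos by (auto simp: height_def intro!: add_pos_pos)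
  show "low_height > 0" using low_rate_sq_less by (auto simp: low_height_def)
  show mid: "mid_rate > 0" using m_gt_2 exponent_pos by (auto simp: mid_rate_def)
  show "return_freq > 0" using m_gt_2 exponent_pos by (auto simp: return_freq_def)
  show "max_speed > 0" by (auto simp: max_speed_def intro!: add_pos_nonneg)
  show bound: "phi_bound > 0" using mid low_rate_sq_less by (auto simp: phi_bound_def)
  show "onset > 0" using bound mu_pos by (simp add: onset_def)
qed

lemma height_powr: "height powr q = m\<^sup>2 * (1 + q / 4)"
proof -
  have "m\<^sup>2 * (1 + q / 4) > 0" using m_gt_2 exponent_pos by (intro mult_pos_pos) auto
  then show ?thesis using exponent_pos by (simp add: height_def powr_powr)
qed

lemma low_height_powr: "low_height powr q = (m\<^sup>2 - low_rate\<^sup>2) / 2"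
  using low_rate_sq_less exponent_pos by (simp add: low_height_def powr_powr)

lemma mid_rate_sq: "mid_rate\<^sup>2 = m\<^sup>2 * q / (4 * (q + 2))"
  using exponent_pos by (simp add: mid_rate_def)

lemma gain_const_pos: "gain_const > 0" and gain_const_le_1: "gain_const \<le> 1"
  using mu_pos height_pos max_speed_pos by (auto simp: gain_const_def)

lemma phi_nonneg: "phi t \<ge> 0"
  using mu_pos by (simp add: phi_def)

lemma phi_le_phi_bound:
  assumes "t \<le> - onset"
  shows "phi t \<le> phi_bound"
proof -
  have t: "onset \<le> - t" "0 < - t" using assms onset_pos by auto
  have "mu / phi_bound = onset\<^sup>2" using mu_pos phi_bound_pos by (simp add: onset_def)
  also have "\<dots> \<le> (- t)\<^sup>2" using t onset_pos by (intro power_mono) auto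
  also have "\<dots> \<le> (sinh (- t))\<^sup>2" using t by (intro power_mono sinh_real_ge_self) auto
  finally have "mu / phi_bound \<le> (sinh t)\<^sup>2" by simp
  moreover have "(sinh t)\<^sup>2 > 0" using t by (simp add: zero_less_power2)
  ultimately show ?thesis using phi_bound_pos by (simp add: phi_def field_simps)
qed

lemma phi_deriv: "t < 0 \<Longrightarrow> (phi has_real_derivative phi' t) (at t)"
  unfolding phi_def[abs_def] phi'_def
  by (auto intro!: derivative_eq_intros simp: field_simps power2_eq_square eval_nat_numeral)

lemma phi'_ge:
  assumes "t < 0"
  shows "phi' t \<ge> 8 * mu * exp (2 * t)"
proof -
  define x where "x = - t"
  have sinh_x: "sinh x > 0" using assms by (simp add: x_def)
  have "sinh x \<le> exp x / 2" by (simp add: sinh_field_def)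
  then have "(sinh x)\<^sup>2 \<le> (exp x / 2)\<^sup>2" using sinh_x by (intro power_mono) auto
  also have "\<dots> = exp (2 * x) / 4" by (simp add: power2_eq_square exp_add[symmetric])
  finally have inverse_sq: "1 / (exp (2 * x) / 4) \<le> 1 / (sinh x)\<^sup>2"
    using sinh_x by (intro divide_left_mono) auto
  have "8 * mu * exp (2 * t) = 2 * mu * 1 * (1 / (exp (2 * x) / 4))"
    by (simp add: x_def exp_minus field_simps)
  also have "\<dots> \<le> 2 * mu * (cosh x / sinh x) * (1 / (sinh x)\<^sup>2)"
    using inverse_sq coth_real_ge_1[of x] mu_pos sinh_x by (intro mult_mono mult_left_mono) auto
  also have "\<dots> = phi' t"
    by (simp add: phi'_def x_def field_simps power2_eq_square eval_nat_numeral)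
  finally show ?thesis .
qed

lemma phi'_pos: "t < 0 \<Longrightarrow> phi' t > 0"
  by (rule less_le_trans[OF _ phi'_ge]) (use mu_pos in auto)

definition ef_energy :: "(real \<Rightarrow> real) \<Rightarrow> (real \<Rightarrow> real) \<Rightarrow> real \<Rightarrow> real" where
  "ef_energy y y' t = (y' t)\<^sup>2 / 2 - m\<^sup>2 * (y t)\<^sup>2 / 2 + phi t * (y t)\<^sup>2 / 2
      + \<bar>y t\<bar> powr (q + 2) / (q + 2)"

lemma ef_energy_minus: "ef_energy (\<lambda>t. - y t) (\<lambda>t. - y' t) t = ef_energy y y' t"
  by (simp add: ef_energy_def)

text \<open>An upper bound for the time in which an orbit of energy at least s^2 / 2 descends from u to 0.\<close>

definition travel_time :: "real \<Rightarrow> real \<Rightarrow> real" where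
  "travel_time s u = arsinh (low_rate * u / s) / low_rate + u / (mid_rate * low_height)"

lemma travel_time_minus: "travel_time s (- u) = - travel_time s u"
  by (simp add: travel_time_def arsinh_minus_real)

lemma travel_time_pos: "s > 0 \<Longrightarrow> u > 0 \<Longrightarrow> travel_time s u > 0"
  unfolding travel_time_def
  using low_rate_gt mid_rate_pos low_height_pos by (intro add_pos_pos) auto

lemma travel_time_strict_mono:
  assumes "s > 0"
  shows "strict_mono (travel_time s)"
proof (rule strict_monoI)
  fix u v :: real
  assume "u < v"
  then have "low_rate * u / s < low_rate * v / s"
    using low_rate_gt assms by (simp add: divide_strict_right_mono)
  then have "arsinh (low_rate * u / s) / low_rate < arsinh (low_rate * v / s) / low_rate"
    using low_rate_gt by (simp add: divide_strict_right_mono)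
  moreover have "u / (mid_rate * low_height) < v / (mid_rate * low_height)"
    using \<open>u < v\<close> mid_rate_pos low_height_pos by (simp add: divide_strict_right_mono)
  ultimately show "travel_time s u < travel_time s v" by (simp add: travel_time_def)
qed

lemma travel_time_deriv:
  assumes "s > 0"
  shows "(travel_time s has_real_derivative
    1 / sqrt (s\<^sup>2 + low_rate\<^sup>2 * u\<^sup>2) + 1 / (mid_rate * low_height)) (at u)"
proof -
  define R where "R = sqrt (s\<^sup>2 + low_rate\<^sup>2 * u\<^sup>2)"
  have "R > 0" unfolding R_def using assms by (auto intro!: add_pos_nonneg)
  have "sqrt ((low_rate * u / s)\<^sup>2 + 1) = sqrt ((s\<^sup>2 + low_rate\<^sup>2 * u\<^sup>2) / s\<^sup>2)"
    using assms by (simp add: field_simps power_mult_distrib power_divide)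
  also have "\<dots> = R / s" using assms by (simp add: R_def real_sqrt_divide)
  finally have root: "sqrt ((low_rate * u / s)\<^sup>2 + 1) = R / s" .
  have "((\<lambda>u. low_rate * u / s) has_real_derivative low_rate / s) (at u)"
    using assms by (auto intro!: derivative_eq_intros)
  from DERIV_chain2[OF arsinh_real_has_field_derivative this]
  have "((\<lambda>u. arsinh (low_rate * u / s) / low_rate) has_real_derivative 1 / R) (at u)"
    by (rule DERIV_cong[OF DERIV_cdivide]) (use assms low_rate_gt \<open>R > 0\<close> in \<open>simp add: root\<close>)
  then show ?thesis unfolding travel_time_def[abs_def] R_def[symmetric]
    by (rule DERIV_cong[OF DERIV_add[OF _ DERIV_cdivide[OF DERIV_ident]]]) simp
qed

lemma travel_time_height_le:
  assumes "t < 0"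
  shows "t + pi / return_freq + 2 * travel_time (sqrt gain_const * exp t) height
    \<le> (1 - 2 / low_rate) * t + delay_const"
proof -
  define x where "x = low_rate * height / (sqrt gain_const * exp t)"
  define K where "K = 2 * low_rate * height / sqrt gain_const + 1"
  have pos: "low_rate > 0" "sqrt gain_const > 0" using low_rate_gt gain_const_pos by auto
  have "K > 0" unfolding K_def using pos height_pos by (intro add_nonneg_pos) auto
  have "x \<ge> 0" using pos height_pos by (simp add: x_def)
  have "2 * x + 1 \<le> K * exp (- t)"
  proof -
    have "2 * x = 2 * low_rate * height / sqrt gain_const * exp (- t)"
      by (simp add: x_def exp_minus field_simps)
    moreover have "1 \<le> exp (- t)" using assms by simp
    ultimately show ?thesis by (simp add: K_def distrib_right)
  qed
  then have "arsinh x \<le> ln (K * exp (- t))"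
    using \<open>x \<ge> 0\<close> by (intro order_trans[OF arsinh_real_le_ln] ln_mono) auto
  also have "\<dots> = ln K - t" using \<open>K > 0\<close> by (simp add: ln_mult_pos)
  finally have "arsinh x / low_rate \<le> (ln K - t) / low_rate"
    using pos by (intro divide_right_mono) auto
  then show ?thesis
    unfolding travel_time_def delay_const_def x_def[symmetric] K_def[symmetric]
      diff_divide_distrib left_diff_distrib distrib_left by simp
qed

end

locale emden_fowler = emden_fowler_params +
  fixes y y' :: "real \<Rightarrow> real"
  assumes y_deriv: "t < 0 \<Longrightarrow> (y has_real_derivative y' t) (at t)"
    and y'_deriv: "t < 0 \<Longrightarrow> (y' has_real_derivative (m\<^sup>2 - phi t - \<bar>y t\<bar> powr q) * y t) (at t)"
begin

abbreviation Ey :: "real \<Rightarrow> real" where "Ey \<equiv> ef_energy y y'"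

lemma continuous_on_y: "b < 0 \<Longrightarrow> continuous_on {a..b} y"
  and continuous_on_y': "b < 0 \<Longrightarrow> continuous_on {a..b} y'"
  by (auto intro!: continuous_at_imp_continuous_on DERIV_isCont y_deriv y'_deriv)

lemma y_mono_if_y'_nonneg:
  assumes "a \<le> b" "b < 0" "\<And>t. t \<in> {a..b} \<Longrightarrow> y' t \<ge> 0"
  shows "y a \<le> y b"
proof (rule DERIV_nonneg_imp_nondecreasing[OF assms(1)])
  fix x assume "a \<le> x" "x \<le> b"
  then show "\<exists>z. (y has_real_derivative z) (at x) \<and> 0 \<le> z"
    using y_deriv[of x] assms(2,3) by (intro exI[of _ "y' x"]) auto
qed

lemma energy_deriv:
  assumes "t < 0"
  shows "(Ey has_real_derivative phi' t * (y t)\<^sup>2 / 2) (at t)"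
proof -
  have powr_deriv: "((\<lambda>t. \<bar>y t\<bar> powr (q + 2) / (q + 2))
      has_real_derivative (\<bar>y t\<bar> powr q * y t) * y' t) (at t)"
    using DERIV_chain2[OF has_real_derivative_abs_powr_primitive[OF exponent_pos] y_deriv[OF assms]] .
  show ?thesis unfolding ef_energy_def[abs_def]
    by (rule DERIV_cong, (rule DERIV_add DERIV_diff DERIV_mult DERIV_power DERIV_cdivide DERIV_cmult
          y_deriv y'_deriv phi_deriv powr_deriv assms)+)
       (simp add: algebra_simps power2_eq_square add_divide_distrib diff_divide_distrib)
qed

lemma energy_mono:
  assumes "s \<le> t" "t < 0"
  shows "Ey s \<le> Ey t"
proof (rule DERIV_nonneg_imp_nondecreasing[OF assms(1)])
  fix x assume "s \<le> x" "x \<le> t"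
  then have "x < 0" using assms by simp
  then show "\<exists>z. (Ey has_real_derivative z) (at x) \<and> 0 \<le> z"
    using energy_deriv phi'_pos[of x] by (intro exI[of _ "phi' x * (y x)\<^sup>2 / 2"]) auto
qed

lemma speed_sq_eq: "(y' t)\<^sup>2 = 2 * Ey t + (m\<^sup>2 - phi t - 2 * \<bar>y t\<bar> powr q / (q + 2)) * (y t)\<^sup>2"
  using exponent_pos by (simp add: ef_energy_def abs_powr_plus_2 algebra_simps)

lemma speed_sq_ge:
  assumes "t \<le> - onset" and "2 * \<bar>y t\<bar> powr q / (q + 2) \<le> m\<^sup>2 - phi_bound - rate\<^sup>2"
  shows "(y' t)\<^sup>2 \<ge> 2 * Ey t + rate\<^sup>2 * (y t)\<^sup>2"
proof -
  have "m\<^sup>2 - phi t - 2 * \<bar>y t\<bar> powr q / (q + 2) \<ge> rate\<^sup>2"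
    using phi_le_phi_bound[OF assms(1)] assms(2) by linarith
  then have "rate\<^sup>2 * (y t)\<^sup>2 \<le> (m\<^sup>2 - phi t - 2 * \<bar>y t\<bar> powr q / (q + 2)) * (y t)\<^sup>2"
    by (intro mult_right_mono) auto
  then show ?thesis by (simp only: speed_sq_eq)
qed

lemma speed_sq_ge_mid:
  assumes "t \<le> - onset" "\<bar>y t\<bar> \<le> height"
  shows "(y' t)\<^sup>2 \<ge> 2 * Ey t + mid_rate\<^sup>2 * (y t)\<^sup>2"
proof (rule speed_sq_ge[OF assms(1)])
  have "\<bar>y t\<bar> powr q \<le> m\<^sup>2 * (1 + q / 4)"
    unfolding height_powr[symmetric] using assms exponent_pos by (intro powr_mono2) auto
  then have "2 * \<bar>y t\<bar> powr q / (q + 2) \<le> 2 * (m\<^sup>2 * (1 + q / 4)) / (q + 2)"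
    using exponent_pos by (intro divide_right_mono) auto
  also have "\<dots> = m\<^sup>2 - 2 * mid_rate\<^sup>2" using exponent_pos by (simp add: mid_rate_sq field_simps)
  also have "\<dots> \<le> m\<^sup>2 - phi_bound - mid_rate\<^sup>2" by (simp add: phi_bound_def)
  finally show "2 * \<bar>y t\<bar> powr q / (q + 2) \<le> m\<^sup>2 - phi_bound - mid_rate\<^sup>2" .
qed

lemma speed_sq_ge_low:
  assumes "t \<le> - onset" "\<bar>y t\<bar> \<le> low_height"
  shows "(y' t)\<^sup>2 \<ge> 2 * Ey t + low_rate\<^sup>2 * (y t)\<^sup>2"
proof (rule speed_sq_ge[OF assms(1)])
  have bound: "phi_bound \<le> (m\<^sup>2 - low_rate\<^sup>2) / 2" unfolding phi_bound_def by (rule min.cobounded2)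
  have "2 * \<bar>y t\<bar> powr q / (q + 2) \<le> \<bar>y t\<bar> powr q"
    using exponent_pos by (simp add: field_simps)
  also have "\<dots> \<le> (m\<^sup>2 - low_rate\<^sup>2) / 2"
    unfolding low_height_powr[symmetric] using assms exponent_pos by (intro powr_mono2) auto
  also have "\<dots> \<le> m\<^sup>2 - phi_bound - low_rate\<^sup>2"
    using bound by (simp add: field_simps)
  finally show "2 * \<bar>y t\<bar> powr q / (q + 2) \<le> m\<^sup>2 - phi_bound - low_rate\<^sup>2" .
qed

lemma energy_pos_if_vanishing_at_bot:
  assumes y_lim: "(y \<longlongrightarrow> 0) at_bot" and y'_lim: "(y' \<longlongrightarrow> 0) at_bot" and phi_lim: "(phi \<longlongrightarrow> 0) at_bot"
    and nonzero: "\<forall>\<^sub>F t in at_bot. y t \<noteq> 0" and "t < 0"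
  shows "Ey t > 0"
proof -
  have "(Ey \<longlongrightarrow> 0\<^sup>2 / 2 - m\<^sup>2 * 0\<^sup>2 / 2 + 0 * 0\<^sup>2 / 2 + \<bar>0\<bar> powr (q + 2) / (q + 2)) at_bot"
    unfolding ef_energy_def[abs_def] using exponent_pos
    by (intro tendsto_intros y_lim y'_lim phi_lim) (auto intro!: tendsto_eq_intros y_lim)
  then have Ey_lim: "(Ey \<longlongrightarrow> 0) at_bot" by simp
  have Ey_nonneg: "Ey s \<ge> 0" if "s < 0" for s
  proof (rule tendsto_upperbound[OF Ey_lim])
    show "\<forall>\<^sub>F r in at_bot. Ey r \<le> Ey s"
      using eventually_gt_at_bot[of s] by eventually_elim (use energy_mono that in auto)
  qed simp
  obtain s where s: "s < t" "y s \<noteq> 0" using eventually_at_bot_ex_less[OF nonzero] .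
  then have "phi' s * (y s)\<^sup>2 / 2 > 0" using phi'_pos[of s] \<open>t < 0\<close> by simp
  then obtain d where d: "d > 0" "\<And>h. 0 < h \<Longrightarrow> h < d \<Longrightarrow> Ey s < Ey (s + h)"
    using DERIV_pos_inc_right[OF energy_deriv[of s]] s \<open>t < 0\<close> by auto
  define h where "h = min (d / 2) (t - s)"
  have "0 \<le> Ey s" using Ey_nonneg s \<open>t < 0\<close> by simp
  also have "\<dots> < Ey (s + h)" by (rule d(2)) (use d(1) s in \<open>auto simp: h_def\<close>)
  also have "\<dots> \<le> Ey t" by (rule energy_mono) (use \<open>t < 0\<close> in \<open>auto simp: h_def\<close>)
  finally show ?thesis .
qed

end

locale emden_fowler_positive_energy = emden_fowler +
  assumes energy_pos: "t < 0 \<Longrightarrow> Ey t > 0"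
begin

lemma reflection: "emden_fowler_positive_energy m mu q (\<lambda>t. - y t) (\<lambda>t. - y' t)"
proof -
  interpret reflected: emden_fowler m mu q "\<lambda>t. - y t" "\<lambda>t. - y' t"
    by unfold_locales (auto intro!: derivative_eq_intros y_deriv y'_deriv)
  show ?thesis
    by unfold_locales (use energy_pos in \<open>simp add: ef_energy_minus\<close>)
qed

lemma mid_rate_less_speed:
  assumes "t \<le> - onset" "\<bar>y t\<bar> \<le> height"
  shows "mid_rate * \<bar>y t\<bar> < \<bar>y' t\<bar>"
proof -
  have "(mid_rate * \<bar>y t\<bar>)\<^sup>2 < \<bar>y' t\<bar>\<^sup>2"
    using speed_sq_ge_mid[OF assms] energy_pos[of t] assms(1) onset_pos
    by (simp add: power_mult_distrib)
  then show ?thesis by (rule power2_less_imp_less) simp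
qed

lemma y'_nonzero: "t \<le> - onset \<Longrightarrow> \<bar>y t\<bar> \<le> height \<Longrightarrow> y' t \<noteq> 0"
  using mid_rate_less_speed[of t] mid_rate_pos by (auto simp: mult_less_0_iff)

lemma ascending_run:
  assumes "s \<le> t" "t \<le> - onset" "y' s > 0" "- height \<le> y s"
    and below: "\<And>x. x \<in> {s..t} \<Longrightarrow> y x \<le> height"
  shows "y' t > 0"
proof (rule ccontr)
  assume "\<not> y' t > 0"
  moreover have "continuous_on {s..t} (\<lambda>x. - y' x)"
    using continuous_on_y'[of t s] assms onset_pos by (intro continuous_intros) auto
  ultimately obtain u where u: "s < u" "u \<le> t" "y' u = 0" "\<And>x. s \<le> x \<Longrightarrow> x < u \<Longrightarrow> y' x > 0"
    using first_root[of s t "\<lambda>x. - y' x"] assms by auto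
  have "y' x \<ge> 0" if "x \<in> {s..u}" for x
    using u(3) u(4)[of x] that by (cases "x = u") auto
  then have "y s \<le> y u" using u assms onset_pos by (intro y_mono_if_y'_nonneg) auto
  then have "\<bar>y u\<bar> \<le> height" using below[of u] u assms(4) by auto
  then show False using y'_nonzero[of u] u assms by auto
qed

lemma descending_run:
  assumes "s \<le> t" "t \<le> - onset" "y' s < 0" "y s \<le> height"
    and "\<And>x. x \<in> {s..t} \<Longrightarrow> - height \<le> y x"
  shows "y' t < 0"
proof -
  interpret reflected: emden_fowler_positive_energy m mu q "\<lambda>t. - y t" "\<lambda>t. - y' t"
    by (rule reflection)
  show ?thesis using reflected.ascending_run[of s t] assms by force
qed

text \<open>Sturm comparison with sin (return_freq (t - t0)).\<close>

lemma returns_below_height: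
  assumes "t0 + pi / return_freq < 0"
  shows "\<exists>t\<in>{t0..t0 + pi / return_freq}. y t < height"
proof (rule ccontr)
  assume "\<not> ?thesis"
  then have above: "y t \<ge> height" if "t \<in> {t0..t0 + pi / return_freq}" for t using that by force
  define k where "k = return_freq"
  have "k > 0" by (simp add: k_def return_freq_pos)
  define W where "W t = y' t * sin (k * (t - t0)) - k * y t * cos (k * (t - t0))" for t
  have "W (t0 + pi / k) \<le> W t0"
  proof (rule DERIV_nonpos_imp_nonincreasing[where f = W])
    fix x assume x: "t0 \<le> x" "x \<le> t0 + pi / k"
    then have "x < 0" using assms by (simp add: k_def)
    have yx: "y x \<ge> height" using above[of x] x by (simp add: k_def)
    then have "height powr q \<le> \<bar>y x\<bar> powr q" using height_pos exponent_pos by (intro powr_mono2) auto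
    then have "m\<^sup>2 - phi x - \<bar>y x\<bar> powr q + k\<^sup>2 \<le> 0"
      using phi_nonneg[of x] m_gt_2 exponent_pos
      unfolding height_powr by (simp add: k_def return_freq_def field_simps)
    then have "(m\<^sup>2 - phi x - \<bar>y x\<bar> powr q + k\<^sup>2) * y x \<le> 0"
      using yx height_pos by (intro mult_nonpos_nonneg) auto
    moreover have "sin (k * (x - t0)) \<ge> 0"
      using x \<open>k > 0\<close> by (intro sin_ge_zero) (auto simp: field_simps)
    ultimately have "(m\<^sup>2 - phi x - \<bar>y x\<bar> powr q + k\<^sup>2) * y x * sin (k * (x - t0)) \<le> 0"
      by (rule mult_nonpos_nonneg)
    moreover have "(W has_real_derivative (m\<^sup>2 - phi x - \<bar>y x\<bar> powr q + k\<^sup>2) * y x * sin (k * (x - t0))) (at x)"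
      unfolding W_def[abs_def]
      by (rule derivative_eq_intros y_deriv y'_deriv \<open>x < 0\<close> refl)+
         (simp add: algebra_simps power2_eq_square)
    ultimately show "\<exists>z. (W has_real_derivative z) (at x) \<and> z \<le> 0" by blast
  qed (use \<open>k > 0\<close> in auto)
  moreover have "W t0 = - k * y t0" "W (t0 + pi / k) = k * y (t0 + pi / k)"
    using \<open>k > 0\<close> by (simp_all add: W_def)
  moreover have "k * y t0 > 0" "k * y (t0 + pi / k) > 0"
    using \<open>k > 0\<close> height_pos above[of t0] above[of "t0 + pi / k"]
      by (auto simp: k_def intro!: mult_pos_pos)
  ultimately show False by simp
qed

lemma travel_time_speed_ge_1:
  assumes "s\<^sup>2 \<le> 2 * Ey t" "t \<le> - onset" "\<bar>y t\<bar> \<le> height" "s > 0"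
  shows "(1 / sqrt (s\<^sup>2 + low_rate\<^sup>2 * (y t)\<^sup>2) + 1 / (mid_rate * low_height)) * \<bar>y' t\<bar> \<ge> 1"
proof (cases "\<bar>y t\<bar> \<le> low_height")
  case True
  define R where "R = sqrt (s\<^sup>2 + low_rate\<^sup>2 * (y t)\<^sup>2)"
  have "R > 0" unfolding R_def using \<open>s > 0\<close> by (auto intro!: add_pos_nonneg)
  have "s\<^sup>2 + low_rate\<^sup>2 * (y t)\<^sup>2 \<le> \<bar>y' t\<bar>\<^sup>2" using speed_sq_ge_low[OF assms(2) True] assms(1)
    by simp
  then have "R \<le> \<bar>y' t\<bar>" unfolding R_def by (intro real_le_lsqrt) auto
  then have "1 \<le> 1 / R * \<bar>y' t\<bar>" using \<open>R > 0\<close> by (simp add: field_simps)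
  moreover have "0 \<le> 1 / (mid_rate * low_height) * \<bar>y' t\<bar>" using mid_rate_pos low_height_pos by simp
  ultimately show ?thesis by (simp only: distrib_right R_def[symmetric])
next
  case False
  then have "mid_rate * low_height \<le> mid_rate * \<bar>y t\<bar>" using mid_rate_pos
    by (intro mult_left_mono) auto
  also have "\<dots> \<le> \<bar>y' t\<bar>" using mid_rate_less_speed[OF assms(2,3)] by simp
  finally have "1 \<le> 1 / (mid_rate * low_height) * \<bar>y' t\<bar>"
    using mid_rate_pos low_height_pos by (simp add: field_simps)
  moreover have "0 \<le> 1 / sqrt (s\<^sup>2 + low_rate\<^sup>2 * (y t)\<^sup>2) * \<bar>y' t\<bar>" by simp
  ultimately show ?thesis by (simp only: distrib_right)
qed

lemma descends_to_minus_height: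
  assumes s: "s > 0" "s\<^sup>2 \<le> 2 * Ey t0" and start: "y t0 \<le> height" "y' t0 < 0"
    and early: "t0 + 2 * travel_time s height \<le> - onset"
  shows "\<exists>t\<in>{t0..t0 + 2 * travel_time s height}. y t \<le> - height"
proof (rule ccontr)
  assume not_thesis: "\<not> ?thesis"
  define t1 where "t1 = t0 + 2 * travel_time s height"
  have "t0 \<le> t1" using travel_time_pos[OF s(1) height_pos] by (simp add: t1_def)
  have above: "y t > - height" if "t \<in> {t0..t1}" for t
    using not_thesis that unfolding t1_def by force
  have descending: "y' t < 0" if "t \<in> {t0..t1}" for t
    by (rule descending_run[of t0 t]) (use that above start early in \<open>force simp: t1_def\<close>)+
  interpret reflected: emden_fowler_positive_energy m mu q "\<lambda>t. - y t" "\<lambda>t. - y' t"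
    by (rule reflection)
  have below: "y t \<le> y t0" if "t \<in> {t0..t1}" for t
    using reflected.y_mono_if_y'_nonneg[of t0 t] descending that early onset_pos
    by (force simp: t1_def)
  have "travel_time s (y t1) + t1 \<le> travel_time s (y t0) + t0"
  proof (rule DERIV_nonpos_imp_nonincreasing[where f = "\<lambda>t. travel_time s (y t) + t", OF \<open>t0 \<le> t1\<close>])
    fix x assume x: "t0 \<le> x" "x \<le> t1"
    then have "x \<le> - onset" "x < 0" using early onset_pos by (auto simp: t1_def)
    define D where "D = 1 / sqrt (s\<^sup>2 + low_rate\<^sup>2 * (y x)\<^sup>2) + 1 / (mid_rate * low_height)"
    have "s\<^sup>2 \<le> 2 * Ey x" using s(2) energy_mono[of t0 x] x \<open>x < 0\<close> by linarith
    moreover have "\<bar>y x\<bar> \<le> height" using above[of x] below[of x] x start(1) by auto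
    ultimately have "D * \<bar>y' x\<bar> \<ge> 1" unfolding D_def
      using \<open>x \<le> - onset\<close> s(1) by (intro travel_time_speed_ge_1)
    then have "D * y' x + 1 \<le> 0" using descending[of x] x by simp
    moreover have "((\<lambda>t. travel_time s (y t) + t) has_real_derivative D * y' x + 1) (at x)"
      unfolding D_def
      by (intro DERIV_add DERIV_ident DERIV_chain2[OF travel_time_deriv[OF s(1)] y_deriv] \<open>x < 0\<close>)
    ultimately show "\<exists>z. ((\<lambda>t. travel_time s (y t) + t) has_real_derivative z) (at x) \<and> z \<le> 0"
      by blast
  qed
  then have "travel_time s (y t1) \<le> travel_time s (y t0) - 2 * travel_time s height"
    by (simp add: t1_def)
  also have "travel_time s (y t0) \<le> travel_time s height"
    using start(1) travel_time_strict_mono[OF s(1)] by (simp add: strict_mono_less_eq)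
  finally have "travel_time s (y t1) \<le> travel_time s (- height)" by (simp add: travel_time_minus)
  then have "y t1 \<le> - height" using travel_time_strict_mono[OF s(1)]
    by (simp add: strict_mono_less_eq)
  then show False using above[of t1] \<open>t0 \<le> t1\<close> by auto
qed

lemma crossing_time_bounds:
  assumes "t0 < t1" "t1 \<le> - onset" "y t0 = height / 2" "y t1 = height"
    and band: "\<And>t. t \<in> {t0..t1} \<Longrightarrow> height / 2 \<le> y t \<and> y t \<le> height" and "Ey t1 \<le> 1"
  shows "height / (2 * max_speed) \<le> t1 - t0" "t1 - t0 \<le> 1 / mid_rate"
proof -
  obtain u where u: "t0 < u" "u < t1" "y t1 - y t0 = (t1 - t0) * y' u"
    using MVT2[OF assms(1), of y y'] y_deriv assms(2) onset_pos by fastforce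
  then have crossing: "height / 2 = (t1 - t0) * y' u" using assms by simp
  have "u \<le> - onset" "u < 0" using u assms onset_pos by auto
  have "y' u > 0"
    using crossing height_pos assms(1) by (metis diff_gt_0_iff_gt half_gt_zero zero_less_mult_pos)
  have band_u: "height / 2 \<le> y u" "y u \<le> height" using band[of u] u by auto
  have "y' u \<le> max_speed"
  proof (rule power2_le_imp_le)
    have "2 * \<bar>y u\<bar> powr q / (q + 2) \<ge> 0" using exponent_pos by simp
    then have "(m\<^sup>2 - phi u - 2 * \<bar>y u\<bar> powr q / (q + 2)) * (y u)\<^sup>2 \<le> m\<^sup>2 * (y u)\<^sup>2"
      using phi_nonneg[of u] by (intro mult_right_mono) auto
    then have "(y' u)\<^sup>2 \<le> 2 * Ey u + m\<^sup>2 * (y u)\<^sup>2" by (simp only: speed_sq_eq)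
    also have "\<dots> \<le> 2 * 1 + m\<^sup>2 * height\<^sup>2"
      using energy_mono[of u t1] u assms(2,6) onset_pos band_u height_pos
      by (intro add_mono mult_left_mono power_mono) auto
    finally show "(y' u)\<^sup>2 \<le> max_speed\<^sup>2" by (simp add: max_speed_def add_nonneg_nonneg)
  qed (use max_speed_pos in simp)
  then have "height / 2 \<le> (t1 - t0) * max_speed"
    unfolding crossing using assms(1) by (intro mult_left_mono) auto
  then show "height / (2 * max_speed) \<le> t1 - t0" using max_speed_pos by (simp add: field_simps)
  have "mid_rate * (height / 2) \<le> mid_rate * \<bar>y u\<bar>"
    using band_u height_pos mid_rate_pos by (intro mult_left_mono) auto
  also have "\<dots> \<le> y' u"
    using mid_rate_less_speed[OF \<open>u \<le> - onset\<close>] band_u height_pos \<open>y' u > 0\<close> by simp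
  finally have "(t1 - t0) * (mid_rate * (height / 2)) \<le> (t1 - t0) * y' u"
    using assms(1) by (intro mult_left_mono) auto
  then have "(t1 - t0) * mid_rate * (height / 2) \<le> 1 * (height / 2)" using crossing by simp
  then have "(t1 - t0) * mid_rate \<le> 1" by (rule mult_right_le_imp_le) (use height_pos in simp)
  then show "t1 - t0 \<le> 1 / mid_rate" using mid_rate_pos by (simp add: pos_le_divide_eq)
qed

lemma crossing_energy_gain:
  assumes "t0 < t1" "t1 \<le> - onset" "y t0 = height / 2" "y t1 = height"
    and band: "\<And>t. t \<in> {t0..t1} \<Longrightarrow> height / 2 \<le> y t \<and> y t \<le> height"
  shows "Ey t1 \<ge> gain_const * exp (2 * t1)"
proof (cases "Ey t1 \<le> 1")
  case False
  have "gain_const * exp (2 * t1) \<le> 1 * 1"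
    using assms(2) onset_pos gain_const_pos gain_const_le_1 by (intro mult_mono) auto
  then show ?thesis using False by simp
next
  case True
  note duration = crossing_time_bounds[OF assms True]
  obtain x where x: "t0 < x" "x < t1" "Ey t1 - Ey t0 = (t1 - t0) * (phi' x * (y x)\<^sup>2 / 2)"
    using MVT2[OF assms(1), of Ey "\<lambda>t. phi' t * (y t)\<^sup>2 / 2"] energy_deriv assms(2) onset_pos
      by fastforce
  have "x < 0" using x assms(2) onset_pos by simp
  define e where "e = exp (2 * t1 - 2 / mid_rate)"
  have "2 * t1 - 2 / mid_rate \<le> 2 * x" using x(1) duration(2) by simp
  then have "8 * mu * e \<le> 8 * mu * exp (2 * x)" using mu_pos by (simp add: e_def)
  also have "\<dots> \<le> phi' x" by (rule phi'_ge[OF \<open>x < 0\<close>])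
  finally have "8 * mu * e \<le> phi' x" .
  moreover have "(height / 2)\<^sup>2 \<le> (y x)\<^sup>2"
    using band[of x] x height_pos by (intro power_mono) auto
  ultimately have "8 * mu * e * (height / 2)\<^sup>2 / 2 \<le> phi' x * (y x)\<^sup>2 / 2"
    using phi'_pos[OF \<open>x < 0\<close>] by (intro divide_right_mono mult_mono) auto
  then have "height / (2 * max_speed) * (8 * mu * e * (height / 2)\<^sup>2 / 2) \<le> Ey t1 - Ey t0"
    unfolding x(3) using duration(1) assms(1) mu_pos by (intro mult_mono) (auto simp: e_def)
  also have "\<dots> \<le> Ey t1" using energy_pos[of t0] assms(1,2) onset_pos by simp
  finally have "mu * height ^ 3 / (2 * max_speed) * e \<le> Ey t1"
    by (simp add: field_simps power2_eq_square eval_nat_numeral)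
  moreover have "e = exp (- 2 / mid_rate) * exp (2 * t1)" by (simp add: e_def exp_add[symmetric])
  ultimately have "mu * height ^ 3 / (2 * max_speed) * exp (- 2 / mid_rate) * exp (2 * t1) \<le> Ey t1"
    by (simp only: mult.assoc)
  moreover have "gain_const * exp (2 * t1)
      \<le> mu * height ^ 3 / (2 * max_speed) * exp (- 2 / mid_rate) * exp (2 * t1)"
    unfolding gain_const_def by (intro mult_right_mono) auto
  ultimately show ?thesis by linarith
qed

lemma first_passage_at_height:
  assumes "a < b" "b \<le> - onset" "y a \<le> height / 2" "y b \<ge> height"
  obtains t where "a < t" "t \<le> b" "y t = height" "Ey t \<ge> gain_const * exp (2 * t)"
proof -
  have cont: "continuous_on {a..x} y" if "x \<le> b" for x
    using continuous_on_y[of x a] that assms onset_pos by auto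
  have "continuous_on {a..b} (\<lambda>t. y t - height)" by (intro continuous_intros cont) simp
  then obtain t1 where t1: "a < t1" "t1 \<le> b" "y t1 = height" "\<And>s. a \<le> s \<Longrightarrow> s < t1 \<Longrightarrow> y s < height"
    using assms height_pos by (auto elim: first_root[of a b "\<lambda>t. y t - height"])
  have "continuous_on {a..t1} (\<lambda>t. height / 2 - y t)" by (intro continuous_intros cont t1)
  then obtain t0 where t0: "a \<le> t0" "t0 < t1" "y t0 = height / 2"
    "\<And>s. t0 < s \<Longrightarrow> s \<le> t1 \<Longrightarrow> y s > height / 2"
    using assms height_pos t1 by (auto elim: last_root[of a t1 "\<lambda>t. height / 2 - y t"])
  have "height / 2 \<le> y t \<and> y t \<le> height" if "t \<in> {t0..t1}" for t
    using t0(3) t0(4)[of t] t1(3) t1(4)[of t] t0(1) that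
    by (cases "t = t0"; cases "t = t1") (auto simp: less_imp_le)
  then have "Ey t1 \<ge> gain_const * exp (2 * t1)" using t0 t1 assms
    by (intro crossing_energy_gain[of t0]) auto
  then show ?thesis using t1 that by blast
qed

lemma downward_crossing:
  assumes "y t0 \<ge> height" "t0 + pi / return_freq \<le> - onset"
  obtains t where "t0 \<le> t" "t \<le> t0 + pi / return_freq" "y t = height" "y' t < 0"
proof -
  obtain u where u: "t0 \<le> u" "u \<le> t0 + pi / return_freq" "y u < height"
    using returns_below_height[of t0] assms(2) onset_pos by auto
  have "continuous_on {t0..u} (\<lambda>t. y t - height)"
    using u assms(2) onset_pos by (intro continuous_intros continuous_on_y) simp
  then obtain t where t: "t0 \<le> t" "t < u" "y t = height" "\<And>s. t < s \<Longrightarrow> s \<le> u \<Longrightarrow> y s < height"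
    using u assms(1) by (auto elim: last_root[of t0 u "\<lambda>t. y t - height"])
  have "t \<le> - onset" "t < 0" using t u assms(2) onset_pos by auto
  have "\<not> y' t > 0"
  proof
    assume "y' t > 0"
    then obtain d where d: "d > 0" "\<And>h. 0 < h \<Longrightarrow> h < d \<Longrightarrow> y t < y (t + h)"
      using DERIV_pos_inc_right[OF y_deriv[OF \<open>t < 0\<close>]] by auto
    define h where "h = min (d / 2) (u - t)"
    have "0 < h" "h < d" "t + h \<le> u" using d t by (auto simp: h_def)
    then show False using d(2)[of h] t(3) t(4)[of "t + h"] by auto
  qed
  moreover have "y' t \<noteq> 0" using y'_nonzero[OF \<open>t \<le> - onset\<close>] t height_pos by auto
  ultimately show ?thesis using that[of t] t u by auto
qed

lemma next_crossing_of_minus_height: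
  assumes start: "y t0 \<ge> height" "Ey t0 \<ge> gain_const * exp (2 * t0)" "t0 < 0"
    and early: "(1 - 2 / low_rate) * t0 + delay_const \<le> - onset"
  obtains t where "t0 < t" "t \<le> (1 - 2 / low_rate) * t0 + delay_const" "y t = - height"
    "Ey t \<ge> gain_const * exp (2 * t)"
proof -
  define s where "s = sqrt gain_const * exp t0"
  have s: "s > 0" "s\<^sup>2 = gain_const * exp (2 * t0)"
    using gain_const_pos by (simp_all add: s_def power_mult_distrib exp_double)
  have time: "t0 + pi / return_freq + 2 * travel_time s height
      \<le> (1 - 2 / low_rate) * t0 + delay_const"
    unfolding s_def by (rule travel_time_height_le[OF start(3)])
  have "travel_time s height > 0" by (rule travel_time_pos[OF s(1) height_pos])
  then have "t0 + pi / return_freq \<le> - onset" using time early by linarith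
  then obtain t1 where t1: "t0 \<le> t1" "t1 \<le> t0 + pi / return_freq" "y t1 = height" "y' t1 < 0"
    by (rule downward_crossing[OF start(1)])
  have fall: "t1 + 2 * travel_time s height \<le> - onset" using t1 time early by linarith
  then have "t1 < 0" using \<open>travel_time s height > 0\<close> onset_pos by linarith
  have "s\<^sup>2 \<le> 2 * Ey t1"
    using start(2) s(2) energy_mono[OF t1(1) \<open>t1 < 0\<close>] energy_pos[OF \<open>t1 < 0\<close>] by linarith
  then obtain u where u: "t1 \<le> u" "u \<le> t1 + 2 * travel_time s height" "y u \<le> - height"
    using descends_to_minus_height[OF s(1) _ _ t1(4) fall] t1(3) by auto
  interpret reflected: emden_fowler_positive_energy m mu q "\<lambda>t. - y t" "\<lambda>t. - y' t"
    by (rule reflection)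
  have "t1 \<noteq> u" using t1 u height_pos by auto
  then obtain t where "t1 < t" "t \<le> u" "- y t = height" "reflected.Ey t \<ge> gain_const * exp (2 * t)"
    using reflected.first_passage_at_height[of t1 u] u t1 height_pos fall by auto
  then show ?thesis using that[of t] t1 u time by (auto simp: ef_energy_minus)
qed

lemma next_crossing:
  assumes start: "\<bar>y t0\<bar> \<ge> height" "Ey t0 \<ge> gain_const * exp (2 * t0)" "t0 < 0"
    and "(1 - 2 / low_rate) * t0 + delay_const \<le> - onset"
  obtains t where "t0 < t" "t \<le> (1 - 2 / low_rate) * t0 + delay_const" "y t * y t0 < 0"
    "\<bar>y t\<bar> = height" "Ey t \<ge> gain_const * exp (2 * t)"
proof (cases "y t0 \<ge> 0")
  case True
  then obtain t where "t0 < t" "t \<le> (1 - 2 / low_rate) * t0 + delay_const" "y t = - height"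
    "Ey t \<ge> gain_const * exp (2 * t)"
    using next_crossing_of_minus_height[of t0] assms by auto
  then show ?thesis using that[of t] True start(1) height_pos by auto
next
  case False
  interpret reflected: emden_fowler_positive_energy m mu q "\<lambda>t. - y t" "\<lambda>t. - y' t"
    by (rule reflection)
  obtain t where "t0 < t" "t \<le> (1 - 2 / low_rate) * t0 + delay_const" "y t = height"
    "Ey t \<ge> gain_const * exp (2 * t)"
    using reflected.next_crossing_of_minus_height[of t0] assms False by (auto simp: ef_energy_minus)
  then show ?thesis using that[of t] False start(1) height_pos by (auto simp: mult_pos_neg)
qed

lemma ascending_from_minus_infinity:
  assumes "s \<le> - onset" and band: "\<And>t. t \<le> s \<Longrightarrow> 0 < y t \<and> y t < height" and lim: "(y \<longlongrightarrow> 0) at_bot"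
  shows "y' s > 0"
proof -
  have "\<forall>\<^sub>F t in at_bot. y t < y s" using lim band[of s] by (intro order_tendstoD(2)[OF lim]) simp
  then obtain a where a: "a < s" "y a < y s" by (rule eventually_at_bot_ex_less)
  obtain x where x: "a < x" "x < s" "y s - y a = (s - a) * y' x"
    using MVT2[OF a(1), of y y'] y_deriv assms(1) onset_pos by fastforce
  then have "(s - a) * y' x > 0" using a by simp
  then have "y' x > 0" using a(1) by (simp add: zero_less_mult_iff)
  moreover have "- height \<le> y x" using band[of x] x height_pos by simp
  ultimately show ?thesis using ascending_run[of x s] band x assms(1) by (auto simp: less_imp_le)
qed

lemma reaches_height:
  assumes "c > 0" "y s \<ge> c" "s + height / (mid_rate * c) \<le> - onset"
    and pos: "\<And>t. t \<le> s \<Longrightarrow> y t > 0" and lim: "(y \<longlongrightarrow> 0) at_bot"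
  shows "\<exists>t\<le>s + height / (mid_rate * c). y t \<ge> height"
proof (rule ccontr)
  assume not_thesis: "\<not> ?thesis"
  define l where "l = height / (mid_rate * c)"
  have "l > 0" using height_pos mid_rate_pos assms(1) by (simp add: l_def)
  have below: "y t < height" if "t \<le> s + l" for t
    using not_thesis that unfolding l_def by force
  have "s \<le> - onset" using assms(3) \<open>l > 0\<close> by (simp add: l_def)
  then have "y' s > 0"
    using ascending_from_minus_infinity[OF _ _ lim] pos below \<open>l > 0\<close> by auto
  then have ascending: "y' t > 0" if "t \<in> {s..s + l}" for t
    using ascending_run[of s t] below assms that height_pos by (force simp: l_def less_imp_le)
  have above: "y t \<ge> c" if "t \<in> {s..s + l}" for t
    using y_mono_if_y'_nonneg[of s t] ascending that assms(2,3) onset_pos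
      by (force simp: l_def less_imp_le)
  obtain x where x: "s < x" "x < s + l" "y (s + l) - y s = l * y' x"
    using MVT2[of s "s + l" y y'] y_deriv assms(3) onset_pos \<open>l > 0\<close> by (force simp: l_def)
  have "mid_rate * c \<le> mid_rate * \<bar>y x\<bar>"
    using above[of x] x mid_rate_pos assms(1) by (intro mult_left_mono) auto
  also have "\<dots> \<le> y' x"
    using mid_rate_less_speed[of x] ascending[of x] above[of x] below[of x] x assms
      by (auto simp: l_def)
  finally have "l * (mid_rate * c) \<le> l * y' x" using \<open>l > 0\<close> by simp
  moreover have "l * (mid_rate * c) = height" using mid_rate_pos assms(1) by (simp add: l_def)
  ultimately have "y (s + l) \<ge> height" using x assms by simp
  then show False using below[of "s + l"] by simp
qed

lemma first_crossing_of_height: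
  assumes "c > 0" "y s \<ge> c" "s + height / (mid_rate * c) \<le> - onset"
    and "\<And>t. t \<le> s \<Longrightarrow> y t > 0" and lim: "(y \<longlongrightarrow> 0) at_bot"
  obtains t where "t \<le> s + height / (mid_rate * c)" "y t = height" "Ey t \<ge> gain_const * exp (2 * t)"
proof -
  obtain b where b: "b \<le> s + height / (mid_rate * c)" "y b \<ge> height"
    using reaches_height[OF assms] by blast
  have "\<forall>\<^sub>F t in at_bot. y t < height / 2" using height_pos by (intro order_tendstoD(2)[OF lim]) simp
  then obtain a where "a < b" "y a < height / 2" by (rule eventually_at_bot_ex_less)
  then show ?thesis using first_passage_at_height[of a b] b assms(3) that by force
qed

end

section \<open>The radial equation\<close>

text \<open>The equation w'' + d coth r w' + lam w + |w|^q w = 0.\<close>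

locale radial_equation =
  fixes d :: nat and q lam :: real
  assumes d_ge_1: "d \<ge> 1" and q_pos: "q > 0" and lam_pos: "lam > 0"
begin

sublocale flux_weight "\<lambda>r. sinh r ^ d" "\<lambda>r. real d * sinh r ^ (d - 1) * cosh r"
  by unfold_locales (auto intro!: continuous_intros derivative_eq_intros)

lemma weight_log_deriv:
  "r > 0 \<Longrightarrow> real d * sinh r ^ (d - 1) * cosh r / sinh r ^ d = real d * (cosh r / sinh r)"
  using d_ge_1 by (cases d) auto

definition nonlin :: "real \<Rightarrow> real" where
  "nonlin u = lam * u + \<bar>u\<bar> powr q * u"

definition potential :: "real \<Rightarrow> real" where
  "potential u = lam * u\<^sup>2 / 2 + \<bar>u\<bar> powr (q + 2) / (q + 2)"

lemma nonlin_deriv: "(nonlin has_real_derivative lam + (q + 1) * \<bar>u\<bar> powr q) (at u)"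
  unfolding nonlin_def[abs_def]
  by (rule DERIV_cong, (rule DERIV_add DERIV_cmult DERIV_ident has_real_derivative_abs_powr_mult q_pos)+) simp

lemma potential_deriv: "(potential has_real_derivative nonlin u) (at u)"
proof -
  have "((\<lambda>u. lam * u\<^sup>2 / 2) has_real_derivative lam * u) (at u)"
    by (auto intro!: derivative_eq_intros)
  from DERIV_add[OF this has_real_derivative_abs_powr_primitive[OF q_pos]]
  show ?thesis by (simp add: potential_def[abs_def] nonlin_def)
qed

lemma continuous_on_nonlin: "continuous_on S nonlin"
  by (auto intro!: continuous_at_imp_continuous_on DERIV_isCont[OF nonlin_deriv])

lemma continuous_on_potential: "continuous_on S potential"
  by (auto intro!: continuous_at_imp_continuous_on DERIV_isCont[OF potential_deriv])

lemma nonlin_mult_self: "u * nonlin u = lam * u\<^sup>2 + \<bar>u\<bar> powr (q + 2)"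
  by (simp add: nonlin_def abs_powr_plus_2 algebra_simps power2_eq_square)

lemma nonlin_mult_self_nonneg: "u * nonlin u \<ge> 0"
  using lam_pos by (simp add: nonlin_mult_self)

lemma quadratic_le_potential: "lam * u\<^sup>2 / 2 \<le> potential u"
  using q_pos by (simp add: potential_def)

lemma potential_nonneg: "potential u \<ge> 0"
  using lam_pos q_pos by (simp add: potential_def)

lemma potential_pos: "u \<noteq> 0 \<Longrightarrow> potential u > 0"
  using lam_pos q_pos by (simp add: potential_def add_pos_nonneg)

lemma potential_abs [simp]: "potential \<bar>u\<bar> = potential u"
  by (simp add: potential_def)

lemma potential_le_nonlin: "potential u \<le> u * nonlin u - lam * u\<^sup>2 / 2"
proof -
  have "\<bar>u\<bar> powr (q + 2) / (q + 2) \<le> \<bar>u\<bar> powr (q + 2)"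
    using q_pos by (simp add: divide_le_eq mult_le_cancel_left1)
  then show ?thesis by (simp add: potential_def nonlin_mult_self)
qed

lemma potential_less:
  assumes "\<bar>a\<bar> < b"
  shows "potential a < potential b"
proof -
  have "\<bar>a\<bar>\<^sup>2 < b\<^sup>2" using assms by (intro power_strict_mono) auto
  then have "lam * a\<^sup>2 / 2 < lam * b\<^sup>2 / 2" using lam_pos by simp
  moreover have "\<bar>a\<bar> powr (q + 2) / (q + 2) \<le> \<bar>b\<bar> powr (q + 2) / (q + 2)"
    using assms q_pos by (intro divide_right_mono powr_mono2) auto
  ultimately show ?thesis by (simp add: potential_def)
qed

lemma abs_nonlin_le:
  assumes "\<bar>a\<bar> \<le> A"
  shows "\<bar>nonlin a\<bar> \<le> nonlin A"
proof -
  have "\<bar>nonlin a\<bar> \<le> lam * \<bar>a\<bar> + \<bar>a\<bar> powr q * \<bar>a\<bar>"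
    unfolding nonlin_def using lam_pos
      by (intro order_trans[OF abs_triangle_ineq]) (simp add: abs_mult)
  also have "\<dots> \<le> lam * A + A powr q * A"
    using assms lam_pos q_pos by (intro add_mono mult_mono powr_mono2) auto
  finally show ?thesis using assms by (simp add: nonlin_def)
qed

definition slope :: "real \<Rightarrow> real" where
  "slope A = lam + (q + 1) * A powr q"

lemma slope_pos: "slope A > 0"
  using lam_pos q_pos by (simp add: slope_def add_pos_nonneg)

lemma nonlin_lipschitz:
  assumes "a \<in> {- A..A}" "b \<in> {- A..A}"
  shows "\<bar>nonlin a - nonlin b\<bar> \<le> slope A * \<bar>a - b\<bar>"
proof -
  have "norm (nonlin a - nonlin b) \<le> slope A * norm (a - b)"
  proof (rule field_differentiable_bound[of "{- A..A}"])
    fix u assume "u \<in> {- A..A}"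
    then have "\<bar>u\<bar> powr q \<le> A powr q" using q_pos by (intro powr_mono2) auto
    then show "norm (lam + (q + 1) * \<bar>u\<bar> powr q) \<le> slope A"
      using lam_pos q_pos by (simp add: slope_def abs_mult)
  qed (use assms nonlin_deriv in \<open>auto intro: has_field_derivative_at_within\<close>)
  then show ?thesis by simp
qed

subsection \<open>Existence and continuous dependence\<close>

text \<open>Energy bounds every solution by its initial value, so the nonlinearity may be truncated.\<close>

definition truncated :: "real \<Rightarrow> real \<Rightarrow> real" where
  "truncated A u = nonlin (clamp (- A) A u)"

lemma truncated_eq: "\<bar>u\<bar> \<le> A \<Longrightarrow> truncated A u = nonlin u"
  by (simp add: truncated_def clamp_cancel_cbox abs_le_iff)

lemma lipschitz_flux_system_truncated:
  assumes "A \<ge> 0"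
  shows "lipschitz_flux_system (\<lambda>r. sinh r ^ d) (\<lambda>r. real d * sinh r ^ (d - 1) * cosh r)
    (truncated A) (slope A)"
proof
  show "slope A > 0" by (rule slope_pos)
  fix a b :: real
  have "clamp (- A) A u \<in> {- A..A}" for u
    using clamp_in_interval[of "- A" A u] assms by simp
  then have "\<bar>truncated A a - truncated A b\<bar> \<le> slope A * \<bar>clamp (- A) A a - clamp (- A) A b\<bar>"
    unfolding truncated_def by (intro nonlin_lipschitz)
  also have "\<dots> \<le> slope A * \<bar>a - b\<bar>"
    using dist_clamps_le_dist_args[of "- A" A a b] slope_pos[of A]
    by (intro mult_left_mono) (auto simp: dist_real_def)
  finally show "\<bar>truncated A a - truncated A b\<bar> \<le> slope A * \<bar>a - b\<bar>" .
qed

lemma truncated_solution_bounded: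
  assumes sol: "flux_solution (truncated A) w z" and init: "\<bar>w 0\<bar> < A" and "r \<ge> 0"
  shows "\<bar>w r\<bar> \<le> A"
proof (rule ccontr)
  assume "\<not> \<bar>w r\<bar> \<le> A"
  interpret lipschitz_flux_system "\<lambda>r. sinh r ^ d" "\<lambda>r. real d * sinh r ^ (d - 1) * cosh r"
      "truncated A" "slope A"
    by (rule lipschitz_flux_system_truncated) (use init in auto)
  have "continuous_on {0..r} (\<lambda>r. \<bar>w r\<bar> - A)"
    by (intro continuous_intros continuous_on_subset[OF flux_solutionD(1)[OF sol]]) auto
  then obtain t where t: "0 < t" "\<bar>w t\<bar> = A" "\<And>s. 0 \<le> s \<Longrightarrow> s < t \<Longrightarrow> \<bar>w s\<bar> < A"
    using init \<open>r \<ge> 0\<close> \<open>\<not> \<bar>w r\<bar> \<le> A\<close> by (elim first_root) auto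
  have "energy potential w z t \<le> energy potential w z 0"
  proof (rule energy_antimono[OF sol continuous_on_H continuous_on_potential])
    fix x assume "x \<in> {0<..<t}"
    then have "truncated A (w x) = nonlin (w x)" using t(3)[of x] by (intro truncated_eq) auto
    then show "(potential has_real_derivative truncated A (w x)) (at (w x))"
      using potential_deriv by simp
  qed (use t in auto)
  then have "potential A \<le> potential (w 0)"
    using potential_le_energy[of potential w t z] potential_abs[of "w t"]
    by (simp add: energy_0[OF sol] t(2))
  then show False using potential_less[OF init] by simp
qed

definition shooting_solution :: "(real \<Rightarrow> real) \<Rightarrow> (real \<Rightarrow> real) \<Rightarrow> bool" where
  "shooting_solution w z \<longleftrightarrow> flux_solution nonlin w z \<and> w 0 > 0"

abbreviation E :: "(real \<Rightarrow> real) \<Rightarrow> (real \<Rightarrow> real) \<Rightarrow> real \<Rightarrow> real" where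
  "E \<equiv> energy potential"

context
  fixes w z :: "real \<Rightarrow> real"
  assumes sol: "shooting_solution w z"
begin

lemma shooting_flux_solution: "flux_solution nonlin w z" and initial_pos: "w 0 > 0"
  using sol by (auto simp: shooting_solution_def)

lemma continuous_on_w: "continuous_on {0..} w" and continuous_on_z: "continuous_on {0..} z"
  and z_0: "z 0 = 0"
  and w_deriv: "r > 0 \<Longrightarrow> (w has_real_derivative - velocity z r) (at r)"
  and z_deriv: "r > 0 \<Longrightarrow> (z has_real_derivative sinh r ^ d * nonlin (w r)) (at r)"
  using flux_solutionD[OF shooting_flux_solution] by auto

lemma continuous_on_nonlin_w: "continuous_on {0..} (\<lambda>r. nonlin (w r))"
  by (rule continuous_on_compose2[OF continuous_on_nonlin[of UNIV] continuous_on_w]) auto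

lemma continuous_on_v: "continuous_on {0..} (velocity z)"
  by (rule continuous_on_velocity[OF shooting_flux_solution continuous_on_nonlin])

lemma v_deriv:
  assumes "r > 0"
  shows "(velocity z has_real_derivative nonlin (w r)
      - real d * (cosh r / sinh r) * velocity z r) (at r)"
  using velocity_deriv[OF shooting_flux_solution assms] unfolding weight_log_deriv[OF assms] .

lemma E_deriv:
  assumes "r > 0"
  shows "(E w z has_real_derivative - (real d * (cosh r / sinh r)) * (velocity z r)\<^sup>2) (at r)"
  using energy_deriv[OF shooting_flux_solution assms, OF potential_deriv]
    unfolding weight_log_deriv[OF assms] .

lemma E_antimono: "0 \<le> r \<Longrightarrow> r \<le> s \<Longrightarrow> E w z s \<le> E w z r"
  by (rule energy_antimono[OF shooting_flux_solution continuous_on_nonlin continuous_on_potential])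
     (auto intro: potential_deriv)

lemma E_pos: "r \<ge> 0 \<Longrightarrow> E w z r > 0"
  by (rule energy_pos[OF shooting_flux_solution potential_deriv potential_nonneg])
     (use potential_pos initial_pos in auto)

lemma w_z_nonzero:
  assumes "r \<ge> 0"
  shows "(w r)\<^sup>2 + (z r)\<^sup>2 > 0"
proof -
  have "\<not> (w r = 0 \<and> z r = 0)"
    using E_pos[OF assms] by (auto simp: energy_def velocity_def potential_def)
  then show ?thesis by (simp add: sum_power2_gt_zero_iff)
qed

lemma abs_w_le_initial:
  assumes "r \<ge> 0"
  shows "\<bar>w r\<bar> \<le> w 0"
proof (rule ccontr)
  assume "\<not> \<bar>w r\<bar> \<le> w 0"
  then have "potential (w 0) < potential (w r)"
    using potential_less[of "w 0" "\<bar>w r\<bar>"] initial_pos by simp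
  also have "\<dots> \<le> E w z r" by (rule potential_le_energy)
  also have "\<dots> \<le> E w z 0" by (rule E_antimono) (use assms in auto)
  finally show False by (simp add: energy_0[OF shooting_flux_solution])
qed

lemma truncated_flux_solution: "w 0 \<le> A \<Longrightarrow> flux_solution (truncated A) w z"
  by (rule flux_solution_cong[OF shooting_flux_solution]) (use abs_w_le_initial truncated_eq in force)

end

lemma shooting_solution_exists:
  assumes "a > 0"
  shows "\<exists>w z. shooting_solution w z \<and> w 0 = a"
proof -
  interpret lipschitz_flux_system "\<lambda>r. sinh r ^ d" "\<lambda>r. real d * sinh r ^ (d - 1) * cosh r"
      "truncated (a + 1)" "slope (a + 1)"
    by (rule lipschitz_flux_system_truncated) (use assms in simp)
  obtain w z where wz: "flux_solution (truncated (a + 1)) w z" "w 0 = a"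
    using flux_solution_exists by blast
  then have "\<bar>w r\<bar> \<le> a + 1" if "r \<ge> 0" for r
    using truncated_solution_bounded[OF wz(1) _ that] assms by simp
  then have "flux_solution nonlin w z"
    by (intro flux_solution_cong[OF wz(1)] truncated_eq)
  then show ?thesis using wz(2) assms by (auto simp: shooting_solution_def)
qed

lemma shooting_solution_lipschitz:
  assumes "B > 0"
  shows "\<exists>K>0. \<exists>k>0. \<forall>v y w z r. shooting_solution v y \<and> v 0 \<le> B \<and> shooting_solution w z \<and> w 0 \<le> B \<and> r
      \<ge> 0 \<longrightarrow>
    \<bar>v r - w r\<bar> \<le> K * exp (k * r) * \<bar>v 0 - w 0\<bar> \<and>
    \<bar>velocity y r - velocity z r\<bar> \<le> K * exp (k * r) * \<bar>v 0 - w 0\<bar>"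
proof -
  interpret lipschitz_flux_system "\<lambda>r. sinh r ^ d" "\<lambda>r. real d * sinh r ^ (d - 1) * cosh r"
      "truncated B" "slope B"
    by (rule lipschitz_flux_system_truncated) (use assms in simp)
  define K where "K = 2 + slope B * 2 / rate"
  have K: "2 \<le> K" "slope B * 2 / rate \<le> K" using slope_pos[of B] rate_pos by (auto simp: K_def)
  have "\<bar>v r - w r\<bar> \<le> K * exp (rate * r) * \<bar>v 0 - w 0\<bar> \<and>
      \<bar>velocity y r - velocity z r\<bar> \<le> K * exp (rate * r) * \<bar>v 0 - w 0\<bar>"
    if v: "shooting_solution v y" "v 0 \<le> B" and w: "shooting_solution w z" "w 0 \<le> B" and "r \<ge> 0"
    for v y w z and r :: real
  proof
    note sols = truncated_flux_solution[OF v] truncated_flux_solution[OF w]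
    have bound: "\<bar>v s - w s\<bar> \<le> 2 * B * exp (rate * s)" if "s \<ge> 0" for s
    proof -
      have "\<bar>v s - w s\<bar> \<le> 2 * B * 1"
        using abs_w_le_initial[OF v(1) that] abs_w_le_initial[OF w(1) that] v(2) w(2) by linarith
      also have "\<dots> \<le> 2 * B * exp (rate * s)" using assms that rate_pos by (intro mult_left_mono) auto
      finally show ?thesis .
    qed
    have lipschitz: "\<bar>v s - w s\<bar> \<le> 2 * \<bar>v 0 - w 0\<bar> * exp (rate * s)" if "s \<ge> 0" for s
      by (rule flux_solution_lipschitz[OF sols]) (use bound that in auto)
    have "2 * \<bar>v 0 - w 0\<bar> * exp (rate * r) \<le> K * \<bar>v 0 - w 0\<bar> * exp (rate * r)"
      using K(1) by (intro mult_right_mono) auto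
    then show "\<bar>v r - w r\<bar> \<le> K * exp (rate * r) * \<bar>v 0 - w 0\<bar>"
      using lipschitz[OF \<open>r \<ge> 0\<close>] by (simp add: mult_ac)
    have "\<bar>velocity y r - velocity z r\<bar> \<le> slope B * (2 * \<bar>v 0 - w 0\<bar>) / rate * exp (rate * r)"
      by (rule velocity_lipschitz[OF sols]) (use lipschitz \<open>r \<ge> 0\<close> in auto)
    also have "\<dots> = (slope B * 2 / rate) * (\<bar>v 0 - w 0\<bar> * exp (rate * r))" by (simp add: mult_ac)
    also have "\<dots> \<le> K * (\<bar>v 0 - w 0\<bar> * exp (rate * r))" using K(2) by (intro mult_right_mono) auto
    finally show "\<bar>velocity y r - velocity z r\<bar> \<le> K * exp (rate * r) * \<bar>v 0 - w 0\<bar>"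
      by (simp add: mult_ac)
  qed
  then show ?thesis using K rate_pos by (intro exI[of _ K] exI[of _ rate]) auto
qed

end

section \<open>The hyperbolic radius\<close>

text \<open>The hyperbolic distance from the origin of the points x of the unit ball with |x|^2 = s.\<close>

definition hyp_radius :: "real \<Rightarrow> real" where
  "hyp_radius s = arsinh (2 * sqrt s / (1 - s))"

lemma hyp_radius_0 [simp]: "hyp_radius 0 = 0"
  by (simp add: hyp_radius_def)

lemma sinh_hyp_radius: "sinh (hyp_radius s) = 2 * sqrt s / (1 - s)"
  by (simp add: hyp_radius_def)

lemma hyp_radius_nonneg: "0 \<le> s \<Longrightarrow> s < 1 \<Longrightarrow> hyp_radius s \<ge> 0"
  by (simp add: hyp_radius_def arsinh_real_nonneg)

lemma hyp_radius_pos: "0 < s \<Longrightarrow> s < 1 \<Longrightarrow> hyp_radius s > 0"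
  by (simp add: hyp_radius_def)

lemma hyp_radius_image: "hyp_radius ` {0..<1} \<subseteq> {0..}"
  using hyp_radius_nonneg by auto

lemma cosh_hyp_radius:
  assumes "0 \<le> s" "s < 1"
  shows "cosh (hyp_radius s) = (1 + s) / (1 - s)"
proof -
  have "cosh (hyp_radius s) = sqrt ((2 * sqrt s / (1 - s))\<^sup>2 + 1)"
    by (simp only: hyp_radius_def cosh_arsinh_real)
  also have "(2 * sqrt s / (1 - s))\<^sup>2 + 1 = ((1 + s) / (1 - s))\<^sup>2"
    using assms
      by (simp add: power_divide power_mult_distrib divide_simps)
        (simp add: power2_eq_square algebra_simps)
  also have "sqrt \<dots> = (1 + s) / (1 - s)" using assms by simp
  finally show ?thesis .
qed

lemma exp_minus_hyp_radius_le:
  assumes "0 \<le> s" "s < 1"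
  shows "exp (- hyp_radius s) \<le> 1 - s"
proof -
  define x where "x = sqrt s"
  have x: "0 \<le> x" "x < 1" "s = x\<^sup>2" using assms by (auto simp: x_def)
  have "exp (- hyp_radius s) = cosh (hyp_radius s) - sinh (hyp_radius s)"
    by (simp add: cosh_field_def sinh_field_def field_simps)
  also have "\<dots> = (1 - x)\<^sup>2 / (1 - s)"
    using assms
      by (simp add: cosh_hyp_radius sinh_hyp_radius x_def[symmetric] flip: diff_divide_distrib)
      (simp add: x(3) power2_eq_square algebra_simps)
  also have "\<dots> \<le> (1 - x)\<^sup>2 * (1 + x)\<^sup>2 / (1 - s)"
    using x assms by (intro divide_right_mono mult_left_mono[of 1, simplified] one_le_power) auto
  also have "(1 - x)\<^sup>2 * (1 + x)\<^sup>2 = (1 - s) * (1 - s)"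
    by (simp add: x(3) power2_eq_square algebra_simps)
  finally show ?thesis using assms by simp
qed

lemma continuous_on_hyp_radius: "continuous_on {0..<1} hyp_radius"
  unfolding hyp_radius_def[abs_def] by (intro continuous_intros) auto

lemma hyp_radius_deriv:
  assumes "0 < s" "s < 1"
  shows "(hyp_radius has_real_derivative 1 / (sqrt s * (1 - s))) (at s)"
proof -
  have "((\<lambda>s. 2 * sqrt s / (1 - s)) has_real_derivative
      (2 * (inverse (sqrt s) / 2) * (1 - s) - 2 * sqrt s * (0 - 1)) / ((1 - s) * (1 - s))) (at s)"
    using assms
      by (intro DERIV_divide DERIV_cmult DERIV_real_sqrt DERIV_diff DERIV_const DERIV_ident) auto
  then have "((\<lambda>s. 2 * sqrt s / (1 - s)) has_real_derivative (1 + s) / (sqrt s * (1 - s)\<^sup>2)) (at s)"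
    by (rule DERIV_cong) (use assms in \<open>simp add: divide_simps power2_eq_square\<close>)
  from DERIV_chain2[OF arsinh_real_has_field_derivative this]
  have "(hyp_radius has_real_derivative
      1 / sqrt ((2 * sqrt s / (1 - s))\<^sup>2 + 1) * ((1 + s) / (sqrt s * (1 - s)\<^sup>2))) (at s)"
    unfolding hyp_radius_def[abs_def] .
  moreover have "sqrt ((2 * sqrt s / (1 - s))\<^sup>2 + 1) = (1 + s) / (1 - s)"
    using cosh_hyp_radius[of s] assms unfolding hyp_radius_def cosh_arsinh_real by simp
  moreover have "1 / ((1 + s) / (1 - s)) * ((1 + s) / (sqrt s * (1 - s)\<^sup>2)) = 1 / (sqrt s * (1 - s))"
    using assms by (simp add: divide_simps power2_eq_square)
  ultimately show ?thesis by simp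
qed

lemma hyp_radius_less:
  assumes "0 < s" "s < t" "t < 1"
  shows "hyp_radius s < hyp_radius t"
proof (rule DERIV_pos_imp_increasing[OF assms(2)])
  fix x assume "s \<le> x" "x \<le> t"
  then show "\<exists>y. (hyp_radius has_real_derivative y) (at x) \<and> y > 0"
    using hyp_radius_deriv[of x] assms by (intro exI[of _ "1 / (sqrt x * (1 - x))"]) auto
qed

lemma tanh_half_sq_less_1: "(tanh (r / 2))\<^sup>2 < (1::real)"
  using tanh_real_bounds[of "r / 2"] by (simp add: abs_square_less_1 abs_less_iff)

lemma hyp_radius_tanh:
  assumes "r \<ge> 0"
  shows "hyp_radius ((tanh (r / 2))\<^sup>2) = r"
proof -
  have "cosh (r / 2) > 0" by simp
  have "1 - (tanh (r / 2))\<^sup>2 = ((cosh (r / 2))\<^sup>2 - (sinh (r / 2))\<^sup>2) / (cosh (r / 2))\<^sup>2"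
    using \<open>cosh (r / 2) > 0\<close> by (simp add: tanh_def power_divide diff_divide_distrib)
  then have "1 - (tanh (r / 2))\<^sup>2 = 1 / (cosh (r / 2))\<^sup>2" by (simp add: cosh_square_eq)
  moreover have "sqrt ((tanh (r / 2))\<^sup>2) = tanh (r / 2)" using assms by simp
  ultimately have "2 * sqrt ((tanh (r / 2))\<^sup>2) / (1 - (tanh (r / 2))\<^sup>2)
      = 2 * sinh (r / 2) * cosh (r / 2)"
    using \<open>cosh (r / 2) > 0\<close> by (simp add: tanh_def power2_eq_square)
  also have "\<dots> = sinh r" using sinh_double[of "r / 2"] by simp
  finally show ?thesis by (simp add: hyp_radius_def arsinh_sinh_real)
qed

text \<open>The Emden--Fowler time of the hyperbolic radius r is t = ln (tanh (r / 2)).\<close>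

definition ef_radius :: "real \<Rightarrow> real" where
  "ef_radius t = hyp_radius (exp (2 * t))"

lemma ef_radius_pos: "t < 0 \<Longrightarrow> ef_radius t > 0"
  by (simp add: ef_radius_def hyp_radius_pos)

lemma ef_radius_less: "s < t \<Longrightarrow> t < 0 \<Longrightarrow> ef_radius s < ef_radius t"
  by (simp add: ef_radius_def hyp_radius_less)

lemma sqrt_exp_double: "sqrt (exp (2 * t)) = exp t"
  by (simp add: exp_double)

lemma sinh_ef_radius: "sinh (ef_radius t) = - 1 / sinh t"
proof -
  have "sinh t = (exp (2 * t) - 1) / (2 * exp t)"
    by (simp add: sinh_field_def exp_minus exp_double divide_simps power2_eq_square)
  then have "2 * exp t / (1 - exp (2 * t)) = - 1 / sinh t"
    using minus_divide_right[of "2 * exp t" "exp (2 * t) - 1"] by simp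
  then show ?thesis by (simp add: ef_radius_def sinh_hyp_radius sqrt_exp_double)
qed

lemma ef_radius_deriv:
  assumes "t < 0"
  shows "(ef_radius has_real_derivative sinh (ef_radius t)) (at t)"
proof -
  have "((\<lambda>t::real. exp (2 * t)) has_real_derivative 2 * exp (2 * t)) (at t)"
    by (auto intro!: derivative_eq_intros)
  from DERIV_chain2[OF hyp_radius_deriv this] assms
  have "(ef_radius has_real_derivative 1 / (exp t * (1 - exp (2 * t))) * (2 * exp (2 * t))) (at t)"
    unfolding ef_radius_def[abs_def] by (simp add: sqrt_exp_double)
  then show ?thesis
    by (rule DERIV_cong)
       (simp add: ef_radius_def sinh_hyp_radius sqrt_exp_double exp_double power2_eq_square)
qed

lemma ef_radius_surj:
  assumes "r > 0"
  obtains t where "t < 0" "ef_radius t = r"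
proof (rule that[of "ln (tanh (r / 2))"])
  have "0 < tanh (r / 2)" "tanh (r / 2) < 1" using assms tanh_real_lt_1 by auto
  then show "ln (tanh (r / 2)) < 0" "ef_radius (ln (tanh (r / 2))) = r"
    using hyp_radius_tanh[of r] assms by (simp_all add: ef_radius_def exp_double)
qed

lemma tendsto_ef_radius_at_bot:
  assumes "continuous_on {0..} f"
  shows "((\<lambda>t. f (ef_radius t)) \<longlongrightarrow> f 0) at_bot"
proof -
  have "continuous_on {0..<1} (\<lambda>s. f (hyp_radius s))"
    by (rule continuous_on_compose2[OF assms continuous_on_hyp_radius hyp_radius_image])
  then have "((\<lambda>s. f (hyp_radius s)) \<longlongrightarrow> f 0) (at 0 within {0..<1})"
    by (auto simp: continuous_on_def dest: bspec[of _ _ 0])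
  moreover have "filterlim (\<lambda>t::real. exp (2 * t)) (at 0 within {0..<1}) at_bot"
    unfolding filterlim_at
  proof
    have "filterlim (\<lambda>t::real. 2 * t) at_bot at_bot"
      by (rule filterlim_tendsto_pos_mult_at_bot[OF tendsto_const]) (auto simp: filterlim_ident)
    then show "((\<lambda>t::real. exp (2 * t)) \<longlongrightarrow> 0) at_bot" by (rule filterlim_compose[OF exp_at_bot])
    show "\<forall>\<^sub>F t::real in at_bot. exp (2 * t) \<in> {0..<1} \<and> exp (2 * t) \<noteq> 0"
      using eventually_gt_at_bot[of 0] by eventually_elim auto
  qed
  ultimately show ?thesis unfolding ef_radius_def by (rule filterlim_compose)
qed

section \<open>Many sign changes for large initial values\<close>

primrec alternates :: "(real \<Rightarrow> real) \<Rightarrow> nat \<Rightarrow> real \<Rightarrow> bool" where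
  "alternates w 0 r \<longleftrightarrow> r > 0 \<and> w r \<noteq> 0"
| "alternates w (Suc k) r \<longleftrightarrow> (\<exists>s<r. alternates w k s \<and> w r * w s < 0)"

locale critical_radial_equation = radial_equation +
  fixes m :: real
  assumes m_gt_2: "m > 2" and d_eq: "real d = 2 * m + 1" and mq: "m * q = 2" and lam_gt:
    "m * (m + 1) < lam"
begin

sublocale emden_fowler_params m "lam - m * (m + 1)" q
  by unfold_locales (use m_gt_2 q_pos lam_gt in auto)

definition ef_y :: "(real \<Rightarrow> real) \<Rightarrow> real \<Rightarrow> real" where
  "ef_y w t = sinh (ef_radius t) powr m * w (ef_radius t)"

definition ef_y' :: "(real \<Rightarrow> real) \<Rightarrow> (real \<Rightarrow> real) \<Rightarrow> real \<Rightarrow> real" where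
  "ef_y' w z t = m * cosh (ef_radius t) * (sinh (ef_radius t) powr m * w (ef_radius t))
     - sinh (ef_radius t) powr (m + 1) * velocity z (ef_radius t)"

lemma sinh_powr_deriv:
  assumes "r > 0"
  shows "((\<lambda>r. sinh r powr a) has_real_derivative a * sinh r powr (a - 1) * cosh r) (at r)"
proof (rule DERIV_chain2[where g = sinh and f = "\<lambda>x. x powr a"])
  show "((\<lambda>x. x powr a) has_real_derivative a * sinh r powr (a - 1)) (at (sinh r))"
    using assms by (intro has_real_derivative_powr) simp
qed (auto intro!: derivative_eq_intros)

lemma abs_ef_scaling_powr:
  assumes "r > 0"
  shows "\<bar>sinh r powr m * u\<bar> powr q = (sinh r)\<^sup>2 * \<bar>u\<bar> powr q"
proof -
  have "(sinh r powr m) powr q = (sinh r)\<^sup>2" using assms mq by (simp add: powr_powr powr_numeral)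
  then show ?thesis by (simp add: abs_mult powr_mult)
qed

lemma ef_y_deriv_radius:
  assumes sol: "shooting_solution w z" and r: "r > 0"
  shows "((\<lambda>r. sinh r powr m * w r) has_real_derivative
    (m * cosh r * (sinh r powr m * w r) - sinh r powr (m + 1) * velocity z r) / sinh r) (at r)"
  by (rule DERIV_cong[OF DERIV_mult[OF sinh_powr_deriv[OF r] w_deriv[OF sol r]]])
     (use r in \<open>simp add: powr_diff powr_add field_simps\<close>)

text \<open>Here d = 2 m + 1 cancels the velocity, and C^2 = S^2 + 1 leaves
  m^2 - (lam - m (m + 1)) S^2 as coefficient of Y = P w.\<close>

lemma ef_identity:
  fixes S C P V w Q :: real
  assumes "S \<noteq> 0" "C\<^sup>2 = S\<^sup>2 + 1"
  shows "m * S * (P * w) + (m * C * (P * w) - P * S * V) / S * (m * C)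
      - ((m + 1) * P * C * V + (lam * w + Q * w - real d * (C / S) * V) * (P * S))
    = (m\<^sup>2 - (lam - m * (m + 1)) * S\<^sup>2 - S\<^sup>2 * Q) * (P * w) / S"
proof -
  have "m * S * (P * w) + (m * C * (P * w) - P * S * V) / S * (m * C)
      - ((m + 1) * P * C * V + (lam * w + Q * w - real d * (C / S) * V) * (P * S))
    = (m * S\<^sup>2 * (P * w) + m\<^sup>2 * C\<^sup>2 * (P * w) - S\<^sup>2 * P * (lam * w + Q * w)) / S"
    using assms(1) unfolding d_eq by (simp add: divide_simps) algebra
  also have "m * S\<^sup>2 * (P * w) + m\<^sup>2 * C\<^sup>2 * (P * w) - S\<^sup>2 * P * (lam * w + Q * w)
    = (m\<^sup>2 - (lam - m * (m + 1)) * S\<^sup>2 - S\<^sup>2 * Q) * (P * w)"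
    unfolding assms(2) by algebra
  finally show ?thesis .
qed

lemma ef_y'_deriv_radius:
  assumes sol: "shooting_solution w z" and r: "r > 0"
  shows "((\<lambda>r. m * cosh r * (sinh r powr m * w r) - sinh r powr (m + 1) * velocity z r) has_real_derivative
    (m\<^sup>2 - (lam - m * (m + 1)) * (sinh r)\<^sup>2 - \<bar>sinh r powr m * w r\<bar> powr q) * (sinh r powr m * w r) /
      sinh r) (at r)"
proof -
  have "((\<lambda>r. m * cosh r) has_real_derivative m * sinh r) (at r)"
    by (auto intro!: derivative_eq_intros)
  from DERIV_diff[OF DERIV_mult[OF this ef_y_deriv_radius[OF sol r]]
      DERIV_mult[OF sinh_powr_deriv[OF r] v_deriv[OF sol r]]]
  show ?thesis
  proof (rule DERIV_cong)
    have "sinh r powr (m + 1) = sinh r powr m * sinh r" using r by (simp add: powr_add)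
    then show "m * sinh r * (sinh r powr m * w r)
        + (m * cosh r * (sinh r powr m * w r) - sinh r powr (m + 1) * velocity z r) / sinh
          r * (m * cosh r)
        - ((m + 1) * sinh r powr (m + 1 - 1) * cosh r * velocity z r
          + (nonlin (w r) - real d * (cosh r / sinh r) * velocity z r) * sinh r powr (m + 1))
      = (m\<^sup>2 - (lam - m * (m + 1)) * (sinh r)\<^sup>2 - \<bar>sinh r powr m * w r\<bar> powr q) *
        (sinh r powr m * w r) / sinh r"
      using ef_identity[of "sinh r" "cosh r" "sinh r powr m" "w r" "velocity z r" "\<bar>w r\<bar> powr q"] r
      by (simp add: abs_ef_scaling_powr nonlin_def cosh_square_eq)
  qed
qed

lemma phi_ef_radius: "phi t = (lam - m * (m + 1)) * (sinh (ef_radius t))\<^sup>2"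
  by (simp add: phi_def sinh_ef_radius power_divide)

lemma emden_fowler_shooting:
  assumes sol: "shooting_solution w z"
  shows "emden_fowler m (lam - m * (m + 1)) q (ef_y w) (ef_y' w z)"
proof
  fix t :: real assume t: "t < 0"
  note r = ef_radius_pos[OF t]
  show "(ef_y w has_real_derivative ef_y' w z t) (at t)"
    unfolding ef_y_def[abs_def] ef_y'_def
    by (rule DERIV_cong[OF DERIV_chain2[OF ef_y_deriv_radius[OF sol r] ef_radius_deriv[OF t]]])
       (use r in simp)
  show "(ef_y' w z has_real_derivative (m\<^sup>2 - phi t - \<bar>ef_y w t\<bar> powr q) * ef_y w t) (at t)"
    unfolding ef_y_def ef_y'_def[abs_def] phi_ef_radius
    by (rule DERIV_cong[OF DERIV_chain2[OF ef_y'_deriv_radius[OF sol r] ef_radius_deriv[OF t]]])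
       (use r in simp)
qed

lemma continuous_on_sinh_powr: "a > 0 \<Longrightarrow> continuous_on {0..} (\<lambda>r::real. sinh r powr a)"
  by (intro continuous_on_powr' continuous_intros) auto

lemma ef_y_tendsto_0:
  assumes sol: "shooting_solution w z"
  shows "(ef_y w \<longlongrightarrow> 0) at_bot"
proof -
  have "continuous_on {0..} (\<lambda>r. sinh r powr m * w r)"
    using m_gt_2 by (intro continuous_on_mult continuous_on_sinh_powr continuous_on_w[OF sol]) simp
  from tendsto_ef_radius_at_bot[OF this] show ?thesis by (simp add: ef_y_def[abs_def])
qed

lemma ef_y'_tendsto_0:
  assumes sol: "shooting_solution w z"
  shows "(ef_y' w z \<longlongrightarrow> 0) at_bot"
proof -
  have "continuous_on {0..} (\<lambda>r. m * cosh r * (sinh r powr m * w r)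
      - sinh r powr (m + 1) * velocity z r)"
    using m_gt_2
    by (intro continuous_on_mult continuous_on_diff continuous_on_const continuous_on_cosh
        continuous_on_id
        continuous_on_sinh_powr continuous_on_w[OF sol] continuous_on_v[OF sol]) auto
  from tendsto_ef_radius_at_bot[OF this] show ?thesis by (simp add: ef_y'_def[abs_def])
qed

lemma emden_fowler_positive_energy_shooting:
  assumes sol: "shooting_solution w z"
  shows "emden_fowler_positive_energy m (lam - m * (m + 1)) q (ef_y w) (ef_y' w z)"
proof -
  interpret emden_fowler m "lam - m * (m + 1)" q "ef_y w" "ef_y' w z"
    by (rule emden_fowler_shooting[OF sol])
  show ?thesis
  proof (unfold_locales, rule energy_pos_if_vanishing_at_bot[OF ef_y_tendsto_0[OF sol] ef_y'_tendsto_0[OF sol]])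
    have "continuous_on {0..} (\<lambda>r::real. (lam - m * (m + 1)) * (sinh r)\<^sup>2)"
      by (intro continuous_intros)
    from tendsto_ef_radius_at_bot[OF this] show "(phi \<longlongrightarrow> 0) at_bot"
      by (simp add: phi_ef_radius[abs_def])
    have "\<forall>\<^sub>F t in at_bot. w (ef_radius t) > 0"
      by (rule order_tendstoD(1)[OF tendsto_ef_radius_at_bot[OF continuous_on_w[OF sol]] initial_pos[OF sol]])
    then show "\<forall>\<^sub>F t in at_bot. ef_y w t \<noteq> 0"
      using eventually_gt_at_bot[of 0]
      by eventually_elim (use ef_radius_pos in \<open>force simp: ef_y_def\<close>)
  qed
qed

text \<open>The solution stays above half its initial value up to this radius.\<close>

definition plateau_radius :: "real \<Rightarrow> real" where
  "plateau_radius a = 1 / sqrt (2 * (lam + a powr q))"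

lemma plateau_radius_pos: "plateau_radius a > 0"
  using lam_pos by (simp add: plateau_radius_def add_pos_nonneg)

lemma initial_plateau:
  assumes sol: "shooting_solution w z" and r: "0 < r" "r \<le> plateau_radius (w 0)"
  shows "w r \<ge> w 0 / 2"
proof -
  define a where "a = w 0"
  define b where "b = lam + a powr q"
  have "a > 0" using initial_pos[OF sol] by (simp add: a_def)
  have "b > 0" using lam_pos by (simp add: b_def add_pos_nonneg)
  have nonlin_a: "nonlin a = b * a" using \<open>a > 0\<close> by (simp add: nonlin_def b_def algebra_simps)
  obtain x where x: "0 < x" "x < r" "w r - w 0 = - velocity z x * (r - 0)"
  proof (rule mvt[of 0 r w "\<lambda>x h. - velocity z x * h"])
    show "continuous_on {0..r} w" by (rule continuous_on_subset[OF continuous_on_w[OF sol]]) simp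
    show "(w has_derivative (\<lambda>h. - velocity z x * h)) (at x)" if "0 < x" "x < r" for x
      using w_deriv[OF sol that(1)] unfolding has_field_derivative_def .
  qed (use r in auto)
  have "\<bar>velocity z x\<bar> \<le> nonlin a * x"
    by (rule abs_velocity_le[OF shooting_flux_solution[OF sol] continuous_on_nonlin])
       (use x abs_nonlin_le abs_w_le_initial[OF sol] in \<open>auto simp: a_def\<close>)
  also have "\<dots> \<le> nonlin a * r" using x \<open>a > 0\<close> \<open>b > 0\<close> by (intro mult_left_mono) (auto simp: nonlin_a)
  finally have "velocity z x * r \<le> b * a * r * r" using r
    by (intro mult_right_mono) (auto simp: nonlin_a)
  also have "\<dots> = a * (b * r\<^sup>2)" by (simp add: power2_eq_square)
  also have "\<dots> \<le> a * (1 / 2)"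
  proof -
    have "r\<^sup>2 \<le> (plateau_radius a)\<^sup>2" using r by (intro power_mono) (auto simp: a_def)
    also have "\<dots> = 1 / (2 * b)" using \<open>b > 0\<close> by (simp add: plateau_radius_def b_def power_divide)
    finally have "b * r\<^sup>2 \<le> 1 / 2" using \<open>b > 0\<close> by (simp add: field_simps)
    then show ?thesis using \<open>a > 0\<close> by (intro mult_left_mono) auto
  qed
  finally show ?thesis using x(3) by (simp add: a_def)
qed

lemma plateau_radius_le:
  assumes "R > 0" "a \<ge> R powr (- m)"
  shows "plateau_radius a \<le> R"
proof -
  define S where "S = sqrt (2 * (lam + a powr q))"
  have "S > 0" using lam_pos by (simp add: S_def add_pos_nonneg)
  have "(R powr (- m)) powr q = R powr (- 2)" by (simp only: powr_powr mult_minus_left mq)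
  then have "(1 / R)\<^sup>2 = (R powr (- m)) powr q"
    using assms(1) by (simp add: powr_minus powr_numeral power_divide inverse_eq_divide)
  also have "\<dots> \<le> a powr q" using assms q_pos by (intro powr_mono2) auto
  also have "\<dots> \<le> 2 * (lam + a powr q)" using lam_pos by (simp add: distrib_left add_increasing)
  finally have "1 / R \<le> S" unfolding S_def by (rule real_le_rsqrt)
  then have "1 / S \<le> R" using assms(1) \<open>S > 0\<close> by (simp add: field_simps)
  then show ?thesis by (simp add: plateau_radius_def S_def)
qed

definition plateau_height :: real where
  "plateau_height = (1 / (2 * (lam + 1))) powr (m / 2) / 2"

lemma plateau_height_pos: "plateau_height > 0"
  using lam_pos by (simp add: plateau_height_def)

lemma plateau_height_le:
  assumes "a \<ge> 1"
  shows "plateau_height \<le> plateau_radius a powr m * (a / 2)"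
proof -
  define b where "b = lam + a powr q"
  have "a powr q \<ge> 1" using assms q_pos by (simp add: ge_one_powr_ge_zero)
  then have "b > 0" using lam_pos by (simp add: b_def)
  have "b \<le> (lam + 1) * a powr q"
    using \<open>a powr q \<ge> 1\<close> lam_pos by (simp add: b_def distrib_right mult_le_cancel_left1)
  then have "1 / (2 * (lam + 1)) \<le> 1 / (2 * b) * a powr q"
    using \<open>b > 0\<close> lam_pos by (simp add: field_simps)
  then have "(1 / (2 * (lam + 1))) powr (m / 2) \<le> (1 / (2 * b) * a powr q) powr (m / 2)"
    using m_gt_2 lam_pos by (intro powr_mono2) auto
  also have "\<dots> = (1 / (2 * b)) powr (m / 2) * (a powr q) powr (m / 2)" by (rule powr_mult)
  also have "(a powr q) powr (m / 2) = a" using assms mq by (simp add: powr_powr mult.commute)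
  also have "(1 / (2 * b)) powr (m / 2) = plateau_radius a powr m"
  proof -
    have "plateau_radius a = (1 / (2 * b)) powr (1 / 2)"
      using \<open>b > 0\<close> by (simp add: plateau_radius_def b_def powr_half_sqrt real_sqrt_divide)
    then show ?thesis by (simp add: powr_powr)
  qed
  finally show ?thesis by (simp add: plateau_height_def)
qed

definition bubble :: "(real \<Rightarrow> real) \<Rightarrow> (real \<Rightarrow> real) \<Rightarrow> real \<Rightarrow> bool" where
  "bubble w z t \<longleftrightarrow> t < 0 \<and> \<bar>ef_y w t\<bar> \<ge> height
     \<and> ef_energy (ef_y w) (ef_y' w z) t \<ge> gain_const * exp (2 * t)"

lemma bubble_after_plateau:
  assumes sol: "shooting_solution w z" and "w 0 \<ge> 1"
    and s: "s < 0" "ef_radius s = plateau_radius (w 0)"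
      "s + height / (mid_rate * plateau_height) \<le> - onset"
  obtains t where "t \<le> s + height / (mid_rate * plateau_height)" "bubble w z t"
proof -
  interpret emden_fowler_positive_energy m "lam - m * (m + 1)" q "ef_y w" "ef_y' w z"
    by (rule emden_fowler_positive_energy_shooting[OF sol])
  have plateau: "w (ef_radius t) \<ge> w 0 / 2" if "t \<le> s" for t
  proof -
    have "ef_radius t \<le> ef_radius s" using ef_radius_less[of t s] s(1) that by (cases "t = s") auto
    then show ?thesis using initial_plateau[OF sol, of "ef_radius t"] ef_radius_pos[of t] s(1,2) that
      by simp
  qed
  have pos: "ef_y w t > 0" if "t \<le> s" for t
    using plateau[OF that] ef_radius_pos[of t] s(1) that initial_pos[OF sol] by (simp add: ef_y_def)
  have "plateau_height \<le> plateau_radius (w 0) powr m * (w 0 / 2)"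
    by (rule plateau_height_le[OF \<open>w 0 \<ge> 1\<close>])
  also have "\<dots> \<le> sinh (plateau_radius (w 0)) powr m * w (plateau_radius (w 0))"
    using plateau[of s] s(2) \<open>w 0 \<ge> 1\<close> m_gt_2 plateau_radius_pos[of "w 0"]
      sinh_real_ge_self[of "plateau_radius (w 0)"]
    by (intro mult_mono powr_mono2) auto
  finally have "ef_y w s \<ge> plateau_height" by (simp add: ef_y_def s(2))
  then obtain t where t: "t \<le> s + height / (mid_rate * plateau_height)" "ef_y w t = height"
      "Ey t \<ge> gain_const * exp (2 * t)"
    using first_crossing_of_height[OF plateau_height_pos _ s(3) pos ef_y_tendsto_0[OF sol]] by blast
  then have "bubble w z t" using s(3) onset_pos height_pos by (auto simp: bubble_def)
  then show ?thesis using that t(1) by blast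
qed

lemma first_bubble:
  "\<exists>A>0. \<forall>w z. shooting_solution w z \<and> w 0 \<ge> A \<longrightarrow> (\<exists>t\<le>- T. bubble w z t)"
proof -
  define l where "l = height / (mid_rate * plateau_height)"
  have "l > 0" using height_pos mid_rate_pos plateau_height_pos by (simp add: l_def)
  define X where "X = max T onset + l"
  have "X > 0" using onset_pos \<open>l > 0\<close> by (auto simp: X_def)
  define A where "A = max 1 (ef_radius (- X) powr (- m))"
  have "\<exists>t\<le>- T. bubble w z t" if sol: "shooting_solution w z" "w 0 \<ge> A" for w z
  proof -
    have init: "w 0 \<ge> 1" "w 0 \<ge> ef_radius (- X) powr (- m)" using sol(2) by (auto simp: A_def)
    obtain s where s: "s < 0" "ef_radius s = plateau_radius (w 0)"
      using ef_radius_surj[OF plateau_radius_pos] .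
    have "ef_radius s \<le> ef_radius (- X)"
      unfolding s(2) by (rule plateau_radius_le) (use init(2) ef_radius_pos \<open>X > 0\<close> in auto)
    then have "s \<le> - X" using ef_radius_less[of "- X" s] s(1) by force
    then have early: "s + l \<le> - onset" "s + l \<le> - T"
      using max.cobounded1[of T onset] max.cobounded2[of onset T] by (auto simp: X_def)
    obtain t where "t \<le> s + l" "bubble w z t"
      using bubble_after_plateau[OF sol(1) init(1) s] early(1) unfolding l_def by blast
    then show ?thesis using early(2) by (intro exI[of _ t]) simp
  qed
  then show ?thesis by (intro exI[of _ A]) (auto simp: A_def)
qed

lemma next_bubble:
  assumes sol: "shooting_solution w z" and bubble: "bubble w z t0"
    and early: "(1 - 2 / low_rate) * t0 + delay_const \<le> - max T onset"
  obtains t where "t0 < t" "t \<le> - T" "bubble w z t" "w (ef_radius t) * w (ef_radius t0) < 0"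
proof -
  interpret emden_fowler_positive_energy m "lam - m * (m + 1)" q "ef_y w" "ef_y' w z"
    by (rule emden_fowler_positive_energy_shooting[OF sol])
  have "(1 - 2 / low_rate) * t0 + delay_const \<le> - onset" using early max.cobounded2[of onset T]
    by linarith
  then obtain t where t: "t0 < t" "t \<le> (1 - 2 / low_rate) * t0 + delay_const"
    "ef_y w t * ef_y w t0 < 0"
    "\<bar>ef_y w t\<bar> = height" "Ey t \<ge> gain_const * exp (2 * t)"
    using next_crossing[of t0] bubble by (auto simp: bubble_def)
  then have "t \<le> - T" "t < 0" using early onset_pos by auto
  have "(sinh (ef_radius t) powr m * sinh (ef_radius t0) powr m) * (w (ef_radius t) * w (ef_radius t0)) < 0"
    using t(3) by (simp add: ef_y_def mult_ac)
  then have "w (ef_radius t) * w (ef_radius t0) < 0" by (auto simp: mult_less_0_iff)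
  then show ?thesis using that[of t] t \<open>t \<le> - T\<close> \<open>t < 0\<close> by (simp add: bubble_def)
qed

text \<open>The factor 1 - 2 / low_rate is positive because m > 2, that is, N > 6; so k further bubbles fit
  before time - T as soon as the first one comes early enough.\<close>

lemma many_bubbles:
  "\<exists>A>0. \<forall>w z. shooting_solution w z \<and> w 0
      \<ge> A \<longrightarrow> (\<exists>t\<le>- T. bubble w z t \<and> alternates w k (ef_radius t))"
proof (induction k arbitrary: T)
  case 0
  obtain A where A: "A > 0" "\<And>w z. shooting_solution w z \<Longrightarrow> w 0 \<ge> A \<Longrightarrow> \<exists>t\<le>- T. bubble w z t"
    using first_bubble[of T] by blast
  have "alternates w 0 (ef_radius t)" if "bubble w z t" for w z t
    using that ef_radius_pos height_pos by (auto simp: bubble_def ef_y_def)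
  then show ?case using A by blast
next
  case (Suc k)
  define f where "f = 1 - 2 / low_rate"
  have "f > 0" using low_rate_gt by (simp add: f_def)
  define T0 where "T0 = (max T onset + delay_const) / f"
  obtain A where A: "A > 0" "\<And>w z. shooting_solution w z \<Longrightarrow> w 0 \<ge> A \<Longrightarrow>
      \<exists>t\<le>- T0. bubble w z t \<and> alternates w k (ef_radius t)"
    using Suc.IH[of T0] by blast
  have "\<exists>t\<le>- T. bubble w z t \<and> alternates w (Suc k) (ef_radius t)"
    if sol: "shooting_solution w z" "w 0 \<ge> A" for w z
  proof -
    obtain t0 where t0: "t0 \<le> - T0" "bubble w z t0" "alternates w k (ef_radius t0)" using A(2)[OF sol]
      by blast
    have "f * t0 \<le> f * (- T0)" using t0(1) \<open>f > 0\<close> by (intro mult_left_mono) auto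
    also have "\<dots> = - (max T onset + delay_const)" using \<open>f > 0\<close> by (simp add: T0_def)
    finally have "f * t0 + delay_const \<le> - max T onset" by simp
    then obtain t where t: "t0 < t" "t \<le> - T" "bubble w z t" "w (ef_radius t) * w (ef_radius t0) < 0"
      using next_bubble[OF sol(1) t0(2), of T] by (auto simp: f_def)
    moreover have "ef_radius t0 < ef_radius t" using t
      by (intro ef_radius_less) (auto simp: bubble_def)
    ultimately show ?thesis using t0(3) by (intro exI[of _ t]) auto
  qed
  then show ?case using A(1) by blast
qed

lemma many_sign_changes:
  "\<exists>A>0. \<forall>w z. shooting_solution w z \<and> w 0 \<ge> A \<longrightarrow> (\<exists>r. alternates w k r)"
  using many_bubbles[of 0 k] by blast

end

section \<open>The Pruefer angle\<close>

locale plane_curve_angle =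
  fixes w z w' z' angle :: "real \<Rightarrow> real"
  assumes w: "continuous_on {0..} w" "\<And>r. r > 0 \<Longrightarrow> (w has_real_derivative w' r) (at r)"
    and z: "continuous_on {0..} z" "\<And>r. r > 0 \<Longrightarrow> (z has_real_derivative z' r) (at r)"
    and angle: "continuous_on {0..} angle"
      "\<And>r. r > 0 \<Longrightarrow> (angle has_real_derivative (w r * z' r - w' r * z r) / ((w r)\<^sup>2 + (z r)\<^sup>2)) (at r)"
    and nonzero: "\<And>r. r \<ge> 0 \<Longrightarrow> (w r)\<^sup>2 + (z r)\<^sup>2 > 0"
begin

lemma norm_deriv:
  assumes "x > 0"
  shows "((\<lambda>r. sqrt ((w r)\<^sup>2 + (z r)\<^sup>2)) has_real_derivative
    (w x * w' x + z x * z' x) / sqrt ((w x)\<^sup>2 + (z x)\<^sup>2)) (at x)"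
proof -
  define D where "D = (w x)\<^sup>2 + (z x)\<^sup>2"
  have "D > 0" using nonzero[of x] assms by (simp add: D_def)
  have "((\<lambda>r. (w r)\<^sup>2 + (z r)\<^sup>2) has_real_derivative 2 * (w x * w' x + z x * z' x)) (at x)"
    using assms by (auto intro!: derivative_eq_intros w(2) z(2))
  from DERIV_chain2[where f = sqrt and x = x, OF _ this] DERIV_real_sqrt[OF \<open>D > 0\<close>]
  have "((\<lambda>r. sqrt ((w r)\<^sup>2 + (z r)\<^sup>2)) has_real_derivative
      inverse (sqrt D) / 2 * (2 * (w x * w' x + z x * z' x))) (at x)" unfolding D_def by blast
  moreover have "inverse (sqrt D) / 2 * (2 * b) = b / sqrt D" for b
    by (simp add: inverse_eq_divide)
  ultimately show ?thesis by (simp only: D_def)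
qed

lemma radial_component_constant:
  assumes "r \<ge> 0"
  shows "(w r * cos (angle r) + z r * sin (angle r)) / sqrt ((w r)\<^sup>2 + (z r)\<^sup>2)
    = (w 0 * cos (angle 0) + z 0 * sin (angle 0)) / sqrt ((w 0)\<^sup>2 + (z 0)\<^sup>2)" (is "?f r = ?f 0")
proof (cases "r = 0")
  case False
  show ?thesis
  proof (rule DERIV_isconst_end[of 0 r ?f])
    have "continuous_on {0..} ?f"
      by (intro continuous_intros w z angle) (use nonzero in force)
    then show "continuous_on {0..r} ?f" by (rule continuous_on_subset) simp
    fix x assume "0 < x" "x < r"
    define c s D where "c = cos (angle x)" and "s = sin (angle x)" and "D = (w x)\<^sup>2 + (z x)\<^sup>2"
    define a' where "a' = (w x * z' x - w' x * z x) / D"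
    have "D > 0" using nonzero[of x] \<open>0 < x\<close> by (simp add: D_def)
    have "(w' x * c - w x * s * a' + (z' x * s + z x * c * a')) * D
        = (w' x * c + z' x * s) * D + (z x * c - w x * s) * (w x * z' x - w' x * z x)"
      using \<open>D > 0\<close> by (simp add: a'_def field_simps)
    then have cancel: "(w' x * c - w x * s * a' + (z' x * s + z x * c * a')) * D
        = (w x * c + z x * s) * (w x * w' x + z x * z' x)"
      unfolding D_def by algebra
    have component: "((\<lambda>r. w r * cos (angle r) + z r * sin (angle r)) has_real_derivative
        w' x * c - w x * s * a' + (z' x * s + z x * c * a')) (at x)"
      unfolding c_def s_def a'_def D_def using \<open>0 < x\<close>
      by (auto intro!: derivative_eq_intros w(2) z(2) angle(2) simp: mult_ac)
    have "(?f has_real_derivative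
        ((w' x * c - w x * s * a' + (z' x * s + z x * c * a')) * sqrt D
          - (w x * c + z x * s) * ((w x * w' x + z x * z' x) / sqrt D)) / (sqrt D * sqrt D)) (at x)"
      by (rule DERIV_divide[OF component norm_deriv[OF \<open>0 < x\<close>], folded c_def s_def D_def])
        (use \<open>D > 0\<close> in simp)
    moreover have "A * sqrt D - b / sqrt D = (A * D - b) / sqrt D" for A b
      using \<open>D > 0\<close> by (simp add: field_simps)
    ultimately show "(?f has_real_derivative 0) (at x)" using cancel by simp
  qed (use False assms in simp)
qed simp

lemma rotated: "plane_curve_angle z (\<lambda>r. - w r) z' (\<lambda>r. - w' r) angle"
proof
  fix r :: real
  have "z r * - w' r - z' r * - w r = w r * z' r - w' r * z r" by simp
  then show "(angle has_real_derivative (z r * - w' r - z' r * - w r)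
      / ((z r)\<^sup>2 + (- w r)\<^sup>2)) (at r)" if "r > 0"
    using angle(2)[OF that] by (simp add: add.commute mult.commute)
qed (use w z angle nonzero in \<open>auto intro!: continuous_intros derivative_eq_intros simp: add.commute\<close>)

lemma polar_coordinates:
  assumes init: "angle 0 = 0" "w 0 > 0" "z 0 = 0" and "r \<ge> 0"
  shows "w r = sqrt ((w r)\<^sup>2 + (z r)\<^sup>2) * cos (angle r)"
    "z r = sqrt ((w r)\<^sup>2 + (z r)\<^sup>2) * sin (angle r)"
proof -
  interpret rotated: plane_curve_angle z "\<lambda>r. - w r" z' "\<lambda>r. - w' r" angle by (rule rotated)
  define R c s where "R = sqrt ((w r)\<^sup>2 + (z r)\<^sup>2)" and "c = cos (angle r)" and "s = sin (angle r)"
  have "R > 0" using nonzero[OF \<open>r \<ge> 0\<close>] by (simp add: R_def)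
  have radial: "w r * c + z r * s = R"
    using radial_component_constant[OF \<open>r \<ge> 0\<close>] init \<open>R > 0\<close> by (simp add: R_def c_def s_def)
  have tangential: "z r * c - w r * s = 0"
    using rotated.radial_component_constant[OF \<open>r \<ge> 0\<close>] init \<open>R > 0\<close>
    by (auto simp: R_def c_def s_def add.commute sum_power2_gt_zero_iff)
  have "c\<^sup>2 + s\<^sup>2 = 1" by (simp add: c_def s_def)
  have "w r * (c\<^sup>2 + s\<^sup>2) = (w r * c + z r * s) * c - (z r * c - w r * s) * s"
    and "z r * (c\<^sup>2 + s\<^sup>2) = (w r * c + z r * s) * s + (z r * c - w r * s) * c"
    by algebra+
  then show "w r = sqrt ((w r)\<^sup>2 + (z r)\<^sup>2) * cos (angle r)"
    "z r = sqrt ((w r)\<^sup>2 + (z r)\<^sup>2) * sin (angle r)"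
    unfolding radial tangential \<open>c\<^sup>2 + s\<^sup>2 = 1\<close> by (simp_all add: R_def c_def s_def)
qed

end

lemma cos_eq_0_iff_Ints: "cos x = 0 \<longleftrightarrow> x / pi + 1 / 2 \<in> \<int>" for x :: real
proof
  assume "cos x = 0"
  then obtain n :: int where "x = n * pi + pi / 2" unfolding cos_zero_iff_int2 by blast
  then have "x / pi + 1 / 2 = of_int (n + 1)" by (simp add: field_simps)
  then show "x / pi + 1 / 2 \<in> \<int>" by (metis Ints_of_int)
next
  assume "x / pi + 1 / 2 \<in> \<int>"
  then obtain n :: int where "x / pi + 1 / 2 = n" by (auto elim: Ints_cases)
  then have "x = (n - 1) * pi + pi / 2" by (simp add: field_simps)
  then have "x = of_int (n - 1) * pi + pi / 2" by simp
  then show "cos x = 0" unfolding cos_zero_iff_int2 by blast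
qed

context radial_equation begin

definition angular_speed :: "(real \<Rightarrow> real) \<Rightarrow> (real \<Rightarrow> real) \<Rightarrow> real \<Rightarrow> real" where
  "angular_speed w z r = (w r * (sinh r ^ d * nonlin (w r)) + velocity z r * z r) / ((w r)\<^sup>2
      + (z r)\<^sup>2)"

definition angle :: "(real \<Rightarrow> real) \<Rightarrow> (real \<Rightarrow> real) \<Rightarrow> real \<Rightarrow> real" where
  "angle w z r = integral {0..r} (angular_speed w z)"

text \<open>As the angle of (w, z) increases from 0, this is the number of zeros of w in [0, r].\<close>

definition nodal_count :: "(real \<Rightarrow> real) \<Rightarrow> (real \<Rightarrow> real) \<Rightarrow> real \<Rightarrow> int" where
  "nodal_count w z r = \<lfloor>angle w z r / pi + 1 / 2\<rfloor>"

context
  fixes w z :: "real \<Rightarrow> real"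
  assumes sol: "shooting_solution w z"
begin

lemma continuous_on_angular_speed: "continuous_on {0..} (angular_speed w z)"
  unfolding angular_speed_def[abs_def]
  by (intro continuous_intros continuous_on_w[OF sol] continuous_on_z[OF sol]
      continuous_on_nonlin_w[OF sol] continuous_on_v[OF sol])
     (use w_z_nonzero[OF sol] in force)

lemma angular_speed_nonneg:
  assumes "r \<ge> 0"
  shows "angular_speed w z r \<ge> 0"
proof -
  have "sinh r ^ d * (w r * nonlin (w r)) \<ge> 0"
    using assms by (intro mult_nonneg_nonneg[OF _ nonlin_mult_self_nonneg]) simp
  moreover have "velocity z r * z r \<ge> 0" using assms by (simp add: velocity_def divide_nonneg_nonneg)
  ultimately show ?thesis unfolding angular_speed_def
    by (intro divide_nonneg_nonneg add_nonneg_nonneg) (auto simp: mult_ac)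
qed

lemma continuous_on_angle: "continuous_on {0..} (angle w z)"
  unfolding angle_def[abs_def]
    by (rule continuous_on_indefinite_integral[OF continuous_on_angular_speed])

lemma angle_0: "angle w z 0 = 0"
  by (simp add: angle_def)

lemma angle_deriv: "r > 0 \<Longrightarrow> (angle w z has_real_derivative angular_speed w z r) (at r)"
  unfolding angle_def[abs_def]
  by (rule has_real_derivative_indefinite_integral[OF continuous_on_angular_speed])

lemma angle_mono:
  assumes "0 \<le> r" "r \<le> s"
  shows "angle w z r \<le> angle w z s"
proof (rule DERIV_nonneg_imp_increasing_open[OF assms(2)])
  fix x assume "r < x" "x < s"
  then show "\<exists>y. (angle w z has_real_derivative y) (at x) \<and> 0 \<le> y"
    using angle_deriv[of x] angular_speed_nonneg[of x] assms by auto
qed (use assms in \<open>auto intro: continuous_on_subset[OF continuous_on_angle]\<close>)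

lemma plane_curve_angle_shooting:
  "plane_curve_angle w z (\<lambda>r. - velocity z r) (\<lambda>r. sinh r ^ d * nonlin (w r)) (angle w z)"
  by unfold_locales
     (use continuous_on_w[OF sol] continuous_on_z[OF sol] w_deriv[OF sol] z_deriv[OF sol]
        continuous_on_angle angle_deriv w_z_nonzero[OF sol] in \<open>auto simp: angular_speed_def\<close>)

lemma w_polar:
  assumes "r \<ge> 0"
  obtains R where "R > 0" "w r = R * cos (angle w z r)"
  using plane_curve_angle.polar_coordinates(1)[OF plane_curve_angle_shooting angle_0
      initial_pos[OF sol] z_0[OF sol] assms]
    w_z_nonzero[OF sol assms] by (metis real_sqrt_gt_0_iff)

lemma w_eq_0_iff: "r \<ge> 0 \<Longrightarrow> w r = 0 \<longleftrightarrow> angle w z r / pi + 1 / 2 \<in> \<int>"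
  unfolding cos_eq_0_iff_Ints[symmetric] by (metis mult_eq_0_iff less_irrefl w_polar)

lemma alternates_angle:
  "alternates w k r \<Longrightarrow> r > 0 \<and> angle w z r > (real k - 1 / 2) * pi"
proof (induction k arbitrary: r)
  case 0
  then have "angle w z r \<ge> 0" using angle_mono[of 0 r] angle_0 by simp
  then show ?case using 0 pi_gt_zero by (auto intro: less_le_trans[of _ 0])
next
  case (Suc k)
  then obtain s where s: "s < r" "alternates w k s" "w r * w s < 0" by auto
  have IH: "s > 0" "angle w z s > (real k - 1 / 2) * pi" using Suc.IH[OF s(2)] by auto
  define a b where "a = angle w z s - real k * pi" and "b = angle w z r - real k * pi"
  have "a \<le> b" "a > - (pi / 2)" using angle_mono[of s r] IH s
    by (auto simp: a_def b_def algebra_simps)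
  have "b > pi / 2"
  proof (rule ccontr)
    assume "\<not> b > pi / 2"
    then have cos_ab: "cos a \<ge> 0" "cos b \<ge> 0" using \<open>a \<le> b\<close> \<open>a > - (pi / 2)\<close>
      by (auto intro!: cos_ge_zero)
    have "angle w z s = a + pi * real k" "angle w z r = b + pi * real k" by (auto simp: a_def b_def)
    then have cos_angle: "cos (angle w z s) = cos a * (-1) ^ k" "cos (angle w z r) = cos b * (-1) ^ k"
      by (simp_all add: cos_add mult.commute[of pi])
    obtain R S where "R > 0" "w s = R * cos (angle w z s)" "S > 0" "w r = S * cos (angle w z r)"
      using w_polar[of s] w_polar[of r] IH(1) s(1) by (metis less_imp_le less_trans)
    then have "w r * w s = (R * S) * (cos a * cos b) * ((-1) ^ k * (-1) ^ k)" by (simp add: cos_angle)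
    also have "\<dots> = (R * S) * (cos a * cos b)" by (simp flip: power_mult_distrib)
    finally have "w r * w s \<ge> 0" using \<open>R > 0\<close> \<open>S > 0\<close> cos_ab by simp
    then show False using s(3) by simp
  qed
  then show ?case using IH s by (simp add: b_def algebra_simps)
qed

lemma nodal_count_constant:
  assumes "0 \<le> r" "r \<le> s" and nonzero: "\<And>x. x \<ge> r \<Longrightarrow> w x \<noteq> 0"
  shows "nodal_count w z s = nodal_count w z r"
proof (rule connected_local_const[of "{r..s}"])
  show "\<forall>a\<in>{r..s}. \<forall>\<^sub>F b in at a within {r..s}. nodal_count w z a = nodal_count w z b"
  proof
    fix a assume a: "a \<in> {r..s}"
    have "continuous_on {r..s} (\<lambda>r. angle w z r / pi + 1 / 2)"
      by (intro continuous_intros continuous_on_subset[OF continuous_on_angle]) (use assms in auto)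
    then have "((\<lambda>r. angle w z r / pi + 1 / 2) \<longlongrightarrow> angle w z a / pi + 1 / 2) (at a within {r..s})"
      using a by (auto simp: continuous_on_def)
    moreover have "angle w z a / pi + 1 / 2 \<notin> \<int>" using w_eq_0_iff[of a] nonzero[of a] a assms(1)
      by auto
    ultimately show "\<forall>\<^sub>F b in at a within {r..s}. nodal_count w z a = nodal_count w z b"
      unfolding nodal_count_def eq_commute[of "\<lfloor>angle w z a / pi + 1 / 2\<rfloor>"]
        by (rule eventually_floor_eq)
  qed
qed (use assms in auto)

lemma alternates_nodal_count:
  assumes "alternates w k r" "r \<le> s"
  shows "nodal_count w z s \<ge> int k"
proof -
  have "(real k - 1 / 2) * pi < angle w z s"
    using alternates_angle[OF assms(1)] angle_mono[of r s] assms(2) by auto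
  then have "real k - 1 / 2 < angle w z s / pi" by (simp add: field_simps)
  then show ?thesis by (simp add: nodal_count_def le_floor_iff)
qed

end

end

section \<open>Fast and slow decay\<close>

lemma coth_real_le_2:
  assumes "r \<ge> 1"
  shows "cosh r / sinh (r::real) \<le> 2"
proof -
  have "3 \<le> exp (2 * r)" using exp_ge_add_one_self[of "2 * r"] assms by linarith
  then have "3 * exp (- r) \<le> exp (2 * r) * exp (- r)" by (intro mult_right_mono) auto
  also have "\<dots> = exp r" by (simp add: exp_add[symmetric])
  finally have "cosh r \<le> 2 * sinh r" by (simp add: cosh_field_def sinh_field_def)
  then show ?thesis using assms by (simp add: field_simps)
qed

context radial_equation begin

text \<open>Adding a small multiple of w w' to the energy gives a Lyapunov function.\<close>

definition coupling :: real where
  "coupling = min (min (1 / 2) (lam / 2)) (real d / 2 / (1 + 2 * (real d)\<^sup>2 / lam))"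

definition lyapunov :: "(real \<Rightarrow> real) \<Rightarrow> (real \<Rightarrow> real) \<Rightarrow> real \<Rightarrow> real" where
  "lyapunov w z r = E w z r - coupling * (w r * velocity z r)"

lemma coupling_pos: "coupling > 0"
  and coupling_le: "coupling \<le> 1 / 2" "coupling \<le> lam / 2"
    "coupling * (1 + 2 * (real d)\<^sup>2 / lam) \<le> real d / 2"
proof -
  have pos: "1 + 2 * (real d)\<^sup>2 / lam > 0" using lam_pos by (simp add: add_pos_nonneg)
  show "coupling > 0" using lam_pos d_ge_1 pos by (simp add: coupling_def)
  show "coupling \<le> 1 / 2" "coupling \<le> lam / 2" unfolding coupling_def by linarith+
  have "coupling \<le> real d / 2 / (1 + 2 * (real d)\<^sup>2 / lam)" by (simp add: coupling_def)
  then show "coupling * (1 + 2 * (real d)\<^sup>2 / lam) \<le> real d / 2" unfolding pos_le_divide_eq[OF pos] .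
qed

lemma half_E_le_lyapunov: "E w z r / 2 \<le> lyapunov w z r"
proof -
  define u v where "u = w r" and "v = velocity z r"
  have "coupling * (u * v) \<le> coupling * ((u\<^sup>2 + v\<^sup>2) / 2)"
    using coupling_pos sum_squares_bound[of u v] by (intro mult_left_mono) auto
  also have "\<dots> = coupling * u\<^sup>2 / 2 + coupling * v\<^sup>2 / 2"
    by (simp add: algebra_simps add_divide_distrib)
  also have "\<dots> \<le> (lam / 2) * u\<^sup>2 / 2 + (1 / 2) * v\<^sup>2 / 2"
    using coupling_le by (intro add_mono divide_right_mono mult_right_mono) auto
  also have "\<dots> \<le> E w z r / 2" using quadratic_le_potential[of u] by (simp add: energy_def u_def v_def)
  finally show ?thesis by (simp add: lyapunov_def u_def v_def)
qed

lemma lyapunov_dissipation: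
  fixes u v c :: real
  assumes "1 \<le> c" "c \<le> 2"
  shows "- (real d * c) * v\<^sup>2 - coupling * (- v * v + (nonlin u - real d * c * v) * u)
    \<le> - coupling * (v\<^sup>2 / 2 + potential u)"
proof -
  have "(real d * c) * (u * v) \<le> (real d * c) * \<bar>u * v\<bar>" using assms by (intro mult_left_mono) auto
  also have "\<dots> \<le> (real d * 2) * \<bar>u * v\<bar>" using assms by (intro mult_right_mono mult_left_mono) auto
  also have "\<dots> \<le> lam * u\<^sup>2 / 2 + (2 * (real d)\<^sup>2 / lam) * v\<^sup>2"
  proof -
    have "0 \<le> (lam * \<bar>u\<bar> - 2 * real d * \<bar>v\<bar>)\<^sup>2 / (2 * lam)" using lam_pos by simp
    also have "\<dots> = lam * u\<^sup>2 / 2 + (2 * (real d)\<^sup>2 / lam) * v\<^sup>2 - (real d * 2) * \<bar>u * v\<bar>"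
      using lam_pos
        by (simp add: power2_diff power_mult_distrib abs_mult field_simps power2_eq_square)
    finally show ?thesis by simp
  qed
  finally have "coupling * ((real d * c) * (u * v))
      \<le> coupling * (lam * u\<^sup>2 / 2 + (2 * (real d)\<^sup>2 / lam) * v\<^sup>2)"
    using coupling_pos by (intro mult_left_mono) auto
  then have "coupling * ((real d * c) * (u * v))
      \<le> coupling * (lam * u\<^sup>2 / 2) + coupling * (2 * (real d)\<^sup>2 / lam) * v\<^sup>2"
    by (simp only: distrib_left mult.assoc)
  moreover have "coupling * v\<^sup>2 + coupling * (2 * (real d)\<^sup>2 / lam) * v\<^sup>2 \<le> real d / 2 * v\<^sup>2"
    using mult_right_mono[OF coupling_le(3), of "v\<^sup>2"] by (simp add: distrib_left distrib_right)
  moreover have "real d * v\<^sup>2 \<le> real d * c * v\<^sup>2"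
    using assms by (intro mult_right_mono) (auto simp: mult_le_cancel_left1)
  moreover have "coupling * v\<^sup>2 \<le> real d * v\<^sup>2"
    using coupling_le(1) d_ge_1 by (intro mult_right_mono) auto
  moreover have "coupling * potential u \<le> coupling * (u * nonlin u) - coupling * (lam * u\<^sup>2 / 2)"
    using mult_left_mono[OF potential_le_nonlin[of u], of coupling] coupling_pos
    by (simp only: right_diff_distrib less_imp_le)
  moreover have "- (real d * c) * v\<^sup>2 - coupling * (- v * v + (nonlin u - real d * c * v) * u)
      = - (real d * c * v\<^sup>2) + coupling * v\<^sup>2 - coupling * (u * nonlin u) + coupling *
        ((real d * c) * (u * v))"
    by (simp add: algebra_simps power2_eq_square)
  moreover have "- coupling * (v\<^sup>2 / 2 + potential u)
      = - (coupling * v\<^sup>2) / 2 - coupling * potential u"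
    by (simp add: algebra_simps)
  ultimately show ?thesis by linarith
qed

lemma lyapunov_deriv_le:
  fixes r :: real
  assumes sol: "shooting_solution w z" and "r \<ge> 1"
  obtains D where "(lyapunov w z has_real_derivative D) (at r)" "D \<le> - coupling * E w z r"
proof -
  have "r > 0" using \<open>r \<ge> 1\<close> by simp
  define c where "c = cosh r / sinh r"
  have "1 \<le> c" "c \<le> 2" using coth_real_ge_1[OF \<open>r > 0\<close>] coth_real_le_2[OF \<open>r \<ge> 1\<close>]
    by (auto simp: c_def)
  moreover have "(lyapunov w z has_real_derivative
      - (real d * c) * (velocity z r)\<^sup>2
        - coupling * (- velocity z r * velocity z r + (nonlin (w r) - real d * c * velocity z r)
            * w r)) (at r)"
    unfolding lyapunov_def[abs_def] c_def
    by (intro DERIV_diff DERIV_cmult DERIV_mult E_deriv[OF sol] w_deriv[OF sol]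
        v_deriv[OF sol] \<open>r > 0\<close>)
  ultimately show ?thesis using that lyapunov_dissipation by (simp add: energy_def)
qed

lemma E_eventually_small:
  assumes sol: "shooting_solution w z" and "e > 0"
  shows "\<exists>r\<ge>1. E w z r < e"
proof (rule ccontr)
  assume "\<not> ?thesis"
  then have large: "E w z r \<ge> e" if "r \<ge> 1" for r using that by force
  define s where "s = 1 + lyapunov w z 1 / (coupling * e)"
  have "lyapunov w z 1 \<ge> 0" using half_E_le_lyapunov[of w z 1] large[of 1] \<open>e > 0\<close> by simp
  then have "s \<ge> 1" using coupling_pos \<open>e > 0\<close> by (simp add: s_def)
  have "lyapunov w z s + coupling * e * s \<le> lyapunov w z 1 + coupling * e * 1"
  proof (rule DERIV_nonpos_imp_nonincreasing[where f = "\<lambda>r. lyapunov w z r + coupling * e * r", OF \<open>s \<ge> 1\<close>])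
    fix x :: real assume "1 \<le> x"
    then obtain D where D: "(lyapunov w z has_real_derivative D) (at x)" "D \<le> - coupling * E w z x"
      by (rule lyapunov_deriv_le[OF sol])
    have "coupling * e \<le> coupling * E w z x" using large[OF \<open>1 \<le> x\<close>] coupling_pos
      by (intro mult_left_mono) auto
    then have "D + coupling * e \<le> 0" using D(2) by simp
    moreover have "((\<lambda>r. lyapunov w z r + coupling * e * r) has_real_derivative D
        + coupling * e) (at x)"
      using D(1) by (auto intro!: derivative_eq_intros)
    ultimately show "\<exists>y. ((\<lambda>r. lyapunov w z r + coupling * e * r) has_real_derivative y) (at x) \<and> y
        \<le> 0" by blast
  qed
  moreover have "coupling * e * (s - 1) = lyapunov w z 1" using coupling_pos \<open>e > 0\<close>
    by (simp add: s_def)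
  ultimately have "lyapunov w z s \<le> 0" by (simp add: algebra_simps)
  then show False using half_E_le_lyapunov[of w z s] large[OF \<open>s \<ge> 1\<close>] \<open>e > 0\<close> by simp
qed

end

locale coercive_radial_equation = radial_equation +
  assumes lam_less: "lam < (real d / 2)\<^sup>2"
begin

definition spectral_gap :: real where
  "spectral_gap = (real d / 2)\<^sup>2 - lam"

definition decay_rate :: real where
  "decay_rate = real d / 2 + min (real d / 4) (sqrt (spectral_gap / 2))"

definition small_energy :: real where
  "small_energy = lam * ((spectral_gap / 2) powr (1 / q))\<^sup>2 / 2"

definition amplified :: "(real \<Rightarrow> real) \<Rightarrow> real \<Rightarrow> real" where
  "amplified w r = w r * exp (decay_rate * r)"

definition amplified_flux :: "(real \<Rightarrow> real) \<Rightarrow> (real \<Rightarrow> real) \<Rightarrow> real \<Rightarrow> real" where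
  "amplified_flux w z r = exp (- decay_rate * r) * (decay_rate * w r * sinh r ^ d - z r)"

text \<open>For small energy the amplified solution is convex away from its zeros, so once |amplified w|
  increases, it increases forever.\<close>

definition slow_at :: "(real \<Rightarrow> real) \<Rightarrow> (real \<Rightarrow> real) \<Rightarrow> real \<Rightarrow> bool" where
  "slow_at w z r \<longleftrightarrow> r \<ge> 1 \<and> E w z r < small_energy \<and> amplified w r * amplified_flux w z r > 0"

definition fast_solution :: "(real \<Rightarrow> real) \<Rightarrow> (real \<Rightarrow> real) \<Rightarrow> bool" where
  "fast_solution w z \<longleftrightarrow> shooting_solution w z \<and>
     (\<exists>C. \<forall>r\<ge>0. \<bar>w r\<bar> \<le> C * exp (- decay_rate * r) \<and> \<bar>velocity z r\<bar> \<le> C * exp (- decay_rate * r))"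

lemma spectral_gap_pos: "spectral_gap > 0"
  using lam_less by (simp add: spectral_gap_def)

lemma decay_rate_gt: "decay_rate > real d / 2"
  using spectral_gap_pos d_ge_1 by (simp add: decay_rate_def)

lemma decay_rate_pos: "decay_rate > 0"
  using decay_rate_gt by (rule le_less_trans[rotated]) simp

lemma small_energy_pos: "small_energy > 0"
  using spectral_gap_pos lam_pos by (simp add: small_energy_def)

lemma decay_rate_bound: "lam + spectral_gap / 2 \<le> decay_rate * (real d - decay_rate)"
proof -
  define x where "x = min (real d / 4) (sqrt (spectral_gap / 2))"
  have "x\<^sup>2 \<le> (sqrt (spectral_gap / 2))\<^sup>2"
    using spectral_gap_pos by (intro power_mono) (auto simp: x_def)
  then have "x\<^sup>2 \<le> spectral_gap / 2" using spectral_gap_pos by simp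
  moreover have "decay_rate * (real d - decay_rate) = (real d / 2)\<^sup>2 - x\<^sup>2"
    by (simp add: decay_rate_def x_def[symmetric] field_simps power2_eq_square)
  ultimately show ?thesis by (simp add: spectral_gap_def field_simps)
qed

lemma abs_powr_le_if_small_energy:
  assumes "E w z r \<le> small_energy"
  shows "\<bar>w r\<bar> powr q \<le> spectral_gap / 2"
proof -
  have "lam * (w r)\<^sup>2 / 2 \<le> lam * ((spectral_gap / 2) powr (1 / q))\<^sup>2 / 2"
    using quadratic_le_potential[of "w r"] potential_le_energy[of potential w r z] assms
    unfolding small_energy_def by linarith
  then have "\<bar>w r\<bar>\<^sup>2 \<le> ((spectral_gap / 2) powr (1 / q))\<^sup>2" using lam_pos by simp
  then have "\<bar>w r\<bar> \<le> (spectral_gap / 2) powr (1 / q)" by (rule power2_le_imp_le) simp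
  then have "\<bar>w r\<bar> powr q \<le> ((spectral_gap / 2) powr (1 / q)) powr q" using q_pos
    by (intro powr_mono2) auto
  then show ?thesis using q_pos spectral_gap_pos by (simp add: powr_powr)
qed

context
  fixes w z :: "real \<Rightarrow> real"
  assumes sol: "shooting_solution w z"
begin

lemma amplified_deriv:
  assumes "r > 0"
  shows "(amplified w has_real_derivative
    exp (2 * decay_rate * r) / sinh r ^ d * amplified_flux w z r) (at r)"
proof -
  have quotient: "(decay_rate * w r * sinh r ^ d - z r) / sinh r ^ d
      = decay_rate * w r - velocity z r"
    using assms by (simp add: velocity_def diff_divide_distrib)
  have "exp (2 * decay_rate * r) * exp (- decay_rate * r) = exp (decay_rate * r)"
    by (simp flip: exp_add)
  then have "exp (2 * decay_rate * r) / sinh r ^ d * amplified_flux w z r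
      = exp (decay_rate * r) * ((decay_rate * w r * sinh r ^ d - z r) / sinh r ^ d)"
    by (simp add: amplified_flux_def)
  also have "\<dots> = - velocity z r * exp (decay_rate * r) + exp (decay_rate * r) * decay_rate * w r"
    unfolding quotient by (simp add: algebra_simps)
  finally show ?thesis
    unfolding amplified_def[abs_def] by (auto intro!: derivative_eq_intros w_deriv[OF sol assms])
qed

lemma amplified_flux_deriv:
  assumes "r > 0"
  shows "(amplified_flux w z has_real_derivative exp (- 2 * decay_rate * r) * sinh r ^ d *
    (decay_rate * real d * (cosh r / sinh r) - decay_rate\<^sup>2 - lam - \<bar>w r\<bar> powr q) *
      amplified w r) (at r)"
proof -
  define S c where "S = sinh r ^ d" and "c = cosh r / sinh r"
  have "S > 0" using assms by (simp add: S_def)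
  have "real d * sinh r ^ (d - 1) * cosh r = real d * sinh r ^ (d - 1) * cosh r / S * S"
    using \<open>S > 0\<close> by simp
  also have "\<dots> = real d * c * S" unfolding S_def c_def weight_log_deriv[OF assms] ..
  finally have weight: "((\<lambda>r. sinh r ^ d) has_real_derivative real d * c * S) (at r)"
    using p_deriv[OF assms] by (simp only:)
  have "(amplified_flux w z has_real_derivative (- decay_rate) * exp (- decay_rate * r) * (decay_rate * w r * S - z r)
      + exp (- decay_rate * r) * (decay_rate * (- velocity z r) * S + decay_rate * w r *
          (real d * c * S)
        - S * nonlin (w r))) (at r)"
    unfolding amplified_flux_def[abs_def]
    by (rule derivative_eq_intros weight w_deriv[OF sol assms] z_deriv[OF sol assms] refl)+
       (simp add: S_def algebra_simps)
  moreover have "exp (- 2 * decay_rate * r) * S * X * amplified w r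
      = (- decay_rate) * exp (- decay_rate * r) * (decay_rate * w r * S - z r)
      + exp (- decay_rate * r) * (decay_rate * (- velocity z r) * S + decay_rate * w r *
          (real d * c * S)
        - S * nonlin (w r))"
    if "X = decay_rate * real d * c - decay_rate\<^sup>2 - lam - \<bar>w r\<bar> powr q" for X
  proof -
    have z: "z r = velocity z r * S" using assms by (simp add: velocity_def S_def)
    have "exp (- 2 * decay_rate * r) * exp (decay_rate * r) = exp (- decay_rate * r)"
      by (simp flip: exp_add)
    then have "exp (- 2 * decay_rate * r) * S * X * amplified w r
        = exp (- decay_rate * r) * (S * X * w r)"
      by (simp add: amplified_def mult_ac)
    then show ?thesis unfolding z by (simp add: that nonlin_def algebra_simps power2_eq_square)
  qed
  ultimately show ?thesis unfolding S_def[symmetric] c_def[symmetric] by (simp only:)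
qed

lemma barrier_nonneg:
  assumes "r > 0" "E w z r \<le> small_energy"
  shows "decay_rate * real d * (cosh r / sinh r) - decay_rate\<^sup>2 - lam - \<bar>w r\<bar> powr q \<ge> 0"
proof -
  have "decay_rate * real d * 1 \<le> decay_rate * real d * (cosh r / sinh r)"
    using coth_real_ge_1[OF assms(1)] decay_rate_pos by (intro mult_left_mono) auto
  then show ?thesis
    using decay_rate_bound abs_powr_le_if_small_energy[OF assms(2)]
    by (simp add: algebra_simps power2_eq_square)
qed

lemma slow_at_imp_nonzero:
  assumes slow: "slow_at w z s" and "r \<ge> s"
  shows "w r \<noteq> 0"
proof -
  have "amplified w s * amplified_flux w z s \<le> amplified w r * amplified_flux w z r"
  proof (rule DERIV_nonneg_imp_nondecreasing[where f = "\<lambda>r. amplified w r * amplified_flux w z r", OF \<open>r \<ge> s\<close>])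
    fix x assume "s \<le> x"
    then have x: "x > 0" "E w z x \<le> small_energy"
      using slow E_antimono[OF sol, of s x] by (auto simp: slow_at_def)
    define A B where "A = exp (2 * decay_rate * x) / sinh x ^ d"
      and "B = exp (- 2 * decay_rate * x) * sinh x ^ d *
        (decay_rate * real d * (cosh x / sinh x) - decay_rate\<^sup>2 - lam - \<bar>w x\<bar> powr q)"
    have "A \<ge> 0" "B \<ge> 0" using x barrier_nonneg[OF x] by (auto simp: A_def B_def)
    then have "A * amplified_flux w z x * amplified_flux w z x + B * amplified w x * amplified w x
        \<ge> 0"
      by (simp add: mult.assoc)
    then show "\<exists>y. ((\<lambda>r. amplified w r * amplified_flux w z r) has_real_derivative y) (at x) \<and> 0 \<le> y"
      using DERIV_mult[OF amplified_deriv[OF x(1)] amplified_flux_deriv[OF x(1)]]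
      unfolding A_def[symmetric] B_def[symmetric] by blast
  qed
  then show ?thesis using slow by (auto simp: slow_at_def amplified_def)
qed

lemma slow_at_nodal_count: "slow_at w z s \<Longrightarrow> r \<ge> s \<Longrightarrow> nodal_count w z r = nodal_count w z s"
  by (rule nodal_count_constant[OF sol]) (use slow_at_imp_nonzero in \<open>auto simp: slow_at_def\<close>)

lemma slow_at_nodal_count_eq:
  assumes "slow_at w z r" "slow_at w z s"
  shows "nodal_count w z r = nodal_count w z s"
  using slow_at_nodal_count[OF assms(1), of "max r s"] slow_at_nodal_count[OF assms(2), of "max r s"]
    by simp

context
  fixes R :: real
  assumes R_ge_1: "R \<ge> 1" and not_slow: "\<And>r. r \<ge> R \<Longrightarrow> amplified w r * amplified_flux w z r \<le> 0"
begin

lemma abs_w_le_exp: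
  assumes "r \<ge> R"
  shows "\<bar>w r\<bar> \<le> \<bar>amplified w R\<bar> * exp (- decay_rate * r)"
proof -
  have "(amplified w r)\<^sup>2 \<le> (amplified w R)\<^sup>2"
  proof (rule DERIV_nonpos_imp_nonincreasing[where f = "\<lambda>r. (amplified w r)\<^sup>2", OF assms])
    fix x assume "R \<le> x"
    then have "x > 0" using R_ge_1 by simp
    define A where "A = exp (2 * decay_rate * x) / sinh x ^ d"
    have "((\<lambda>r. (amplified w r)\<^sup>2) has_real_derivative 2 * A * (amplified w x * amplified_flux w z x)) (at x)"
      by (rule DERIV_cong[OF DERIV_power[OF amplified_deriv[OF \<open>x > 0\<close>], of 2]]) (simp add: A_def)
    moreover have "2 * A * (amplified w x * amplified_flux w z x) \<le> 0"
      by (rule mult_nonneg_nonpos) (use not_slow[OF \<open>R \<le> x\<close>] \<open>x > 0\<close> in \<open>auto simp: A_def\<close>)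
    ultimately show "\<exists>y. ((\<lambda>r. (amplified w r)\<^sup>2) has_real_derivative y) (at x) \<and> y \<le> 0" by blast
  qed
  then have "\<bar>amplified w r\<bar> \<le> \<bar>amplified w R\<bar>" by (simp add: abs_le_square_iff)
  then have "\<bar>w r\<bar> * exp (decay_rate * r) * exp (- decay_rate * r)
      \<le> \<bar>amplified w R\<bar> * exp (- decay_rate * r)"
    by (intro mult_right_mono) (auto simp: amplified_def abs_mult)
  then show ?thesis by (simp add: mult.assoc exp_add[symmetric])
qed

lemma z_nonlin_nonneg:
  assumes "r \<ge> R"
  shows "z r * nonlin (w r) \<ge> 0"
proof -
  have "amplified w r * amplified_flux w z r = w r * (decay_rate * w r * sinh r ^ d - z r)"
    by (simp add: amplified_def amplified_flux_def exp_minus)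
  then have "decay_rate * (w r)\<^sup>2 * sinh r ^ d \<le> z r * w r"
    using not_slow[OF assms] by (simp add: algebra_simps power2_eq_square)
  moreover have "decay_rate * (w r)\<^sup>2 * sinh r ^ d \<ge> 0" using decay_rate_pos assms R_ge_1 by simp
  ultimately have "z r * w r \<ge> 0" by linarith
  then have "(lam + \<bar>w r\<bar> powr q) * (z r * w r) \<ge> 0"
    by (rule mult_nonneg_nonneg[rotated]) (use lam_pos in simp)
  then show ?thesis by (simp add: nonlin_def algebra_simps)
qed

lemma abs_z_mono:
  assumes "R \<le> s" "s \<le> r"
  shows "\<bar>z s\<bar> \<le> \<bar>z r\<bar>"
proof -
  have "(z s)\<^sup>2 \<le> (z r)\<^sup>2"
  proof (rule DERIV_nonneg_imp_nondecreasing[where f = "\<lambda>r. (z r)\<^sup>2", OF assms(2)])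
    fix x assume "s \<le> x"
    then have "x > 0" "x \<ge> R" using assms R_ge_1 by auto
    have "((\<lambda>r. (z r)\<^sup>2) has_real_derivative 2 * sinh x ^ d * (z x * nonlin (w x))) (at x)"
      by (rule DERIV_cong[OF DERIV_power[OF z_deriv[OF sol \<open>x > 0\<close>], of 2]]) simp
    moreover have "2 * sinh x ^ d * (z x * nonlin (w x)) \<ge> 0"
      by (rule mult_nonneg_nonneg[OF _ z_nonlin_nonneg[OF \<open>x \<ge> R\<close>]]) (use \<open>x > 0\<close> in simp)
    ultimately show "\<exists>y. ((\<lambda>r. (z r)\<^sup>2) has_real_derivative y) (at x) \<and> 0 \<le> y" by blast
  qed
  then show ?thesis by (simp add: abs_le_square_iff)
qed

lemma abs_velocity_le_exp:
  assumes "r \<ge> R"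
  shows "\<bar>velocity z r\<bar> \<le> (cosh 1 + 2 * sinh 1) ^ d * (2 * \<bar>amplified w R\<bar>) * exp (- decay_rate * r)"
proof -
  define C K where "C = \<bar>amplified w R\<bar>" and "K = cosh 1 + 2 * sinh (1::real)"
  have "r > 0" "r \<ge> 1" using assms R_ge_1 by auto
  obtain x where x: "r < x" "x < r + 1" "w (r + 1) - w r = (r + 1 - r) * (- velocity z x)"
    using MVT2[of r "r + 1" w "\<lambda>x. - velocity z x"] w_deriv[OF sol] \<open>r > 0\<close> by auto
  have velocity_x: "\<bar>velocity z x\<bar> \<le> 2 * C * exp (- decay_rate * r)"
  proof -
    have "\<bar>velocity z x\<bar> \<le> \<bar>w (r + 1)\<bar> + \<bar>w r\<bar>" using x(3) by simp
    also have "\<dots> \<le> C * exp (- decay_rate * (r + 1)) + C * exp (- decay_rate * r)"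
      unfolding C_def using assms by (intro add_mono abs_w_le_exp) auto
    also have "\<dots> \<le> C * exp (- decay_rate * r) + C * exp (- decay_rate * r)"
      using decay_rate_pos by (intro add_mono mult_left_mono) (auto simp: C_def algebra_simps)
    finally show ?thesis by simp
  qed
  have sinh_x: "sinh x ^ d \<le> sinh r ^ d * K ^ d"
  proof -
    have "cosh r \<le> 2 * sinh r" using coth_real_le_2[OF \<open>r \<ge> 1\<close>] \<open>r > 0\<close> by (simp add: divide_le_eq)
    then have "cosh r * sinh 1 \<le> 2 * sinh r * sinh 1" by (intro mult_right_mono) auto
    then have "sinh (r + 1) \<le> sinh r * K" by (simp add: K_def sinh_add algebra_simps)
    then have "sinh x \<le> sinh r * K" by (rule order_trans[rotated]) (use x(2) in simp)
    then have "sinh x ^ d \<le> (sinh r * K) ^ d"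
      using x(1) \<open>r > 0\<close> by (intro power_mono) auto
    then show ?thesis by (simp add: power_mult_distrib)
  qed
  have "\<bar>velocity z r\<bar> * sinh r ^ d = \<bar>z r\<bar>" using \<open>r > 0\<close> by (simp add: velocity_def abs_mult)
  also have "\<dots> \<le> \<bar>z x\<bar>" using abs_z_mono[OF assms] x by simp
  also have "\<dots> = \<bar>velocity z x\<bar> * sinh x ^ d" using x \<open>r > 0\<close> by (simp add: velocity_def abs_mult)
  also have "\<dots> \<le> (2 * C * exp (- decay_rate * r)) * (sinh r ^ d * K ^ d)"
    using velocity_x sinh_x x(1) \<open>r > 0\<close> by (intro mult_mono) (auto simp: C_def)
  finally have "\<bar>velocity z r\<bar> * sinh r ^ d \<le> (K ^ d * (2 * C) * exp (- decay_rate * r)) * sinh r ^ d"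
    by (simp add: mult_ac)
  then show ?thesis using \<open>r > 0\<close> by (simp add: mult_le_cancel_right C_def K_def)
qed

lemma fast_solution_if_not_slow: "fast_solution w z"
proof -
  obtain C where C: "\<And>r. r \<ge> 0 \<Longrightarrow> \<bar>w r\<bar> \<le> C * exp (- decay_rate * r)"
    using exp_decay_from_tail[OF continuous_on_w[OF sol] abs_w_le_exp] by blast
  obtain C' where C': "\<And>r. r \<ge> 0 \<Longrightarrow> \<bar>velocity z r\<bar> \<le> C' * exp (- decay_rate * r)"
    using exp_decay_from_tail[OF continuous_on_v[OF sol] abs_velocity_le_exp] by blast
  have "\<bar>w r\<bar> \<le> max C C' * exp (- decay_rate * r) \<and> \<bar>velocity z r\<bar>
      \<le> max C C' * exp (- decay_rate * r)"
    if "r \<ge> 0" for r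
    by (intro conjI order_trans[OF C[OF that]] order_trans[OF C'[OF that]] mult_right_mono) auto
  then show ?thesis using sol by (auto simp: fast_solution_def)
qed

end

lemma fast_or_slow: "fast_solution w z \<or> (\<exists>r. slow_at w z r)"
proof -
  obtain R where R: "R \<ge> 1" "E w z R < small_energy"
    using E_eventually_small[OF sol small_energy_pos] by blast
  then have "E w z r < small_energy \<and> r \<ge> 1" if "r \<ge> R" for r
    using E_antimono[OF sol, of R r] that by auto
  then show ?thesis using fast_solution_if_not_slow[OF R(1)] by (force simp: slow_at_def not_less)
qed

end

end

section \<open>Existence of fast solutions\<close>

lemma continuous_on_prod_lipschitz:
  fixes f :: "'a::metric_space \<Rightarrow> 'b::topological_space \<Rightarrow> 'c::real_normed_vector"
  assumes cont: "\<And>a. a \<in> U \<Longrightarrow> continuous_on T (f a)"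
    and lipschitz: "\<And>a b x. a \<in> U \<Longrightarrow> b \<in> U \<Longrightarrow> x \<in> T \<Longrightarrow> norm (f a x - f b x) \<le> C * dist a b"
  shows "continuous_on (U \<times> T) (\<lambda>p. f (fst p) (snd p))"
proof -
  have "((\<lambda>p. f (fst p) (snd p)) \<longlongrightarrow> f a x) (at (a, x) within U \<times> T)" if "a \<in> U" "x \<in> T" for a x
  proof -
    have "((\<lambda>p. f (fst p) (snd p) - f a (snd p)) \<longlongrightarrow> 0) (at (a, x) within U \<times> T)"
    proof (rule Lim_null_comparison)
      show "\<forall>\<^sub>F p in at (a, x) within U \<times> T. norm (f (fst p) (snd p) - f a (snd p))
          \<le> C * dist (fst p) a"
        unfolding eventually_at_filter by (rule always_eventually) (use lipschitz that in auto)
      have "((\<lambda>p. C * dist (fst p) a) \<longlongrightarrow> C * dist (fst (a, x)) a) (at (a, x) within U \<times> T)"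
        by (intro tendsto_intros)
      then show "((\<lambda>p. C * dist (fst p) a) \<longlongrightarrow> 0) (at (a, x) within U \<times> T)" by simp
    qed
    moreover have "continuous_on (U \<times> T) (\<lambda>p. f a (snd p))"
      by (rule continuous_on_compose2[OF cont[OF that(1)]]) (auto intro!: continuous_intros)
    then have "((\<lambda>p. f a (snd p)) \<longlongrightarrow> f a x) (at (a, x) within U \<times> T)"
      using that by (auto simp: continuous_on_def)
    ultimately have "((\<lambda>p. (f (fst p) (snd p) - f a (snd p)) + f a (snd p)) \<longlongrightarrow> 0
        + f a x) (at (a, x) within U \<times> T)"
      by (rule tendsto_add)
    then show ?thesis by simp
  qed
  then show ?thesis by (auto simp: continuous_on_def)
qed

locale shooting_family = coercive_radial_equation +
  fixes I :: "real set" and W Z :: "real \<Rightarrow> real \<Rightarrow> real" and B :: real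
  assumes family: "a \<in> I \<Longrightarrow> shooting_solution (W a) (Z a)" and initial: "a \<in> I \<Longrightarrow> W a 0 = a"
    and bounded: "a \<in> I \<Longrightarrow> a \<le> B" and B_pos: "B > 0"
begin

lemma continuous_on_W: "continuous_on (I \<times> {0..R}) (\<lambda>p. W (fst p) (snd p))"
  and continuous_on_velocity_Z: "continuous_on (I \<times> {0..R}) (\<lambda>p. velocity (Z (fst p)) (snd p))"
proof -
  obtain K k where K: "K > 0" "k > 0"
    and all_lipschitz: "\<forall>v y w z r. shooting_solution v y \<and> v 0 \<le> B \<and> shooting_solution w z \<and> w 0
        \<le> B \<and> r \<ge> 0 \<longrightarrow>
      \<bar>v r - w r\<bar> \<le> K * exp (k * r) * \<bar>v 0 - w 0\<bar> \<and>
      \<bar>velocity y r - velocity z r\<bar> \<le> K * exp (k * r) * \<bar>v 0 - w 0\<bar>"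
    using shooting_solution_lipschitz[OF B_pos] by blast
  have lipschitz: "\<bar>W a r - W b r\<bar> \<le> K * exp (k * r) * \<bar>a - b\<bar>"
      "\<bar>velocity (Z a) r - velocity (Z b) r\<bar> \<le> K * exp (k * r) * \<bar>a - b\<bar>"
    if "a \<in> I" "b \<in> I" "r \<ge> 0" for a b r
    using all_lipschitz[rule_format, of "W a" "Z a" "W b" "Z b" r] family[of a] family[of b]
      initial[of a] initial[of b] bounded[of a] bounded[of b] that by auto
  have mono: "K * exp (k * r) * \<bar>a - b\<bar> \<le> K * exp (k * R) * \<bar>a - b\<bar>" if "r \<in> {0..R}" for a b r
    using K that by (intro mult_right_mono mult_left_mono) auto
  show "continuous_on (I \<times> {0..R}) (\<lambda>p. W (fst p) (snd p))"
    by (rule continuous_on_prod_lipschitz[where C = "K * exp (k * R)"])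
       (use order_trans[OF lipschitz(1) mono] in
         \<open>auto simp: dist_real_def intro: continuous_on_subset[OF continuous_on_w[OF family]]\<close>)
  show "continuous_on (I \<times> {0..R}) (\<lambda>p. velocity (Z (fst p)) (snd p))"
    by (rule continuous_on_prod_lipschitz[where C = "K * exp (k * R)" and f = "\<lambda>a. velocity (Z a)"])
       (use order_trans[OF lipschitz(2) mono] in
         \<open>auto simp: dist_real_def intro: continuous_on_subset[OF continuous_on_v[OF family]]\<close>)
qed

lemma continuous_on_Z: "continuous_on (I \<times> {0..R}) (\<lambda>p. Z (fst p) (snd p))"
proof (rule continuous_on_eq)
  show "continuous_on (I \<times> {0..R}) (\<lambda>p. sinh (snd p) ^ d * velocity (Z (fst p)) (snd p))"
    by (intro continuous_intros continuous_on_velocity_Z)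
  show "sinh (snd p) ^ d * velocity (Z (fst p)) (snd p) = Z (fst p) (snd p)" if "p \<in> I \<times> {0..R}" for p
    using that z_0[OF family, of "fst p"] d_ge_1 by (cases "snd p = 0") (auto simp: velocity_def)
qed

lemma continuous_on_section:
  fixes f :: "real \<Rightarrow> real \<Rightarrow> real"
  assumes "continuous_on (I \<times> {0..R}) (\<lambda>p. f (fst p) (snd p))" "R \<ge> 0"
  shows "continuous_on I (\<lambda>a. f a R)"
proof -
  have "continuous_on I (\<lambda>a. (a, R))" "(\<lambda>a. (a, R)) ` I \<subseteq> I \<times> {0..R}"
    using assms(2) by (auto intro!: continuous_intros)
  from continuous_on_compose2[OF assms(1) this] show ?thesis by simp
qed

lemma continuous_on_angle_initial: "continuous_on I (\<lambda>a. angle (W a) (Z a) R)"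
proof -
  have "continuous_on (I \<times> {0..R}) (\<lambda>p. nonlin (W (fst p) (snd p)))"
    by (rule continuous_on_compose2[OF continuous_on_nonlin[of UNIV] continuous_on_W]) auto
  then have "continuous_on (I \<times> {0..R}) (\<lambda>p. angular_speed (W (fst p)) (Z (fst p)) (snd p))"
    unfolding angular_speed_def
    by (intro continuous_intros continuous_on_W continuous_on_Z continuous_on_velocity_Z)
       (use w_z_nonzero[OF family] in \<open>auto simp: less_imp_neq[symmetric] simp del: sum_power2_eq_zero_iff\<close>)
  then have "continuous_on (I \<times> cbox 0 R) (\<lambda>(a, x). angular_speed (W a) (Z a) x)"
    by (simp add: case_prod_unfold)
  from integral_continuous_on_param[OF this] show ?thesis by (simp add: angle_def[abs_def])
qed

lemma eventually_slow_at:
  assumes "a \<in> I" "slow_at (W a) (Z a) R"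
  shows "\<forall>\<^sub>F b in at a within I. slow_at (W b) (Z b) R"
proof -
  have "R \<ge> 1" "R \<ge> 0" using assms(2) by (auto simp: slow_at_def)
  note sections = continuous_on_section[OF continuous_on_W \<open>R \<ge> 0\<close>]
    continuous_on_section[OF continuous_on_Z \<open>R \<ge> 0\<close>]
    continuous_on_section[OF continuous_on_velocity_Z \<open>R \<ge> 0\<close>]
  have "continuous_on I (\<lambda>a. E (W a) (Z a) R)" unfolding energy_def
    by (intro continuous_intros sections continuous_on_compose2[OF continuous_on_potential[of UNIV] sections(1)]) auto
  then have "\<forall>\<^sub>F b in at a within I. E (W b) (Z b) R < small_energy"
    using assms
      by (intro order_tendstoD(2)[of _ "E (W a) (Z a) R"]) (auto simp: continuous_on_def slow_at_def)
  moreover have "continuous_on I (\<lambda>a. amplified (W a) R * amplified_flux (W a) (Z a) R)"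
    unfolding amplified_def amplified_flux_def by (intro continuous_intros sections)
  then have "\<forall>\<^sub>F b in at a within I. amplified (W b) R * amplified_flux (W b) (Z b) R > 0"
    using assms by (intro order_tendstoD(1)[of _ "amplified (W a) R * amplified_flux (W a) (Z a) R"])
      (auto simp: continuous_on_def slow_at_def)
  ultimately show ?thesis by eventually_elim (use \<open>R \<ge> 1\<close> in \<open>simp add: slow_at_def\<close>)
qed

lemma eventually_nodal_count_eq:
  assumes "a \<in> I" "R \<ge> 0" "W a R \<noteq> 0"
  shows "\<forall>\<^sub>F b in at a within I. nodal_count (W b) (Z b) R = nodal_count (W a) (Z a) R"
  unfolding nodal_count_def
proof (rule eventually_floor_eq)
  show "((\<lambda>b. angle (W b) (Z b) R / pi + 1 / 2) \<longlongrightarrow> angle (W a) (Z a) R / pi + 1 / 2) (at a within I)"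
    using continuous_on_angle_initial assms(1)
      by (intro tendsto_intros) (auto simp: continuous_on_def)
  show "angle (W a) (Z a) R / pi + 1 / 2 \<notin> \<int>"
    using w_eq_0_iff[OF family[OF assms(1)] assms(2)] assms(3) by simp
qed

lemma nodal_count_initial_constant:
  assumes "connected I" "a \<in> I" "b \<in> I" and slow: "\<And>a. a \<in> I \<Longrightarrow> slow_at (W a) (Z a) (R a)"
  shows "nodal_count (W a) (Z a) (R a) = nodal_count (W b) (Z b) (R b)"
proof (rule connected_local_const[OF assms(1-3)], rule ballI)
  fix a assume "a \<in> I"
  have "R a \<ge> 0" using slow[OF \<open>a \<in> I\<close>] by (simp add: slow_at_def)
  have "W a (R a) \<noteq> 0"
    using slow_at_imp_nonzero[OF family[OF \<open>a \<in> I\<close>] slow[OF \<open>a \<in> I\<close>]] by simp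
  then have "\<forall>\<^sub>F b in at a within I. nodal_count (W b) (Z b) (R a) = nodal_count (W a) (Z a) (R a)"
    by (rule eventually_nodal_count_eq[OF \<open>a \<in> I\<close> \<open>R a \<ge> 0\<close>])
  moreover have "\<forall>\<^sub>F b in at a within I. slow_at (W b) (Z b) (R a)"
    by (rule eventually_slow_at[OF \<open>a \<in> I\<close> slow[OF \<open>a \<in> I\<close>]])
  moreover have "\<forall>\<^sub>F b in at a within I. b \<in> I" by (auto simp: eventually_at_filter)
  ultimately show "\<forall>\<^sub>F b in at a within I. nodal_count (W a) (Z a) (R a)
      = nodal_count (W b) (Z b) (R b)"
    by eventually_elim (metis family slow slow_at_nodal_count_eq)
qed

end

context coercive_radial_equation begin

lemma fast_solutions_unbounded:
  assumes oscillation: "\<And>k. \<exists>A. \<forall>w z. shooting_solution w z \<and> w 0 \<ge> A \<longrightarrow> (\<exists>r. alternates w k r)"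
    and "M > 0"
  shows "\<exists>w z. fast_solution w z \<and> w 0 \<ge> M"
proof (rule ccontr)
  assume no_fast: "\<not> ?thesis"
  obtain W Z where shoot: "\<And>a. a > 0 \<Longrightarrow> shooting_solution (W a) (Z a)" "\<And>a. a > 0 \<Longrightarrow> W a 0 = a"
    using shooting_solution_exists by metis
  have "\<exists>r. slow_at (W a) (Z a) r" if "a \<ge> M" for a
    using fast_or_slow[OF shoot(1)] shoot(2) no_fast that \<open>M > 0\<close> by (metis less_le_trans)
  then obtain R where slow: "\<And>a. a \<ge> M \<Longrightarrow> slow_at (W a) (Z a) (R a)" by metis
  define count where "count a = nodal_count (W a) (Z a) (R a)" for a
  obtain A where A: "\<And>w z. shooting_solution w z \<Longrightarrow> w 0 \<ge> A \<Longrightarrow> \<exists>r. alternates w (nat (count M + 1)) r"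
    using oscillation by blast
  define B where "B = max A M"
  have B: "B \<ge> M" "B \<ge> A" "B > 0" using \<open>M > 0\<close> by (auto simp: B_def)
  interpret shooting_family d q lam "{M..B}" W Z B
    by unfold_locales (use shoot \<open>M > 0\<close> B in auto)
  have "count M = count B"
    unfolding count_def by (rule nodal_count_initial_constant) (use slow B in auto)
  moreover have "count B > count M"
  proof -
    obtain r where r: "alternates (W B) (nat (count M + 1)) r"
      using A[OF shoot(1)[OF B(3)]] shoot(2)[OF B(3)] B(2) by auto
    have "int (nat (count M + 1)) \<le> nodal_count (W B) (Z B) (max r (R B))"
      by (rule alternates_nodal_count[OF shoot(1)[OF B(3)] r]) simp
    also have "\<dots> = count B"
      unfolding count_def by (rule slow_at_nodal_count[OF shoot(1)[OF B(3)] slow[OF B(1)]]) simp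
    finally show ?thesis by linarith
  qed
  ultimately show False by simp
qed

end

section \<open>Smooth cutoffs\<close>

definition flat_exp :: "nat \<Rightarrow> real \<Rightarrow> real" where
  "flat_exp j t = (if t > 0 then exp (- 1 / t) / t ^ j else 0)"

lemma flat_exp_nonneg: "flat_exp j t \<ge> 0"
  by (simp add: flat_exp_def)

lemma flat_exp_0_le_1: "flat_exp 0 t \<le> 1"
  by (simp add: flat_exp_def)

lemma flat_exp_tendsto_0: "(flat_exp j \<longlongrightarrow> 0) (at 0)"
proof -
  have "((\<lambda>t. inverse t ^ j / exp (inverse t)) \<longlongrightarrow> 0) (at_right (0::real))"
    by (rule filterlim_compose[OF tendsto_power_div_exp_0 filterlim_inverse_at_top_right])
  moreover have "\<forall>\<^sub>F t in at_right (0::real). inverse t ^ j / exp (inverse t) = flat_exp j t"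
    by (auto simp: eventually_at_filter flat_exp_def exp_minus field_simps)
  ultimately have "(flat_exp j \<longlongrightarrow> 0) (at_right 0)" by (rule Lim_transform_eventually)
  moreover have "(flat_exp j \<longlongrightarrow> 0) (at_left 0)"
    by (rule tendsto_eventually) (auto simp: eventually_at_filter flat_exp_def)
  ultimately show ?thesis by (simp add: filterlim_split_at)
qed

lemma flat_exp_deriv:
  "(flat_exp j has_real_derivative flat_exp (j + 2) t - real j * flat_exp (j + 1) t) (at t)"
proof -
  consider "t > 0" | "t < 0" | "t = 0" by linarith
  then show ?thesis
  proof cases
    case 1
    have "((\<lambda>t. exp (- 1 / t) / t ^ j) has_real_derivative
        (exp (- 1 / t) * (1 / t\<^sup>2) * t ^ j - exp (- 1 / t) * (real j * t ^ (j - 1))) /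
          (t ^ j * t ^ j)) (at t)"
      using 1 by (auto intro!: derivative_eq_intros simp: power2_eq_square)
    moreover have "(exp (- 1 / t) * (1 / t\<^sup>2) * t ^ j - exp (- 1 / t) * (real j * t ^ (j - 1)))
        / (t ^ j * t ^ j)
        = flat_exp (j + 2) t - real j * flat_exp (j + 1) t"
      using 1 by (cases j) (auto simp: flat_exp_def field_simps power2_eq_square)
    ultimately show ?thesis
      using 1 by (auto intro: has_field_derivative_transform_within_open[of _ _ _ "{0<..}"]
          simp: flat_exp_def)
  next
    case 2
    have "(flat_exp j has_real_derivative 0) (at t)"
      by (rule has_field_derivative_transform_within_open[OF DERIV_const, of "{..<0}"])
         (use 2 in \<open>auto simp: flat_exp_def\<close>)
    then show ?thesis using 2 by (simp add: flat_exp_def)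
  next
    case 3
    have "\<forall>\<^sub>F h in at 0. flat_exp (j + 1) h = flat_exp j h / h"
      by (auto simp: eventually_at_filter flat_exp_def)
    with flat_exp_tendsto_0 have "((\<lambda>h. flat_exp j h / h) \<longlongrightarrow> 0) (at 0)"
      by (rule Lim_transform_eventually)
    then show ?thesis using 3 by (simp add: DERIV_def flat_exp_def)
  qed
qed

lemma continuous_on_flat_exp: "continuous_on S (flat_exp j)"
  by (auto intro!: continuous_at_imp_continuous_on DERIV_isCont[OF flat_exp_deriv])

lemma flat_exp_0_tendsto_1: "(flat_exp 0 \<longlongrightarrow> 1) at_top"
proof -
  have "((\<lambda>t::real. - 1 / t) \<longlongrightarrow> 0) at_top"
    by (rule tendsto_divide_0[OF tendsto_const filterlim_at_top_imp_at_infinity[OF filterlim_ident]])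
  then have "((\<lambda>t::real. exp (- 1 / t)) \<longlongrightarrow> 1) at_top" using tendsto_exp by fastforce
  moreover have "\<forall>\<^sub>F t in at_top. exp (- 1 / t) = flat_exp 0 t"
    using eventually_gt_at_top[of 0] by eventually_elim (simp add: flat_exp_def)
  ultimately show ?thesis by (rule Lim_transform_eventually)
qed

lemma flat_exp_2_weighted_le: "t > -1 \<Longrightarrow> (t + 1) * flat_exp 2 t \<le> 2"
proof (cases "t > 0")
  case True
  define y where "y = 1 / t"
  have "y > 0" using True by (simp add: y_def)
  have "(t + 1) * flat_exp 2 t = (y + y\<^sup>2) / exp y"
    using True by (simp add: flat_exp_def y_def exp_minus field_simps power2_eq_square)
  moreover have "y + y\<^sup>2 \<le> 2 * exp y"
    using exp_lower_Taylor_quadratic[of y] \<open>y > 0\<close> by simp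
  ultimately show ?thesis by (simp add: divide_le_eq)
qed (simp add: flat_exp_def)

lemma flat_exp_2_weighted_tendsto_0: "((\<lambda>t. (t + 1) * flat_exp 2 t) \<longlongrightarrow> 0) at_top"
proof -
  have "((\<lambda>t::real. 1 / t) \<longlongrightarrow> 0) at_top"
    by (rule tendsto_divide_0[OF tendsto_const filterlim_at_top_imp_at_infinity[OF filterlim_ident]])
  then have "((\<lambda>t. (1 / t + (1 / t)\<^sup>2) * flat_exp 0 t) \<longlongrightarrow> (0 + 0\<^sup>2) * 1) at_top"
    by (intro tendsto_intros flat_exp_0_tendsto_1)
  moreover have "\<forall>\<^sub>F t in at_top. (1 / t + (1 / t)\<^sup>2) * flat_exp 0 t = (t + 1) * flat_exp 2 t"
    using eventually_gt_at_top[of 0]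
    by eventually_elim (simp add: flat_exp_def field_simps power2_eq_square)
  ultimately show ?thesis by (simp add: Lim_transform_eventually)
qed

text \<open>The coinduction for \<^const>\<open>smooth_on\<close> runs over this class of functions, which is closed
  under directional derivatives.\<close>

inductive smooth_elementary :: "('a::euclidean_space \<Rightarrow> real) \<Rightarrow> bool" where
  linear: "bounded_linear f \<Longrightarrow> smooth_elementary f"
| const: "smooth_elementary (\<lambda>x. c)"
| add: "smooth_elementary f \<Longrightarrow> smooth_elementary g \<Longrightarrow> smooth_elementary (\<lambda>x. f x + g x)"
| mult: "smooth_elementary f \<Longrightarrow> smooth_elementary g \<Longrightarrow> smooth_elementary (\<lambda>x. f x * g x)"
| flat_exp: "smooth_elementary f \<Longrightarrow> smooth_elementary (\<lambda>x. flat_exp j (f x))"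

lemma smooth_elementary_derivative:
  "smooth_elementary f \<Longrightarrow> \<exists>f'. (\<forall>x. (f has_derivative f' x) (at x))
      \<and> (\<forall>v. smooth_elementary (\<lambda>x. f' x v))"
proof (induction rule: smooth_elementary.induct)
  case (linear f)
  then show ?case
    by (intro exI[of _ "\<lambda>x. f"]) (auto intro: bounded_linear_imp_has_derivative
        smooth_elementary.const)
next
  case (const c)
  show ?case by (rule exI[of _ "\<lambda>x v. 0"]) (auto intro: smooth_elementary.const)
next
  case (add f g)
  then obtain f' g' where "\<forall>x. (f has_derivative f' x) (at x)" "\<forall>v. smooth_elementary (\<lambda>x. f' x v)"
    "\<forall>x. (g has_derivative g' x) (at x)" "\<forall>v. smooth_elementary (\<lambda>x. g' x v)" by blast
  then show ?case
    by (intro exI[of _ "\<lambda>x h. f' x h + g' x h"]) (auto intro!: derivative_intros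
        smooth_elementary.add)
next
  case (mult f g)
  then obtain f' g' where "\<forall>x. (f has_derivative f' x) (at x)" "\<forall>v. smooth_elementary (\<lambda>x. f' x v)"
    "\<forall>x. (g has_derivative g' x) (at x)" "\<forall>v. smooth_elementary (\<lambda>x. g' x v)" by blast
  then show ?case using mult.hyps
    by (intro exI[of _ "\<lambda>x h. f x * g' x h + f' x h * g x"])
       (auto intro!: derivative_intros smooth_elementary.add smooth_elementary.mult)
next
  case (flat_exp f j)
  then obtain f' where f': "\<forall>x. (f has_derivative f' x) (at x)" "\<forall>v. smooth_elementary (\<lambda>x. f' x v)"
    by blast
  let ?d = "\<lambda>x h. (flat_exp (j + 2) (f x) + (- real j) * flat_exp (j + 1) (f x)) * f' x h"
  have "((\<lambda>x. flat_exp j (f x)) has_derivative ?d x) (at x)" for x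
    using has_derivative_compose[OF f'(1)[rule_format]
        flat_exp_deriv[unfolded has_field_derivative_def]]
    by (simp add: o_def)
  moreover have "smooth_elementary (\<lambda>x. ?d x v)" for v
    by (intro smooth_elementary.intros flat_exp.hyps f'(2)[rule_format])
  ultimately show ?case by (intro exI[of _ ?d] conjI allI)
qed

lemma smooth_on_smooth_elementary:
  assumes "smooth_elementary f" "open S"
  shows "smooth_on S f"
  using assms(1)
proof (coinduction arbitrary: f rule: smooth_on.coinduct)
  case smooth_on
  obtain f' where f': "\<forall>x. (f has_derivative f' x) (at x)" "\<forall>v. smooth_elementary (\<lambda>x. f' x v)"
    using smooth_elementary_derivative[OF smooth_on] by blast
  have "frechet_derivative f (at x) = f' x" for x using f'(1) frechet_derivative_at by metis
  moreover have "f differentiable_on S"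
    using f'(1)
      by (auto simp: differentiable_on_def differentiable_def intro: has_derivative_at_withinI)
  ultimately show ?case using assms(2) f'(2) by (auto simp: differentiable_imp_continuous_on)
qed

lemma smooth_elementary_polynomial: "real_polynomial_function p \<Longrightarrow> smooth_elementary p"
  by (induction rule: real_polynomial_function.induct) (auto intro: smooth_elementary.intros)

lemma real_polynomial_function_inner_self: "real_polynomial_function (\<lambda>x::'a::euclidean_space. x \<bullet> x)"
proof -
  have "real_polynomial_function (\<lambda>x::'a. \<Sum>b\<in>Basis. (x \<bullet> b) * (x \<bullet> b))"
    by (intro real_polynomial_function_sum real_polynomial_function.intros
        bounded_linear_inner_left) simp
  moreover have "(\<lambda>x::'a. x \<bullet> x) = (\<lambda>x. \<Sum>b\<in>Basis. (x \<bullet> b) * (x \<bullet> b))"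
    by (rule ext) (rule euclidean_inner)
  ultimately show ?thesis by simp
qed

lemma smooth_elementary_radial_polynomial:
  assumes "real_polynomial_function p"
  shows "smooth_elementary (\<lambda>x::'a::euclidean_space. p (x \<bullet> x))"
proof -
  have "polynomial_function (\<lambda>x::'a. x \<bullet> x)"
    using real_polynomial_function_inner_self by (simp add: real_polynomial_function_eq)
  from real_polynomial_function_compose[OF this assms] show ?thesis
    by (intro smooth_elementary_polynomial) (simp add: o_def)
qed

definition cutoff :: "real \<Rightarrow> real \<Rightarrow> real" where
  "cutoff k s = flat_exp 0 (k - 1 - k * s)"

definition cutoff' :: "real \<Rightarrow> real \<Rightarrow> real" where
  "cutoff' k s = - k * flat_exp 2 (k - 1 - k * s)"

lemma cutoff_deriv: "(cutoff k has_real_derivative cutoff' k s) (at s)"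
proof -
  have "((\<lambda>s. k - 1 - k * s) has_real_derivative - k) (at s)" by (auto intro!: derivative_eq_intros)
  from DERIV_chain2[OF flat_exp_deriv this, of 0] show ?thesis
    by (simp add: cutoff_def[abs_def] cutoff'_def mult.commute numeral_2_eq_2)
qed

lemma continuous_on_cutoff: "continuous_on S (cutoff k)"
  by (auto intro!: continuous_at_imp_continuous_on DERIV_isCont[OF cutoff_deriv])

lemma continuous_on_cutoff': "continuous_on S (cutoff' k)"
  unfolding cutoff'_def[abs_def]
  by (intro continuous_intros continuous_on_compose2[OF continuous_on_flat_exp[of UNIV]]) auto

lemma cutoff_bounds: "0 \<le> cutoff k s" "cutoff k s \<le> 1"
  by (simp_all add: cutoff_def flat_exp_nonneg flat_exp_0_le_1)

lemma cutoff_eq_0: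
  assumes "k > 0" "1 - 1 / k \<le> s"
  shows "cutoff k s = 0" "cutoff' k s = 0"
proof -
  have "k - 1 - k * s \<le> 0" using assms by (simp add: field_simps)
  then show "cutoff k s = 0" "cutoff' k s = 0" by (simp_all add: cutoff_def cutoff'_def flat_exp_def)
qed

lemma cutoff'_weighted:
  "cutoff' k s * (1 - s) = - ((k - 1 - k * s + 1) * flat_exp 2 (k - 1 - k * s))"
  by (simp add: cutoff'_def algebra_simps)

lemma abs_cutoff'_le:
  assumes "k > 0" "s < 1"
  shows "\<bar>cutoff' k s\<bar> * (1 - s) \<le> 2"
proof -
  have "k * (1 - s) > 0" using assms by simp
  then have "k - 1 - k * s > - 1" by (simp add: algebra_simps)
  moreover have "\<bar>cutoff' k s\<bar> * (1 - s) = - (cutoff' k s * (1 - s))"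
    using assms by (simp add: cutoff'_def abs_mult flat_exp_nonneg)
  ultimately show ?thesis using flat_exp_2_weighted_le[of "k - 1 - k * s"] cutoff'_weighted[of k s]
    by linarith
qed

lemma cutoff_limits:
  assumes "s < 1" and k: "filterlim k at_top F"
  shows "((\<lambda>n. cutoff (k n) s) \<longlongrightarrow> 1) F" "((\<lambda>n. cutoff' (k n) s) \<longlongrightarrow> 0) F"
proof -
  have "filterlim (\<lambda>n. - 1 + (1 - s) * k n) at_top F"
    by (intro filterlim_tendsto_add_at_top[OF tendsto_const]
        filterlim_tendsto_pos_mult_at_top[OF tendsto_const _ k])
       (use assms(1) in simp)
  then have arg: "filterlim (\<lambda>n. k n - 1 - k n * s) at_top F" by (simp add: algebra_simps)
  show "((\<lambda>n. cutoff (k n) s) \<longlongrightarrow> 1) F"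
    unfolding cutoff_def by (rule filterlim_compose[OF flat_exp_0_tendsto_1 arg])
  have "((\<lambda>n. - ((k n - 1 - k n * s + 1) * flat_exp 2 (k n - 1 - k n * s)) / (1 - s)) \<longlongrightarrow> - 0
      / (1 - s)) F"
    by (intro tendsto_divide tendsto_minus tendsto_const
        filterlim_compose[OF flat_exp_2_weighted_tendsto_0 arg])
       (use assms(1) in simp)
  then show "((\<lambda>n. cutoff' (k n) s) \<longlongrightarrow> 0) F"
    using assms(1) unfolding cutoff'_weighted[symmetric] by simp
qed

lemma test_fun_cutoff:
  assumes "real_polynomial_function p" "k > 1"
  shows "test_fun (\<lambda>x::'a::euclidean_space. cutoff k (x \<bullet> x) * p (x \<bullet> x))" (is "test_fun ?f")
proof -
  have "real_polynomial_function (\<lambda>s. k - 1 - k * s)" by (intro real_polynomial_function_diff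
        real_polynomial_function.intros bounded_linear_mult_right)
  then have "smooth_elementary ?f" unfolding cutoff_def
    by (intro smooth_elementary.mult smooth_elementary.flat_exp
        smooth_elementary_radial_polynomial assms(1))
  then have smooth: "smooth_on hyp_ball ?f"
    by (rule smooth_on_smooth_elementary) (simp add: hyp_ball_def)
  define R where "R = sqrt (1 - 1 / k)"
  have "R < 1" using assms(2) by (simp add: R_def)
  have "{x. ?f x \<noteq> 0} \<subseteq> cball 0 R"
  proof
    fix x :: 'a assume "x \<in> {x. ?f x \<noteq> 0}"
    then have "x \<bullet> x \<le> 1 - 1 / k" using cutoff_eq_0(1)[of k "x \<bullet> x"] assms(2) by force
    then have "norm x \<le> R" unfolding R_def norm_eq_sqrt_inner by (rule real_sqrt_le_mono)
    then show "x \<in> cball 0 R" by simp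
  qed
  then have closure: "closure {x. ?f x \<noteq> 0} \<subseteq> cball 0 R" by (rule closure_minimal) simp
  then have "compact (closure {x. ?f x \<noteq> 0})"
    using bounded_subset[OF bounded_cball] by (simp add: compact_eq_bounded_closed)
  moreover have "closure {x. ?f x \<noteq> 0} \<subseteq> hyp_ball" using closure \<open>R < 1\<close> by (force simp: hyp_ball_def)
  ultimately show ?thesis using smooth by (simp add: test_fun_def)
qed

section \<open>Polynomial approximation of C1 functions\<close>

lemma real_polynomial_function_antiderivative:
  fixes g :: "real \<Rightarrow> real"
  assumes "real_polynomial_function g"
  obtains p where "real_polynomial_function p" "\<And>x. (p has_real_derivative g x) (at x)"
proof -
  obtain a n where g: "g = (\<lambda>x. \<Sum>i\<le>n. a i * x ^ i)"
    using assms by (auto simp: real_polynomial_function_iff_sum)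
  define p where "p x = (\<Sum>i\<le>n. a i / real (Suc i) * x ^ Suc i)" for x :: real
  have "real_polynomial_function p" unfolding p_def[abs_def]
    by (intro real_polynomial_function_sum real_polynomial_function_power
        real_polynomial_function.intros
        bounded_linear_ident) simp
  moreover have "(p has_real_derivative g x) (at x)" for x
  proof -
    have "((\<lambda>x. a i / real (Suc i) * x ^ Suc i) has_real_derivative a i * x ^ i) (at x)" for i
      by (rule DERIV_cong[OF DERIV_cmult[OF DERIV_pow]]) simp
    then show ?thesis unfolding p_def[abs_def] g by (intro DERIV_sum) auto
  qed
  ultimately show ?thesis by (rule that)
qed

lemma C1_polynomial_approximation:
  fixes f f' :: "real \<Rightarrow> real"
  assumes f: "continuous_on {a..b} f" and f': "continuous_on {a..b} f'"
    and deriv: "\<And>x. a < x \<Longrightarrow> x < b \<Longrightarrow> (f has_real_derivative f' x) (at x)" and "e > 0"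
  shows "\<exists>p p'. real_polynomial_function p \<and> real_polynomial_function p' \<and>
    (\<forall>x. (p has_real_derivative p' x) (at x)) \<and>
    (\<forall>x\<in>{a..b}. \<bar>p x - f x\<bar> \<le> e \<and> \<bar>p' x - f' x\<bar> \<le> e)"
proof -
  define \<delta> where "\<delta> = e / (1 + \<bar>b - a\<bar>)"
  have \<delta>: "\<delta> > 0" "\<delta> \<le> e" "\<delta> * \<bar>b - a\<bar> \<le> e"
    using \<open>e > 0\<close> by (auto simp: \<delta>_def field_simps)
  obtain g where g: "real_polynomial_function g" "\<And>x. x \<in> {a..b} \<Longrightarrow> \<bar>f' x - g x\<bar> < \<delta>"
    using Stone_Weierstrass_real_polynomial_function[OF compact_Icc f' \<delta>(1)] by blast
  obtain G where G: "real_polynomial_function G" "\<And>x. (G has_real_derivative g x) (at x)"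
    using real_polynomial_function_antiderivative[OF g(1)] by blast
  define p where "p x = G x + (f a - G a)" for x
  have p: "real_polynomial_function p"
    unfolding p_def[abs_def] by (intro real_polynomial_function.intros(2,3) G(1))
  have p_deriv: "(p has_real_derivative g x) (at x)" for x
    unfolding p_def[abs_def] using G(2) by (auto intro!: derivative_eq_intros)
  have "\<bar>p x - f x\<bar> \<le> e" if x: "x \<in> {a..b}" for x
  proof (cases "x = a")
    case False
    then have "a < x" using x by simp
    have "continuous_on {a..x} (\<lambda>y. p y - f y)"
      using x by (intro continuous_on_diff continuous_on_subset[OF f])
        (auto intro!: continuous_at_imp_continuous_on DERIV_isCont[OF p_deriv])
    moreover have "((\<lambda>y. p y - f y) has_derivative (\<lambda>h. (g y - f' y) * h)) (at y)"
      if "a < y" "y < x" for y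
      using DERIV_diff[OF p_deriv deriv[of y]] that x by (simp add: has_field_derivative_def)
    ultimately obtain y where y: "a < y" "y < x" "p x - f x - (p a - f a) = (g y - f' y) * (x - a)"
      using mvt[OF \<open>a < x\<close>, of "\<lambda>y. p y - f y" "\<lambda>y h. (g y - f' y) * h"] by blast
    have "\<bar>p x - f x\<bar> = \<bar>g y - f' y\<bar> * (x - a)" using y(3) \<open>a < x\<close> by (simp add: p_def abs_mult)
    also have "\<dots> \<le> \<delta> * \<bar>b - a\<bar>"
      using g(2)[of y] y x \<delta>(1) by (intro mult_mono) (auto simp: abs_minus_commute less_imp_le)
    finally show ?thesis using \<delta>(3) by simp
  qed (use \<open>e > 0\<close> in \<open>simp add: p_def\<close>)
  moreover have "\<bar>g x - f' x\<bar> \<le> e" if "x \<in> {a..b}" for x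
    using g(2)[OF that] \<delta>(2) by (simp add: abs_minus_commute)
  ultimately show ?thesis using p g(1) p_deriv by blast
qed

section \<open>Integration over the Poincare ball\<close>

lemma hyp_ball_sets [measurable]: "(hyp_ball :: 'a::euclidean_space set) \<in> sets lebesgue"
  by (simp add: hyp_ball_def)

lemma open_hyp_ball: "open hyp_ball"
  by (simp add: hyp_ball_def)

lemma in_hyp_ball: "x \<in> hyp_ball \<longleftrightarrow> x \<bullet> x < 1"
  by (simp add: hyp_ball_def norm_eq_sqrt_inner)

lemma space_hyp_vol: "space hyp_vol = hyp_ball"
  by (simp add: hyp_vol_def)

lemma continuous_on_inner_self_compose:
  fixes S :: "'a::real_inner set"
  assumes "continuous_on T f" "\<And>x. x \<in> S \<Longrightarrow> x \<bullet> x \<in> T"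
  shows "continuous_on S (\<lambda>x. f (x \<bullet> x))"
  by (rule continuous_on_compose2[OF assms(1)]) (auto intro!: continuous_intros assms(2))

lemma borel_measurable_hyp_vol_if_continuous:
  "continuous_on hyp_ball f \<Longrightarrow> f \<in> borel_measurable (hyp_vol :: 'a::euclidean_space measure)"
  unfolding hyp_vol_def by (simp add: continuous_imp_measurable_on_sets_lebesgue hyp_ball_sets)

lemma hyp_conf_pos: "x \<in> hyp_ball \<Longrightarrow> hyp_conf x > 0"
  by (simp add: hyp_conf_def in_hyp_ball power2_norm_eq_inner)

lemma continuous_on_hyp_conf: "continuous_on hyp_ball (hyp_conf :: 'a::euclidean_space \<Rightarrow> real)"
  unfolding hyp_conf_def[abs_def]
  by (intro continuous_intros) (auto simp: in_hyp_ball power2_norm_eq_inner)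

lemma borel_measurable_hyp_conf_power [measurable]:
  "(\<lambda>x. hyp_conf x ^ n) \<in> borel_measurable (lebesgue_on (hyp_ball :: 'a::euclidean_space set))"
  by (intro continuous_imp_measurable_on_sets_lebesgue continuous_intros
      continuous_on_hyp_conf hyp_ball_sets)

lemma nn_integral_hyp_vol:
  assumes "f \<in> borel_measurable (hyp_vol :: 'a::euclidean_space measure)"
  shows "(\<integral>\<^sup>+ x. f x \<partial>hyp_vol) = (\<integral>\<^sup>+ x. ennreal (hyp_conf x ^ DIM('a)) * f x * indicator hyp_ball x \<partial>lebesgue)"
proof -
  have "f \<in> borel_measurable (lebesgue_on hyp_ball)" using assms by (simp add: hyp_vol_def)
  then have "(\<integral>\<^sup>+ x. f x \<partial>hyp_vol) = (\<integral>\<^sup>+ x. ennreal (hyp_conf x ^ DIM('a)) * f x \<partial>lebesgue_on hyp_ball)"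
    unfolding hyp_vol_def by (intro nn_integral_density) auto
  also have "\<dots> = (\<integral>\<^sup>+ x. ennreal (hyp_conf x ^ DIM('a)) * f x * indicator hyp_ball x \<partial>lebesgue)"
    by (rule nn_integral_restrict_space) (simp add: hyp_ball_sets)
  finally show ?thesis .
qed

lemma power_diff_le:
  fixes r R :: real
  assumes "0 \<le> r" "r \<le> R" "R \<le> 1"
  shows "R ^ n - r ^ n \<le> real n * (R - r)"
proof (induction n)
  case (Suc n)
  have "R ^ Suc n - r ^ Suc n = R * (R ^ n - r ^ n) + (R - r) * r ^ n" by (simp add: algebra_simps)
  also have "\<dots> \<le> 1 * (R ^ n - r ^ n) + (R - r) * 1"
    using assms by (intro add_mono mult_mono power_le_one) (auto intro: power_mono)
  also have "\<dots> \<le> real (Suc n) * (R - r)" using Suc by (simp add: algebra_simps)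
  finally show ?case .
qed simp

lemma emeasure_shell_le:
  fixes r R :: real
  assumes "0 \<le> r" "r \<le> R" "R \<le> 1"
  shows "emeasure lebesgue (ball 0 R - ball (0::'a::euclidean_space) r)
    \<le> ennreal (measure lborel (ball (0::'a) 1) * real DIM('a) * (R - r))"
proof -
  define V where "V = measure lborel (ball (0::'a) 1)"
  have ball: "emeasure lebesgue (ball (0::'a) t) = ennreal (V * t ^ DIM('a))" if "t \<ge> 0" for t
  proof -
    have "emeasure lebesgue (ball (0::'a) t) = ennreal (measure lborel (ball (0::'a) t))"
      using emeasure_lborel_ball_finite[of "0::'a" t]
        by (subst emeasure_eq_ennreal_measure[symmetric]) auto
    then show ?thesis using content_ball_conv_unit_ball[of t "0::'a"] that
      by (simp add: V_def mult.commute)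
  qed
  have "emeasure lebesgue (ball (0::'a) R - ball 0 r)
      = emeasure lebesgue (ball (0::'a) R) - emeasure lebesgue (ball (0::'a) r)"
    by (rule emeasure_Diff) (use assms ball[of r] in auto)
  also have "\<dots> = ennreal (V * R ^ DIM('a) - V * r ^ DIM('a))"
    using assms by (simp only: ball order_trans[OF assms(1,2)]) (rule ennreal_minus, simp add: V_def)
  also have "V * R ^ DIM('a) - V * r ^ DIM('a) = V * (R ^ DIM('a) - r ^ DIM('a))"
    by (simp add: algebra_simps)
  also have "ennreal \<dots> \<le> ennreal (V * (real DIM('a) * (R - r)))"
    by (intro ennreal_leI mult_left_mono power_diff_le assms) (simp add: V_def)
  finally show ?thesis by (simp add: V_def mult.assoc)
qed

lemma dyadic_interval:
  fixes u :: real
  assumes "0 < u" "u \<le> 1"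
  obtains j :: nat where "(1 / 2) ^ Suc j < u" "u \<le> (1 / 2) ^ j"
proof -
  define below where "below j \<longleftrightarrow> (1 / 2) ^ j < u" for j :: nat
  obtain n where "below n" using real_arch_pow_inv[of u "1 / 2"] assms by (auto simp: below_def)
  moreover have "\<not> below 0" using assms by (simp add: below_def)
  ultimately obtain j where "\<not> below j" "below (Suc j)"
    by (metis nat.exhaust less_Suc_eq_le not_less_Least LeastI not_less)
  then show ?thesis using that[of j] by (simp add: below_def)
qed

lemma powr_le_dyadic:
  fixes u \<beta> :: real
  assumes "(1 / 2) ^ Suc j < u" "u \<le> (1 / 2) ^ j"
  shows "u powr \<beta> \<le> 2 powr \<bar>\<beta>\<bar> * ((1 / 2) ^ j) powr \<beta>"
proof (cases "\<beta> \<ge> 0")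
  case True
  have "u > 0" using assms(1) by (rule le_less_trans[rotated]) simp
  then have "1 * u powr \<beta> \<le> 2 powr \<bar>\<beta>\<bar> * ((1 / 2) ^ j) powr \<beta>"
    using assms(2) True by (intro mult_mono powr_mono2) (auto simp: ge_one_powr_ge_zero)
  then show ?thesis by simp
next
  case False
  have "u powr \<beta> \<le> ((1 / 2) ^ Suc j) powr \<beta>" using assms(1) False by (intro powr_mono2') auto
  also have "\<dots> = (1 / 2) powr \<beta> * ((1 / 2) ^ j) powr \<beta>" unfolding power_Suc by (rule powr_mult)
  also have "(1 / 2) powr \<beta> = 2 powr \<bar>\<beta>\<bar>" using False by (simp add: powr_divide powr_minus_divide)
  finally show ?thesis .
qed

lemma suminf_geometric_ennreal_finite:
  fixes x :: real
  assumes "0 \<le> C" "0 \<le> x" "x < 1"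
  shows "(\<Sum>j. ennreal (C * x ^ j)) < \<infinity>"
proof -
  have "summable (\<lambda>j. C * x ^ j)" using assms by (intro summable_mult summable_geometric) auto
  then show ?thesis using assms by (subst suminf_ennreal2) (auto simp: less_top[symmetric])
qed

definition dyadic_shell :: "nat \<Rightarrow> 'a::euclidean_space set" where
  "dyadic_shell j = ball 0 (1 - (1/2) ^ Suc j) - ball 0 (1 - (1/2) ^ j)"

lemma sets_dyadic_shell: "dyadic_shell j \<in> sets lebesgue"
  by (simp add: dyadic_shell_def del: power_Suc)

lemma dyadic_weight_emeasure_shell_le:
  fixes \<beta> :: real
  defines "V \<equiv> measure lborel (ball (0::'a::euclidean_space) 1) * real DIM('a)"
  shows "ennreal (2 powr \<bar>\<beta>\<bar> * ((1/2) ^ j) powr \<beta>) * emeasure lebesgue (dyadic_shell j :: 'a set)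
    \<le> ennreal (2 powr \<bar>\<beta>\<bar> * V * ((1/2) powr (\<beta> + 1)) ^ j)"
proof -
  have "V \<ge> 0" by (simp add: V_def)
  have "emeasure lebesgue (dyadic_shell j :: 'a set)
      \<le> ennreal (V * ((1 - (1/2) ^ Suc j) - (1 - (1/2) ^ j)))"
    unfolding dyadic_shell_def V_def by (rule emeasure_shell_le) (auto simp: power_le_one)
  also have "\<dots> \<le> ennreal (V * (1/2) ^ j)" using \<open>V \<ge> 0\<close> by (intro ennreal_leI mult_left_mono) auto
  finally have "ennreal (2 powr \<bar>\<beta>\<bar> * ((1/2) ^ j) powr \<beta>) * emeasure lebesgue (dyadic_shell j :: 'a set)
      \<le> ennreal (2 powr \<bar>\<beta>\<bar> * ((1/2) ^ j) powr \<beta>) * ennreal (V * (1/2) ^ j)"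
    by (rule mult_left_mono) simp
  also have "\<dots> = ennreal (2 powr \<bar>\<beta>\<bar> * ((1/2) ^ j) powr \<beta> * (V * (1/2) ^ j))"
    using \<open>V \<ge> 0\<close> by (simp add: ennreal_mult')
  also have "((1/2::real) ^ j) powr \<beta> = ((1/2) powr \<beta>) ^ j"
    by (simp add: powr_realpow[symmetric] powr_powr mult.commute)
  then have "2 powr \<bar>\<beta>\<bar> * ((1/2) ^ j) powr \<beta> * (V * (1/2) ^ j)
      = 2 powr \<bar>\<beta>\<bar> * V * ((1/2) powr (\<beta> + 1)) ^ j"
    by (simp add: powr_add power_mult_distrib power_divide mult_ac)
  finally show ?thesis .
qed

lemma nn_integral_boundary_powr_finite:
  fixes \<beta> :: real
  assumes "\<beta> > -1"
  shows "(\<integral>\<^sup>+ x. ennreal ((1 - norm x) powr \<beta>) * indicator (ball (0::'a::euclidean_space) 1) x \<partial>lebesgue) < \<infinity>"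
proof -
  define c where "c j = 2 powr \<bar>\<beta>\<bar> * ((1/2) ^ j) powr \<beta>" for j :: nat
  define V where "V = measure lborel (ball (0::'a) 1) * real DIM('a)"
  have "V \<ge> 0" by (simp add: V_def)
  have "ennreal ((1 - norm x) powr \<beta>) * indicator (ball 0 1) x
      \<le> (\<Sum>j. ennreal (c j) * indicator (dyadic_shell j) x)" for x :: 'a
  proof (cases "x \<in> ball 0 1")
    case True
    then obtain j where j: "(1/2) ^ Suc j < 1 - norm x" "1 - norm x \<le> (1/2) ^ j"
      using dyadic_interval[of "1 - norm x"] by auto
    then have "x \<in> dyadic_shell j" by (simp add: dyadic_shell_def)
    then have "ennreal ((1 - norm x) powr \<beta>) * indicator (ball 0 1) x
        \<le> ennreal (c j) * indicator (dyadic_shell j) x"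
      using powr_le_dyadic[OF j] True by (simp add: c_def ennreal_leI)
    also have "\<dots> \<le> (\<Sum>j. ennreal (c j) * indicator (dyadic_shell j) x)"
      by (rule leI) (auto dest: ennreal_suminf_lessD)
    finally show ?thesis .
  qed simp
  then have "(\<integral>\<^sup>+ x. ennreal ((1 - norm x) powr \<beta>) * indicator (ball (0::'a) 1) x \<partial>lebesgue)
      \<le> (\<integral>\<^sup>+ x. (\<Sum>j. ennreal (c j) * indicator (dyadic_shell j) (x::'a))
          \<partial>lebesgue)" by (rule nn_integral_mono)
  also have "\<dots> = (\<Sum>j. ennreal (c j) * emeasure lebesgue (dyadic_shell j :: 'a set))"
    using sets_dyadic_shell[where 'a = 'a]
      by (simp add: nn_integral_suminf nn_integral_cmult_indicator)
  also have "\<dots> \<le> (\<Sum>j. ennreal (2 powr \<bar>\<beta>\<bar> * V * ((1/2) powr (\<beta> + 1)) ^ j))"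
    unfolding c_def V_def by (intro suminf_le dyadic_weight_emeasure_shell_le) auto
  also have "\<dots> < \<infinity>"
    by (rule suminf_geometric_ennreal_finite)
       (use \<open>V \<ge> 0\<close> assms powr_less_mono'[of "1/2" 0 "\<beta> + 1"] in auto)
  finally show ?thesis .
qed

lemma one_minus_norm_sq_powr_le:
  fixes x :: "'a::real_inner"
  assumes "norm x < 1"
  shows "(1 - x \<bullet> x) powr \<beta> \<le> 2 powr \<bar>\<beta>\<bar> * (1 - norm x) powr \<beta>"
proof -
  have "1 - x \<bullet> x = (1 + norm x) * (1 - norm x)"
    by (simp add: power2_norm_eq_inner[symmetric] power2_eq_square algebra_simps)
  then have "(1 - x \<bullet> x) powr \<beta> = (1 + norm x) powr \<beta> * (1 - norm x) powr \<beta>"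
    by (simp only: powr_mult)
  also have "(1 + norm x) powr \<beta> \<le> (1 + norm x) powr \<bar>\<beta>\<bar>" by (rule powr_mono) auto
  also have "\<dots> \<le> 2 powr \<bar>\<beta>\<bar>" using assms by (intro powr_mono2) auto
  finally show ?thesis by (simp add: mult_right_mono)
qed

lemma nn_integral_hyp_vol_powr_finite:
  assumes "c > (real DIM('a) - 1) / 2" and "M \<ge> 0"
  shows "(\<integral>\<^sup>+ x. ennreal (M * (1 - (x::'a::euclidean_space) \<bullet> x) powr (2 * c)) \<partial>hyp_vol) < \<infinity>"
proof -
  define N where "N = DIM('a)"
  define \<beta> where "\<beta> = 2 * c - real N"
  define K where "K = 2 ^ N * M * 2 powr \<bar>\<beta>\<bar>"
  have "(\<lambda>x::'a. ennreal (M * (1 - x \<bullet> x) powr (2 * c))) \<in> borel_measurable hyp_vol"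
    by (intro measurable_compose[OF _ measurable_ennreal] borel_measurable_hyp_vol_if_continuous
        continuous_intros)
       (auto simp: in_hyp_ball)
  then have "(\<integral>\<^sup>+ x. ennreal (M * (1 - (x::'a) \<bullet> x) powr (2 * c)) \<partial>hyp_vol)
      = (\<integral>\<^sup>+ x. ennreal (hyp_conf x ^ N) * ennreal (M * (1 - (x::'a) \<bullet> x) powr (2 * c)) * indicator
          hyp_ball x \<partial>lebesgue)"
    unfolding N_def by (rule nn_integral_hyp_vol)
  also have "\<dots> \<le> (\<integral>\<^sup>+ x. ennreal K * (ennreal ((1 - norm x) powr \<beta>) * indicator (ball (0::'a) 1) x) \<partial>lebesgue)"
  proof (rule nn_integral_mono)
    fix x :: 'a
    show "ennreal (hyp_conf x ^ N) * ennreal (M * (1 - x \<bullet> x) powr (2 * c)) * indicator hyp_ball x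
        \<le> ennreal K * (ennreal ((1 - norm x) powr \<beta>) * indicator (ball 0 1) x)"
    proof (cases "x \<in> hyp_ball")
      case True
      then have "norm x < 1" "1 - x \<bullet> x > 0" by (auto simp: hyp_ball_def in_hyp_ball[symmetric])
      have "hyp_conf x ^ N * (M * (1 - x \<bullet> x) powr (2 * c)) = 2 ^ N * M * (1 - x \<bullet> x) powr \<beta>"
        using \<open>1 - x \<bullet> x > 0\<close>
        by (simp add: hyp_conf_def power2_norm_eq_inner power_divide \<beta>_def powr_diff powr_realpow)
      also have "\<dots> \<le> 2 ^ N * M * (2 powr \<bar>\<beta>\<bar> * (1 - norm x) powr \<beta>)"
        using one_minus_norm_sq_powr_le[OF \<open>norm x < 1\<close>] \<open>M \<ge> 0\<close> by (intro mult_left_mono) auto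
      finally have "ennreal (hyp_conf x ^ N * (M * (1 - x \<bullet> x) powr (2 * c)))
          \<le> ennreal (K * (1 - norm x) powr \<beta>)"
        by (intro ennreal_leI) (simp add: K_def mult.assoc)
      then show ?thesis using True hyp_conf_pos[OF True] \<open>M \<ge> 0\<close>
        by (simp add: K_def hyp_ball_def ennreal_mult' ennreal_mult'')
    qed simp
  qed
  also have "\<dots> = ennreal K * (\<integral>\<^sup>+ x. ennreal ((1 - norm x) powr \<beta>) * indicator (ball (0::'a) 1) x \<partial>lebesgue)"
    by (intro nn_integral_cmult borel_measurable_times_ennreal borel_measurable_indicator
        measurable_completion) simp_all
  also have "\<dots> < \<infinity>"
    using nn_integral_boundary_powr_finite[where 'a = 'a, of \<beta>] assms(1)
    by (simp add: \<beta>_def N_def ennreal_mult_less_top)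
  finally show ?thesis .
qed

section \<open>Radial functions in the energy space\<close>

lemma egrad_radial:
  assumes "(F has_real_derivative D) (at (x \<bullet> x))"
  shows "egrad (\<lambda>x. F (x \<bullet> x)) x = (2 * D) *\<^sub>R x"
proof -
  have "((\<lambda>x. x \<bullet> x) has_derivative (\<lambda>h. 2 * (x \<bullet> h))) (at x)"
    by (auto intro!: derivative_eq_intros simp: inner_commute)
  from has_derivative_compose[OF this assms[unfolded has_field_derivative_def]]
  have "((\<lambda>x. F (x \<bullet> x)) has_derivative (\<lambda>h. D * (2 * (x \<bullet> h)))) (at x)" by simp
  then have "frechet_derivative (\<lambda>x. F (x \<bullet> x)) (at x) = (\<lambda>h. D * (2 * (x \<bullet> h)))"
    by (rule frechet_derivative_at[symmetric])
  then have "egrad (\<lambda>x. F (x \<bullet> x)) x = (\<Sum>b\<in>Basis. (2 * D) *\<^sub>R ((x \<bullet> b) *\<^sub>R b))"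
    by (simp add: egrad_def mult_ac)
  also have "\<dots> = (2 * D) *\<^sub>R (\<Sum>b\<in>Basis. (x \<bullet> b) *\<^sub>R b)" by (rule scaleR_sum_right[symmetric])
  also have "\<dots> = (2 * D) *\<^sub>R x" by (simp only: euclidean_representation)
  finally show ?thesis .
qed

lemma radial_gradient_sq:
  fixes x :: "'a::real_inner"
  shows "((1 - (norm x)\<^sup>2) / 2)\<^sup>2 * (norm ((2 * a) *\<^sub>R x - (2 * b) *\<^sub>R x))\<^sup>2
      = ((a - b) * (1 - x \<bullet> x))\<^sup>2 * (x \<bullet> x)"
proof -
  have "norm ((2 * a) *\<^sub>R x - (2 * b) *\<^sub>R x) = \<bar>2 * (a - b)\<bar> * norm x"
    unfolding scaleR_diff_left[symmetric] right_diff_distrib[symmetric] by (rule norm_scaleR)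
  then have "(norm ((2 * a) *\<^sub>R x - (2 * b) *\<^sub>R x))\<^sup>2 = (2 * (a - b))\<^sup>2 * (x \<bullet> x)"
    by (simp only: power_mult_distrib power2_abs power2_norm_eq_inner)
  then show ?thesis by (simp only: power2_norm_eq_inner) (simp add: power2_eq_square field_simps)
qed

lemma nn_integral_hyp_vol_tendsto_0:
  fixes I :: "nat \<Rightarrow> 'a::euclidean_space \<Rightarrow> real"
  assumes c: "c > (real DIM('a) - 1) / 2" and "M \<ge> 0"
    and continuous: "\<And>k. continuous_on hyp_ball (I k)"
    and bound: "\<And>k x. x \<in> hyp_ball \<Longrightarrow> I k x \<le> M * (1 - x \<bullet> x) powr (2 * c)"
    and lim: "\<And>x. x \<in> hyp_ball \<Longrightarrow> (\<lambda>k. I k x) \<longlonglongrightarrow> 0"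
  shows "(\<lambda>k. \<integral>\<^sup>+ x. ennreal (I k x) \<partial>hyp_vol) \<longlonglongrightarrow> 0"
proof -
  have "(\<lambda>k. \<integral>\<^sup>+ x. ennreal (I k x) \<partial>hyp_vol) \<longlonglongrightarrow> (\<integral>\<^sup>+ x. 0 \<partial>(hyp_vol :: 'a measure))"
  proof (rule nn_integral_dominated_convergence[where w = "\<lambda>x. ennreal (M * (1 - x \<bullet> x) powr (2 * c))"])
    show "(\<lambda>x. ennreal (I k x)) \<in> borel_measurable hyp_vol" for k
      by (intro measurable_compose[OF _ measurable_ennreal]
          borel_measurable_hyp_vol_if_continuous continuous)
    show "(\<lambda>x::'a. ennreal (M * (1 - x \<bullet> x) powr (2 * c))) \<in> borel_measurable hyp_vol"
      by (intro measurable_compose[OF _ measurable_ennreal] borel_measurable_hyp_vol_if_continuous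
          continuous_intros)
         (auto simp: in_hyp_ball)
    show "AE x in hyp_vol. ennreal (I k x) \<le> ennreal (M * (1 - x \<bullet> x) powr (2 * c))" for k
      by (rule AE_I2) (use bound in \<open>auto simp: space_hyp_vol intro: ennreal_leI\<close>)
    show "AE x in hyp_vol. (\<lambda>k. ennreal (I k x)) \<longlonglongrightarrow> 0"
      by (rule AE_I2) (use tendsto_ennrealI[OF lim] in \<open>auto simp: space_hyp_vol\<close>)
  qed (use nn_integral_hyp_vol_powr_finite[OF c \<open>M \<ge> 0\<close>] in auto)
  then show ?thesis by simp
qed

lemma radial_energy_error_le:
  fixes a a' s :: real
  assumes s: "s \<in> {0..<1}" and "\<bar>a\<bar> \<le> B" "\<bar>a'\<bar> * (1 - s) \<le> B"
  shows "(a' * (1 - s))\<^sup>2 * s + a\<^sup>2 \<le> 2 * B\<^sup>2"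
proof -
  have "(a' * (1 - s))\<^sup>2 = (\<bar>a'\<bar> * (1 - s))\<^sup>2" by (simp add: power_mult_distrib)
  also have "\<dots> \<le> B\<^sup>2" using assms by (intro power_mono) auto
  finally have "(a' * (1 - s))\<^sup>2 * s \<le> B\<^sup>2 * 1" using s by (intro mult_mono) auto
  moreover have "a\<^sup>2 \<le> B\<^sup>2" using power_mono[OF assms(2), of 2] by simp
  ultimately show ?thesis by simp
qed

lemma H1_with_grad_radial_limit:
  fixes u u' :: "real \<Rightarrow> real" and F F' :: "nat \<Rightarrow> real \<Rightarrow> real"
  assumes c: "c > (real DIM('a::euclidean_space) - 1) / 2"
    and u: "continuous_on {0..<1} u" "continuous_on {0..<1} u'"
    and test: "\<And>k. test_fun (\<lambda>x::'a. F k (x \<bullet> x))"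
    and F_deriv: "\<And>k s. (F k has_real_derivative F' k s) (at s)" and F':
      "\<And>k. continuous_on UNIV (F' k)"
    and lim: "\<And>s. s \<in> {0..<1} \<Longrightarrow> (\<lambda>k. F k s) \<longlonglongrightarrow> u s" "\<And>s. s \<in> {0..<1} \<Longrightarrow> (\<lambda>k. F' k s) \<longlonglongrightarrow> u' s"
    and bound: "\<And>k s. s \<in> {0..<1} \<Longrightarrow> \<bar>F k s - u s\<bar> \<le> C * (1 - s) powr c"
      "\<And>k s. s \<in> {0..<1} \<Longrightarrow> \<bar>F' k s - u' s\<bar> * (1 - s) \<le> C * (1 - s) powr c"
  shows "H1_with_grad (\<lambda>x::'a. u (x \<bullet> x)) (\<lambda>x. (2 * u' (x \<bullet> x)) *\<^sub>R x)"
proof -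
  define I where "I k x = ((F' k (x \<bullet> x) - u' (x \<bullet> x)) * (1 - x \<bullet> x))\<^sup>2 * (x \<bullet> x)
      + (F k (x \<bullet> x) - u (x \<bullet> x))\<^sup>2"
    for k and x :: 'a
  have sq: "x \<bullet> x \<in> {0..<1}" if "x \<in> hyp_ball" for x :: 'a using that by (simp add: in_hyp_ball)
  have I_le: "I k x \<le> 2 * C\<^sup>2 * (1 - x \<bullet> x) powr (2 * c)" if x: "x \<in> hyp_ball" for k x
  proof -
    have "I k x \<le> 2 * (C * (1 - x \<bullet> x) powr c)\<^sup>2"
      unfolding I_def by (rule radial_energy_error_le[OF sq[OF x] bound[OF sq[OF x]]])
    also have "((1 - x \<bullet> x) powr c)\<^sup>2 = (1 - x \<bullet> x) powr (2 * c)"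
      by (simp add: power2_eq_square powr_add[symmetric])
    then have "2 * (C * (1 - x \<bullet> x) powr c)\<^sup>2 = 2 * C\<^sup>2 * (1 - x \<bullet> x) powr (2 * c)"
      by (simp add: power_mult_distrib)
    finally show ?thesis .
  qed
  have F: "continuous_on UNIV (F k)" for k
    by (auto intro!: continuous_at_imp_continuous_on DERIV_isCont[OF F_deriv])
  have "(\<lambda>k. \<integral>\<^sup>+ x. ennreal (I k x) \<partial>hyp_vol) \<longlonglongrightarrow> 0"
  proof (rule nn_integral_hyp_vol_tendsto_0[OF c _ _ I_le])
    show "continuous_on hyp_ball (I k)" for k unfolding I_def[abs_def]
      by (intro continuous_intros continuous_on_inner_self_compose[OF u(1) sq]
          continuous_on_inner_self_compose[OF u(2) sq]
          continuous_on_inner_self_compose[OF F'] continuous_on_inner_self_compose[OF F]) auto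
    have "(\<lambda>k. I k x) \<longlonglongrightarrow> ((u' (x \<bullet> x) - u' (x \<bullet> x)) * (1 - x \<bullet> x))\<^sup>2 * (x \<bullet> x)
        + (u (x \<bullet> x) - u (x \<bullet> x))\<^sup>2"
      if "x \<in> hyp_ball" for x unfolding I_def by (intro tendsto_intros lim sq that)
    then show "(\<lambda>k. I k x) \<longlonglongrightarrow> 0" if "x \<in> hyp_ball" for x using that by simp
  qed auto
  moreover have "((1 - (norm x)\<^sup>2) / 2)\<^sup>2 * (norm (egrad (\<lambda>x. F k (x \<bullet> x)) x - (2 * u' (x \<bullet> x)) *\<^sub>R x))\<^sup>2
      + (F k (x \<bullet> x) - u (x \<bullet> x))\<^sup>2 = I k x" for k x
    unfolding egrad_radial[OF F_deriv] radial_gradient_sq I_def ..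
  ultimately show ?thesis unfolding H1_with_grad_def
    by (intro conjI exI[of _ "\<lambda>k x. F k (x \<bullet> x)"] borel_measurable_hyp_vol_if_continuous
        continuous_intros
        continuous_on_inner_self_compose[OF u(1) sq] continuous_on_inner_self_compose[OF u(2) sq])
      (auto simp: test)
qed

lemma abs_convex_error_le:
  fixes z p u :: real
  assumes "0 \<le> z" "z \<le> 1"
  shows "\<bar>z * p - u\<bar> \<le> z * \<bar>p - u\<bar> + (1 - z) * \<bar>u\<bar>"
proof -
  have "\<bar>z * p - u\<bar> = \<bar>z * (p - u) - (1 - z) * u\<bar>" by (simp add: algebra_simps)
  also have "\<dots> \<le> z * \<bar>p - u\<bar> + (1 - z) * \<bar>u\<bar>"
    using assms by (intro order_trans[OF abs_triangle_ineq4]) (simp add: abs_mult)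
  finally show ?thesis .
qed

lemma cutoff_product_error:
  fixes p p' u u' :: real
  assumes s: "s \<in> {0..<1}" and "k > 1" and C: "C \<ge> 0" and P: "P \<ge> 0"
    and near: "s \<le> 1 - 1 / k \<Longrightarrow> \<bar>p - u\<bar> \<le> P \<and> \<bar>p' - u'\<bar> \<le> P"
    and decay: "\<bar>u\<bar> \<le> C * P" "\<bar>u'\<bar> * (1 - s) \<le> C * P"
  shows "\<bar>cutoff k s * p - u\<bar> \<le> 3 * (1 + C) * P"
    "\<bar>cutoff' k s * p + cutoff k s * p' - u'\<bar> * (1 - s) \<le> 3 * (1 + C) * P"
proof -
  define z z' where "z = cutoff k s" and "z' = \<bar>cutoff' k s\<bar> * (1 - s)"
  have z: "0 \<le> z" "z \<le> 1" by (auto simp: z_def cutoff_bounds)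
  have z': "0 \<le> z'" "z' \<le> 2" using abs_cutoff'_le[of k s] s \<open>k > 1\<close> by (auto simp: z'_def)
  have "z * \<bar>p - u\<bar> \<le> P \<and> z * (\<bar>p' - u'\<bar> * (1 - s)) \<le> P \<and> z' * \<bar>p - u\<bar> \<le> 2 * P"
  proof (cases "s \<le> 1 - 1 / k")
    case True
    have "\<bar>p' - u'\<bar> * (1 - s) \<le> P * 1" using near[OF True] s by (intro mult_mono) auto
    then have "z * (\<bar>p' - u'\<bar> * (1 - s)) \<le> 1 * P" using z s P by (intro mult_mono[of z]) auto
    moreover have "z * \<bar>p - u\<bar> \<le> 1 * P" using near[OF True] z P by (intro mult_mono[of z]) auto
    moreover have "z' * \<bar>p - u\<bar> \<le> 2 * P" using near[OF True] z' P by (intro mult_mono[of z']) auto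
    ultimately show ?thesis by simp
  next
    case False
    then show ?thesis using cutoff_eq_0[of k s] \<open>k > 1\<close> P by (simp add: z_def z'_def)
  qed
  moreover have "(1 - z) * \<bar>u\<bar> \<le> 1 * (C * P)" using decay(1) z C P
    by (intro mult_mono[of "1 - z"]) auto
  moreover have "(1 - z) * (\<bar>u'\<bar> * (1 - s)) \<le> 1 * (C * P)" using decay(2) z C P s
    by (intro mult_mono[of "1 - z"]) auto
  moreover have "z' * \<bar>u\<bar> \<le> 2 * (C * P)" using decay(1) z' C P by (intro mult_mono[of z']) auto
  ultimately have sums: "z * \<bar>p - u\<bar> + (1 - z) * \<bar>u\<bar> \<le> 3 * (1 + C) * P"
    "z' * \<bar>p - u\<bar> + z' * \<bar>u\<bar> + z * (\<bar>p' - u'\<bar> * (1 - s)) + (1 - z) * (\<bar>u'\<bar> * (1 - s))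
        \<le> 3 * (1 + C) * P"
    using P mult_nonneg_nonneg[OF C P] by (simp_all add: algebra_simps)
  show "\<bar>cutoff k s * p - u\<bar> \<le> 3 * (1 + C) * P"
    using abs_convex_error_le[OF z, of p u] sums(1) by (simp add: z_def)
  have "\<bar>cutoff' k s * p\<bar> \<le> \<bar>cutoff' k s\<bar> * \<bar>p - u\<bar> + \<bar>cutoff' k s\<bar> * \<bar>u\<bar>"
    unfolding abs_mult distrib_left[symmetric] by (intro mult_left_mono) auto
  then have "\<bar>cutoff' k s * p + z * p' - u'\<bar>
      \<le> \<bar>cutoff' k s\<bar> * \<bar>p - u\<bar> + \<bar>cutoff' k s\<bar> * \<bar>u\<bar> + z * \<bar>p' - u'\<bar> + (1 - z) * \<bar>u'\<bar>"
    using abs_convex_error_le[OF z, of p' u'] by linarith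
  then have "\<bar>cutoff' k s * p + z * p' - u'\<bar> * (1 - s)
      \<le> (\<bar>cutoff' k s\<bar> * \<bar>p - u\<bar> + \<bar>cutoff' k s\<bar> * \<bar>u\<bar> + z * \<bar>p' - u'\<bar> + (1 - z) * \<bar>u'\<bar>) * (1 - s)"
    using s by (intro mult_right_mono) auto
  also have "\<dots> = z' * \<bar>p - u\<bar> + z' * \<bar>u\<bar> + z * (\<bar>p' - u'\<bar> * (1 - s)) + (1 - z) * (\<bar>u'\<bar> * (1 - s))"
    unfolding z'_def by algebra
  finally show "\<bar>cutoff' k s * p + cutoff k s * p' - u'\<bar> * (1 - s) \<le> 3 * (1 + C) * P"
    using sums(2) by (simp add: z_def)
qed

lemma C1_polynomial_exhaustion:
  fixes u u' :: "real \<Rightarrow> real"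
  assumes u: "continuous_on {0..<1} u" "continuous_on {0..<1} u'"
    and deriv: "\<And>s. s \<in> {0<..<1} \<Longrightarrow> (u has_real_derivative u' s) (at s)" and "c \<ge> 0"
  obtains p p' :: "nat \<Rightarrow> real \<Rightarrow> real" where
    "\<And>k. real_polynomial_function (p k)" "\<And>k. real_polynomial_function (p' k)"
    "\<And>k s. (p k has_real_derivative p' k s) (at s)"
    "\<And>k s. 0 \<le> s \<Longrightarrow> s \<le> 1 - 1 / real (k + 2) \<Longrightarrow>
      \<bar>p k s - u s\<bar> \<le> (1 - s) powr c / real (k + 2) \<and> \<bar>p' k s - u' s\<bar> \<le> (1 - s) powr c / real (k + 2)"
proof -
  define K where "K k = real (k + 2)" for k
  define e where "e k = (1 / K k) powr c / K k" for k
  have K: "K k > 1" for k by (simp add: K_def)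
  have "\<exists>p p'. real_polynomial_function p \<and> real_polynomial_function p' \<and>
      (\<forall>s. (p has_real_derivative p' s) (at s)) \<and> (\<forall>s\<in>{0..1 - 1 / K k}. \<bar>p s - u s\<bar> \<le> e k \<and> \<bar>p' s - u'
          s\<bar> \<le> e k)" for k
  proof (rule C1_polynomial_approximation)
    have less_1: "s < 1" if "s \<le> 1 - 1 / K k" for s using K[of k]
      by (intro le_less_trans[OF that]) simp
    then have "{0..1 - 1 / K k} \<subseteq> {0..<1}" by force
    then show "continuous_on {0..1 - 1 / K k} u" "continuous_on {0..1 - 1 / K k} u'"
      using u by (auto intro: continuous_on_subset)
    show "(u has_real_derivative u' s) (at s)" if "0 < s" "s < 1 - 1 / K k" for s
      using that less_1[of s] by (intro deriv) simp
    show "e k > 0" using K[of k] by (simp add: e_def)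
  qed
  then obtain p p' where p: "\<And>k. real_polynomial_function (p k)" "\<And>k. real_polynomial_function (p' k)"
    "\<And>k s. (p k has_real_derivative p' k s) (at s)"
    and approx: "\<And>k s. s \<in> {0..1 - 1 / K k} \<Longrightarrow> \<bar>p k s - u s\<bar> \<le> e k \<and> \<bar>p' k s - u' s\<bar> \<le> e k"
    by metis
  have e_le: "e k \<le> (1 - s) powr c / K k" if "s \<le> 1 - 1 / K k" for k s
    unfolding e_def using that K[of k] \<open>c \<ge> 0\<close> by (intro divide_right_mono powr_mono2) auto
  show ?thesis
  proof (rule that[OF p])
    fix k and s :: real assume s: "0 \<le> s" "s \<le> 1 - 1 / real (k + 2)"
    show "\<bar>p k s - u s\<bar> \<le> (1 - s) powr c / real (k + 2) \<and> \<bar>p' k s - u' s\<bar>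
        \<le> (1 - s) powr c / real (k + 2)"
      using approx[of s k] e_le[of s k] s unfolding K_def by (auto intro: order_trans)
  qed
qed

lemma filterlim_real_add: "filterlim (\<lambda>k. real (k + n)) at_top sequentially"
  by (rule filterlim_compose[OF filterlim_real_sequentially filterlim_add_const_nat_at_top])

lemma LIMSEQ_if_exhausted:
  fixes f :: "nat \<Rightarrow> real"
  assumes "s < 1" and near: "\<And>k. s \<le> 1 - 1 / real (k + 2) \<Longrightarrow> \<bar>f k - l\<bar> \<le> B / real (k + 2)"
  shows "f \<longlonglongrightarrow> l"
proof -
  have inverse_0: "(\<lambda>k. a / real (k + 2)) \<longlonglongrightarrow> 0" for a
    by (rule tendsto_divide_0[OF tendsto_const filterlim_at_top_imp_at_infinity[OF filterlim_real_add]])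
  have "\<forall>\<^sub>F k in sequentially. 1 / real (k + 2) < 1 - s"
    using inverse_0 by (rule order_tendstoD) (use assms(1) in simp)
  then have "\<forall>\<^sub>F k in sequentially. norm (f k - l) \<le> B / real (k + 2)"
    by eventually_elim (use near in simp)
  then have "(\<lambda>k. f k - l) \<longlonglongrightarrow> 0" using inverse_0 by (rule Lim_null_comparison)
  then show ?thesis by (simp add: LIM_zero_iff)
qed

lemma cutoff_product_limits:
  assumes "s < 1" "filterlim K at_top sequentially" "p \<longlonglongrightarrow> u" "p' \<longlonglongrightarrow> u'"
  shows "(\<lambda>k. cutoff (K k) s * p k) \<longlonglongrightarrow> u" "(\<lambda>k. cutoff' (K k) s * p k + cutoff (K k) s * p' k) \<longlonglongrightarrow> u'"
  using tendsto_mult[OF cutoff_limits(1)[OF assms(1,2)] assms(3)]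
    tendsto_add[OF tendsto_mult[OF cutoff_limits(2)[OF assms(1,2)] assms(3)]
      tendsto_mult[OF cutoff_limits(1)[OF assms(1,2)] assms(4)]]
  by simp_all

lemma H1_with_grad_radial:
  fixes u u' :: "real \<Rightarrow> real"
  assumes c: "c > (real DIM('a::euclidean_space) - 1) / 2"
    and u: "continuous_on {0..<1} u" "continuous_on {0..<1} u'"
    and deriv: "\<And>s. s \<in> {0<..<1} \<Longrightarrow> (u has_real_derivative u' s) (at s)"
    and decay: "\<And>s. s \<in> {0..<1} \<Longrightarrow> \<bar>u s\<bar> \<le> C * (1 - s) powr c"
      "\<And>s. s \<in> {0..<1} \<Longrightarrow> \<bar>u' s\<bar> * (1 - s) \<le> C * (1 - s) powr c"
  shows "H1_with_grad (\<lambda>x::'a. u (x \<bullet> x)) (\<lambda>x. (2 * u' (x \<bullet> x)) *\<^sub>R x)"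
proof -
  define K where "K k = real (k + 2)" for k
  have K: "K k > 1" for k by (simp add: K_def)
  have "real DIM('a) \<ge> 1" using DIM_positive[where 'a = 'a] by linarith
  then have "c \<ge> 0" by (intro less_imp_le[OF le_less_trans[OF _ c]]) simp
  have "C \<ge> 0" using decay(1)[of 0] by simp
  obtain p p' where p: "\<And>k. real_polynomial_function (p k)" "\<And>k. real_polynomial_function (p' k)"
    "\<And>k s. (p k has_real_derivative p' k s) (at s)"
    and approx: "\<And>k s. 0 \<le> s \<Longrightarrow> s \<le> 1 - 1 / K k \<Longrightarrow>
      \<bar>p k s - u s\<bar> \<le> (1 - s) powr c / K k \<and> \<bar>p' k s - u' s\<bar> \<le> (1 - s) powr c / K k"
    unfolding K_def using C1_polynomial_exhaustion[OF u deriv \<open>c \<ge> 0\<close>] by blast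
  define F where "F k s = cutoff (K k) s * p k s" for k s
  define F' where "F' k s = cutoff' (K k) s * p k s + cutoff (K k) s * p' k s" for k s
  show ?thesis
  proof (rule H1_with_grad_radial_limit[where c = c and C = "3 * (1 + C)" and F = F and F' = F'])
    show "test_fun (\<lambda>x::'a. F k (x \<bullet> x))" for k unfolding F_def by (rule test_fun_cutoff[OF p(1) K])
    show "(F k has_real_derivative F' k s) (at s)" for k s unfolding F_def[abs_def] F'_def
      by (rule DERIV_cong[OF DERIV_mult[OF cutoff_deriv p(3)]]) simp
    show "continuous_on UNIV (F' k)" for k unfolding F'_def[abs_def]
      by (intro continuous_intros continuous_on_cutoff continuous_on_cutoff'
          continuous_on_polymonial_function)
         (use p(1,2) in \<open>simp_all add: real_polynomial_function_eq\<close>)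
  next
    fix s :: real assume s: "s \<in> {0..<1}"
    have K_lim: "filterlim K at_top sequentially" unfolding K_def[abs_def]
      by (rule filterlim_real_add)
    have "(\<lambda>k. p k s) \<longlonglongrightarrow> u s" "(\<lambda>k. p' k s) \<longlonglongrightarrow> u' s"
      using s approx[of s]
        by (auto intro!: LIMSEQ_if_exhausted[where s = s and B = "(1 - s) powr c"] simp: K_def)
    from cutoff_product_limits[OF _ K_lim this] s
    show "(\<lambda>k. F k s) \<longlonglongrightarrow> u s" "(\<lambda>k. F' k s) \<longlonglongrightarrow> u' s" by (auto simp: F_def F'_def)
  next
    fix k and s :: real assume s: "s \<in> {0..<1}"
    have "(1 - s) powr c / K k \<le> (1 - s) powr c" using K[of k]
      by (simp add: divide_le_eq mult_le_cancel_left1)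
    then have near: "\<bar>p k s - u s\<bar> \<le> (1 - s) powr c \<and> \<bar>p' k s - u' s\<bar> \<le> (1 - s) powr c"
      if "s \<le> 1 - 1 / K k"
      using approx[of s k] s that by auto
    show "\<bar>F k s - u s\<bar> \<le> 3 * (1 + C) * (1 - s) powr c"
      "\<bar>F' k s - u' s\<bar> * (1 - s) \<le> 3 * (1 + C) * (1 - s) powr c"
      using cutoff_product_error[OF s K \<open>C \<ge> 0\<close> _ near decay(1)[OF s] decay(2)[OF s]]
      by (simp_all add: F_def F'_def)
  qed (use c u in auto)
qed

section \<open>Divergence of radial fields\<close>

lemma integral_translation:
  fixes F :: "'a::euclidean_space \<Rightarrow> real"
  assumes "integrable lborel F"
  shows "integrable lborel (\<lambda>x. F (x + c))" "(\<integral>x. F (x + c) \<partial>lborel) = (\<integral>x. F x \<partial>lborel)"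
proof -
  have measurable: "F \<in> borel_measurable borel" using assms by (simp add: borel_measurable_integrable)
  have "integrable (distr lborel borel ((+) c)) F" unfolding lborel_distr_plus by (rule assms)
  then show "integrable lborel (\<lambda>x. F (x + c))"
    by (subst (asm) integrable_distr_eq) (use measurable in \<open>auto simp: add.commute\<close>)
  have "(\<integral>x. F x \<partial>lborel) = (\<integral>x. F x \<partial>distr lborel borel ((+) c))" by (simp only: lborel_distr_plus)
  also have "\<dots> = (\<integral>x. F (c + x) \<partial>lborel)" by (rule integral_distr) (use measurable in auto)
  finally show "(\<integral>x. F (x + c) \<partial>lborel) = (\<integral>x. F x \<partial>lborel)" by (simp add: add.commute)
qed

lemma integrable_if_continuous_on_compact_support:
  fixes f :: "'a::euclidean_space \<Rightarrow> real"
  assumes "compact K" "continuous_on K f" "\<And>x. x \<notin> K \<Longrightarrow> f x = 0"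
  shows "integrable lborel f"
proof -
  have "(\<lambda>x. indicator K x *\<^sub>R f x) = f" using assms(3) by (auto simp: fun_eq_iff indicator_def)
  with borel_integrable_compact[OF assms(1,2)] show ?thesis by simp
qed

lemma abs_difference_quotient_le:
  fixes F F' :: "'a::real_normed_vector \<Rightarrow> real"
  assumes deriv: "\<And>x. ((\<lambda>t. F (x + t *\<^sub>R b)) has_real_derivative F' x) (at 0)"
    and bound: "\<And>x. \<bar>F' x\<bar> \<le> C" and "h > 0"
  shows "\<bar>(F (x + h *\<^sub>R b) - F x) / h\<bar> \<le> C"
proof -
  have "((\<lambda>t. F (x + t *\<^sub>R b)) has_real_derivative F' (x + t *\<^sub>R b)) (at t)" for t
  proof -
    have "((\<lambda>s. F (x + (s + t) *\<^sub>R b)) has_real_derivative F' (x + t *\<^sub>R b)) (at 0)"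
      using deriv[of "x + t *\<^sub>R b"] by (simp add: scaleR_add_left algebra_simps)
    then show ?thesis using DERIV_shift[of "\<lambda>t. F (x + t *\<^sub>R b)" _ 0 t] by simp
  qed
  then obtain s where "F (x + h *\<^sub>R b) - F (x + 0 *\<^sub>R b) = (h - 0) * F' (x + s *\<^sub>R b)"
    using MVT2[of 0 h "\<lambda>t. F (x + t *\<^sub>R b)" "\<lambda>t. F' (x + t *\<^sub>R b)"] \<open>h > 0\<close> by blast
  then have "(F (x + h *\<^sub>R b) - F x) / h = F' (x + s *\<^sub>R b)" using \<open>h > 0\<close> by simp
  then show ?thesis using bound by simp
qed

lemma LIMSEQ_difference_quotient:
  fixes F :: "'a::real_normed_vector \<Rightarrow> real"
  assumes "((\<lambda>t. F (x + t *\<^sub>R b)) has_real_derivative D) (at 0)"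
    and "h \<longlonglongrightarrow> 0" "\<And>n. h n \<noteq> 0"
  shows "(\<lambda>n. (F (x + h n *\<^sub>R b) - F x) / h n) \<longlonglongrightarrow> D"
proof -
  have "((\<lambda>t. (F (x + t *\<^sub>R b) - F x) / t) \<longlongrightarrow> D) (at 0)" using assms(1) by (simp add: DERIV_def)
  moreover have "filterlim h (at 0) sequentially" using assms(2,3) by (simp add: filterlim_at)
  ultimately show ?thesis by (rule filterlim_compose)
qed

text \<open>Difference quotients integrate to zero by translation invariance.\<close>

lemma integral_directional_derivative:
  fixes F F' :: "'a::euclidean_space \<Rightarrow> real"
  assumes deriv: "\<And>x. ((\<lambda>t. F (x + t *\<^sub>R b)) has_real_derivative F' x) (at 0)"
    and bound: "\<And>x. \<bar>F' x\<bar> \<le> C" and support: "\<And>x. norm x \<ge> R \<Longrightarrow> F x = 0"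
    and F: "integrable lborel F"
  shows "integrable lborel F'" "(\<integral>x. F' x \<partial>lborel) = 0"
proof -
  define h where "h n = inverse (real (Suc n))" for n
  define D where "D n x = (F (x + h n *\<^sub>R b) - F x) / h n" for n x
  have h: "h n > 0" "h n \<le> 1" for n by (auto simp: h_def inverse_le_1_iff)
  have "h \<longlonglongrightarrow> 0" unfolding h_def[abs_def] by (rule LIMSEQ_inverse_real_of_nat)
  then have D_lim: "(\<lambda>n. D n x) \<longlonglongrightarrow> F' x" for x
    unfolding D_def using h(1)
      by (intro LIMSEQ_difference_quotient[OF deriv]) (simp_all add: less_imp_neq[symmetric])
  have "F \<in> borel_measurable borel" using F by (simp add: borel_measurable_integrable)
  then have D_measurable: "D n \<in> borel_measurable lborel" for n unfolding D_def by measurable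
  have D_le: "norm (D n x) \<le> C * indicator (cball 0 (R + norm b)) x" for n x
  proof (cases "x \<in> cball 0 (R + norm b)")
    case True
    then show ?thesis using abs_difference_quotient_le[OF deriv bound h(1)] by (simp add: D_def)
  next
    case False
    then have "norm x > R + norm b" by simp
    moreover have "norm (h n *\<^sub>R b) \<le> norm b" using h[of n] by (simp add: mult_left_le_one_le)
    ultimately have "norm (x + h n *\<^sub>R b) \<ge> R" "norm x \<ge> R"
      using norm_diff_ineq[of x "h n *\<^sub>R b"] norm_ge_zero[of b] by linarith+
    then show ?thesis using False by (simp add: D_def support)
  qed
  have dominating: "integrable lborel (\<lambda>x::'a. C * indicator (cball 0 (R + norm b)) x)"
    using emeasure_bounded_finite[of "cball 0 (R + norm b) :: 'a set"]
    by (intro integrable_mult_right integrable_real_indicator) auto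
  have F'_measurable: "F' \<in> borel_measurable lborel"
    by (rule borel_measurable_LIMSEQ_real[OF D_lim D_measurable])
  show "integrable lborel F'"
    by (rule integrable_dominated_convergence[where s = D, OF F'_measurable D_measurable dominating])
       (use D_lim D_le in auto)
  have "(\<lambda>n. \<integral>x. D n x \<partial>lborel) \<longlonglongrightarrow> (\<integral>x. F' x \<partial>lborel)"
    by (rule integral_dominated_convergence[where s = D, OF F'_measurable D_measurable dominating])
       (use D_lim D_le in auto)
  moreover have "(\<integral>x. D n x \<partial>lborel) = 0" for n
    using integral_translation[OF F, of "h n *\<^sub>R b"] F by (simp add: D_def)
  ultimately show "(\<integral>x. F' x \<partial>lborel) = 0" by (simp add: LIMSEQ_const_iff)
qed

lemma has_real_derivative_along_line:
  assumes "(f has_derivative f') (at x)"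
  shows "((\<lambda>t. f (x + t *\<^sub>R b)) has_real_derivative f' b) (at 0)"
proof -
  have "((\<lambda>t. x + t *\<^sub>R b) has_derivative (\<lambda>h. h *\<^sub>R b)) (at 0)"
    by (auto intro!: derivative_eq_intros)
  moreover have "(f has_derivative f') (at (x + 0 *\<^sub>R b))" using assms by simp
  ultimately have "((\<lambda>t. f (x + t *\<^sub>R b)) has_derivative (\<lambda>h. f' (h *\<^sub>R b))) (at 0)"
    by (rule has_derivative_compose)
  moreover have "f' (h *\<^sub>R b) = f' b * h" for h
    using linear_cmul[OF has_derivative_linear[OF assms], of h b] by (simp add: mult.commute)
  ultimately show ?thesis by (simp add: has_field_derivative_def)
qed

lemma has_derivative_0_off_closed:
  fixes f :: "'a::real_normed_vector \<Rightarrow> real"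
  assumes "closed K" "\<And>x. x \<notin> K \<Longrightarrow> f x = 0" "x \<notin> K"
  shows "(f has_derivative (\<lambda>h. 0)) (at x)"
  by (rule has_derivative_transform_within_open[of "\<lambda>x. 0" _ _ _ "- K"])
     (use assms in \<open>auto simp: open_Compl\<close>)

definition closed_support :: "('a::topological_space \<Rightarrow> real) \<Rightarrow> 'a set" where
  "closed_support f = closure {x. f x \<noteq> 0}"

lemma eq_0_off_closed_support: "x \<notin> closed_support f \<Longrightarrow> f x = 0"
  unfolding closed_support_def using closure_subset[of "{x. f x \<noteq> 0}"] by auto

lemma egrad_eq_0_off_closed_support:
  assumes "x \<notin> closed_support f"
  shows "egrad f x = 0"
proof -
  have "(f has_derivative (\<lambda>h. 0)) (at x)"
    by (rule has_derivative_0_off_closed[OF _ eq_0_off_closed_support assms])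
      (simp add: closed_support_def)
  from frechet_derivative_at[OF this, symmetric] show ?thesis by (simp add: egrad_def)
qed

lemma compact_closed_support: "test_fun \<phi> \<Longrightarrow> compact (closed_support \<phi>)"
  by (simp add: test_fun_def closed_support_def)

lemma closed_support_subset: "test_fun \<phi> \<Longrightarrow> closed_support \<phi> \<subseteq> hyp_ball"
  by (simp add: test_fun_def closed_support_def)

lemma test_fun_has_derivative:
  assumes "test_fun \<phi>" "x \<in> hyp_ball"
  shows "(\<phi> has_derivative frechet_derivative \<phi> (at x)) (at x)"
proof -
  have "\<phi> differentiable_on hyp_ball" using assms(1)
    by (auto simp: test_fun_def elim: smooth_on.cases)
  then have "\<phi> differentiable at x"
    using assms(2) open_hyp_ball differentiable_on_eq_differentiable_at by blast
  then show ?thesis by (simp add: frechet_derivative_works)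
qed

lemma continuous_on_test_fun: "test_fun \<phi> \<Longrightarrow> continuous_on hyp_ball \<phi>"
  by (auto simp: test_fun_def elim: smooth_on.cases)

lemma continuous_on_test_fun_derivative:
  assumes "test_fun \<phi>"
  shows "continuous_on hyp_ball (\<lambda>x. frechet_derivative \<phi> (at x) v)"
proof -
  have "smooth_on hyp_ball (\<lambda>x. frechet_derivative \<phi> (at x) v)"
    using assms by (auto simp: test_fun_def elim: smooth_on.cases)
  then show ?thesis by (auto elim: smooth_on.cases)
qed

lemma continuous_on_egrad_test_fun: "test_fun \<phi> \<Longrightarrow> continuous_on hyp_ball (egrad \<phi>)"
  unfolding egrad_def[abs_def] by (intro continuous_intros continuous_on_test_fun_derivative)

lemma radial_vector_field_deriv:
  fixes x :: "'a::euclidean_space"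
  assumes Z: "continuous_on {0..<1} Z" "\<And>s. s \<in> {0<..<1} \<Longrightarrow> (Z has_real_derivative Z' s) (at s)"
    and x: "x \<in> hyp_ball" and b: "b \<in> Basis"
  shows "((\<lambda>t. Z ((x + t *\<^sub>R b) \<bullet> (x + t *\<^sub>R b)) * ((x + t *\<^sub>R b) \<bullet> b)) has_real_derivative
    Z (x \<bullet> x) + 2 * Z' (x \<bullet> x) * (x \<bullet> b)\<^sup>2) (at 0)"
proof -
  have bb: "b \<bullet> b = 1" using b by (simp add: inner_same_Basis)
  have line: "(x + t *\<^sub>R b) \<bullet> (x + t *\<^sub>R b) = x \<bullet> x + 2 * (x \<bullet> b) * t + t\<^sup>2"
    "(x + t *\<^sub>R b) \<bullet> b = x \<bullet> b + t" for t
    by (auto simp: inner_add_left inner_add_right bb inner_commute power2_eq_square algebra_simps)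
  show ?thesis
  proof (cases "x = 0")
    case False
    then have s: "x \<bullet> x \<in> {0<..<1}" using x by (simp add: in_hyp_ball)
    have "((\<lambda>t. x \<bullet> x + 2 * (x \<bullet> b) * t + t\<^sup>2) has_real_derivative 2 * (x \<bullet> b)) (at 0)"
      by (auto intro!: derivative_eq_intros)
    moreover have "(Z has_real_derivative Z' (x \<bullet> x)) (at (x \<bullet> x + 2 * (x \<bullet> b) * 0 + 0\<^sup>2))"
      using Z(2)[OF s] by simp
    ultimately have "((\<lambda>t. Z (x \<bullet> x + 2 * (x \<bullet> b) * t + t\<^sup>2))
        has_real_derivative Z' (x \<bullet> x) * (2 * (x \<bullet> b))) (at 0)"
      by (rule DERIV_chain2[rotated])
    moreover have "((\<lambda>t. x \<bullet> b + t) has_real_derivative 1) (at 0)"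
      by (auto intro!: derivative_eq_intros)
    ultimately show ?thesis unfolding line
      by (rule DERIV_cong[OF DERIV_mult]) (simp add: power2_eq_square algebra_simps)
  next
    case True
    have "(Z \<longlongrightarrow> Z 0) (at 0 within {0..<1})" using Z(1) by (auto simp: continuous_on_def)
    moreover have "filterlim (\<lambda>t::real. t\<^sup>2) (at 0 within {0..<1}) (at 0)"
      unfolding filterlim_at
    proof
      have "((\<lambda>t::real. t\<^sup>2) \<longlongrightarrow> 0) (at 0)" by (auto intro!: tendsto_eq_intros)
      then have "\<forall>\<^sub>F t::real in at 0. t\<^sup>2 < 1" by (rule order_tendstoD) simp
      moreover have "\<forall>\<^sub>F t::real in at 0. t \<noteq> 0" by (simp add: eventually_at_filter)
      ultimately show "\<forall>\<^sub>F t::real in at 0. t\<^sup>2 \<in> {0..<1} \<and> t\<^sup>2 \<noteq> 0" by eventually_elim simp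
    qed (auto intro!: tendsto_eq_intros)
    ultimately have "((\<lambda>t. Z (t\<^sup>2)) \<longlongrightarrow> Z 0) (at 0)" by (rule filterlim_compose)
    moreover have "\<forall>\<^sub>F t in at 0. Z (t\<^sup>2) = (Z (t\<^sup>2) * t - 0) / t"
      by (auto simp: eventually_at_filter)
    ultimately have "((\<lambda>t. (Z (t\<^sup>2) * t - 0) / t) \<longlongrightarrow> Z 0) (at 0)" by (rule Lim_transform_eventually)
    then show ?thesis unfolding line by (simp add: True DERIV_def)
  qed
qed

lemma divergence_sum_radial:
  fixes x v :: "'a::euclidean_space"
  shows "(\<Sum>b\<in>Basis. D b * (z * (x \<bullet> b)) + p * (z + 2 * z' * (x \<bullet> b)\<^sup>2))
    = z * (x \<bullet> (\<Sum>b\<in>Basis. D b *\<^sub>R b)) + p * (2 * (x \<bullet> x) * z' + real DIM('a) * z)"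
proof -
  have "(\<Sum>b\<in>Basis. (x \<bullet> b)\<^sup>2) = x \<bullet> x" by (subst euclidean_inner[of x x]) (simp add: power2_eq_square)
  moreover have "(\<Sum>b\<in>Basis. D b * (x \<bullet> b)) = x \<bullet> (\<Sum>b\<in>Basis. D b *\<^sub>R b)" by (simp add: inner_sum_right)
  moreover have "(\<Sum>b\<in>Basis. D b * (z * (x \<bullet> b)) + p * (z + 2 * z' * (x \<bullet> b)\<^sup>2))
      = z * (\<Sum>b\<in>Basis. D b * (x \<bullet> b)) + p * (real DIM('a) * z + 2 * z' * (\<Sum>b\<in>Basis. (x \<bullet> b)\<^sup>2))"
    by (simp add: sum.distrib sum_distrib_left distrib_left mult_ac)
  ultimately show ?thesis by (simp add: algebra_simps)
qed

text \<open>The field x -> Z (x . x) x with divergence f (x . x); Z need not be differentiable at 0, but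
  s Z'(s) stays bounded there.\<close>

context
  fixes \<phi> :: "'a::euclidean_space \<Rightarrow> real" and Z Z' f :: "real \<Rightarrow> real"
  assumes test: "test_fun \<phi>"
    and Z: "continuous_on {0..<1} Z" "\<And>s. s \<in> {0<..<1} \<Longrightarrow> (Z has_real_derivative Z' s) (at s)"
    and f: "continuous_on {0..<1} f"
    and divergence: "\<And>s. s \<in> {0..<1} \<Longrightarrow> 2 * s * Z' s + real DIM('a) * Z s = f s"
begin

definition field_component :: "'a \<Rightarrow> 'a \<Rightarrow> real" where
  "field_component b x = \<phi> x * (Z (x \<bullet> x) * (x \<bullet> b))"

definition field_component' :: "'a \<Rightarrow> 'a \<Rightarrow> real" where
  "field_component' b x = (egrad \<phi> x \<bullet> b) * (Z (x \<bullet> x) * (x \<bullet> b))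
    + \<phi> x * (Z (x \<bullet> x) + 2 * Z' (x \<bullet> x) * (x \<bullet> b)\<^sup>2)"

lemma field_component_eq_0: "x \<notin> closed_support \<phi> \<Longrightarrow> field_component b x = 0"
  by (simp add: field_component_def eq_0_off_closed_support)

lemma field_component'_eq_0: "x \<notin> closed_support \<phi> \<Longrightarrow> field_component' b x = 0"
  by (simp add: field_component'_def eq_0_off_closed_support egrad_eq_0_off_closed_support)

lemma inner_self_closed_support: "x \<in> closed_support \<phi> \<Longrightarrow> x \<bullet> x \<in> {0..<1}"
  using closed_support_subset[OF test] by (auto simp: in_hyp_ball)

lemma field_component_deriv:
  assumes b: "b \<in> Basis"
  shows "((\<lambda>t. field_component b (x + t *\<^sub>R b)) has_real_derivative field_component' b x) (at 0)"
proof (cases "x \<in> closed_support \<phi>")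
  case True
  then have x: "x \<in> hyp_ball" using closed_support_subset[OF test] by auto
  have "((\<lambda>t. \<phi> (x + t *\<^sub>R b)) has_real_derivative egrad \<phi> x \<bullet> b) (at 0)"
    using has_real_derivative_along_line[OF test_fun_has_derivative[OF test x]] b
      by (simp add: egrad_def)
  moreover have "((\<lambda>t. Z ((x + t *\<^sub>R b) \<bullet> (x + t *\<^sub>R b)) * ((x + t *\<^sub>R b) \<bullet> b)) has_real_derivative
      Z (x \<bullet> x) + 2 * Z' (x \<bullet> x) * (x \<bullet> b)\<^sup>2) (at 0)"
    by (rule radial_vector_field_deriv[OF Z x b])
  ultimately show ?thesis unfolding field_component_def field_component'_def
    by (rule DERIV_cong[OF DERIV_mult]) simp
next
  case False
  have "(field_component b has_derivative (\<lambda>h. 0)) (at x)"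
    using compact_imp_closed[OF compact_closed_support[OF test]] field_component_eq_0 False
    by (rule has_derivative_0_off_closed)
  from has_real_derivative_along_line[OF this] show ?thesis
    by (simp add: field_component'_eq_0[OF False])
qed

lemmas continuous_on_closed_support =
  continuous_on_subset[OF continuous_on_test_fun[OF test] closed_support_subset[OF test]]
  continuous_on_subset[OF continuous_on_egrad_test_fun[OF test] closed_support_subset[OF test]]
  continuous_on_inner_self_compose[OF Z(1) inner_self_closed_support]
  continuous_on_inner_self_compose[OF f inner_self_closed_support]

lemma integrable_field_component: "integrable lborel (field_component b)"
  by (rule integrable_if_continuous_on_compact_support[OF compact_closed_support[OF test] _ field_component_eq_0])
     (auto simp: field_component_def[abs_def] intro!: continuous_intros continuous_on_closed_support)

lemma bounded_field_component':
  assumes b: "b \<in> Basis"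
  shows "\<exists>C. \<forall>x. \<bar>field_component' b x\<bar> \<le> C"
proof -
  define g where "g x = \<bar>egrad \<phi> x \<bullet> b\<bar> * (\<bar>Z (x \<bullet> x)\<bar> * \<bar>x \<bullet> b\<bar>)
    + \<bar>\<phi> x\<bar> * (\<bar>Z (x \<bullet> x)\<bar> + \<bar>f (x \<bullet> x) - real DIM('a) * Z (x \<bullet> x)\<bar>)" for x
  have "continuous_on (closed_support \<phi>) g"
    unfolding g_def[abs_def] by (intro continuous_intros continuous_on_closed_support)
  then have "bounded (g ` closed_support \<phi>)"
    using compact_closed_support[OF test] by (intro compact_imp_bounded compact_continuous_image)
  then obtain C where C: "\<And>x. x \<in> closed_support \<phi> \<Longrightarrow> g x \<le> C"
    by (auto simp: bounded_iff) (meson abs_ge_self order_trans)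
  have "\<bar>field_component' b x\<bar> \<le> max C 0" for x
  proof (cases "x \<in> closed_support \<phi>")
    case True
    have "(x \<bullet> b)\<^sup>2 \<le> x \<bullet> x"
      using power_mono[OF Basis_le_norm[OF b], of x 2] by (simp add: power2_norm_eq_inner)
    from mult_left_mono[OF this, of "\<bar>2 * Z' (x \<bullet> x)\<bar>"]
    have "\<bar>2 * Z' (x \<bullet> x) * (x \<bullet> b)\<^sup>2\<bar> \<le> \<bar>2 * (x \<bullet> x) * Z' (x \<bullet> x)\<bar>"
      by (simp add: abs_mult mult_ac)
    also have "2 * (x \<bullet> x) * Z' (x \<bullet> x) = f (x \<bullet> x) - real DIM('a) * Z (x \<bullet> x)"
      using divergence[OF inner_self_closed_support[OF True]] by simp
    finally have "\<bar>Z (x \<bullet> x) + 2 * Z' (x \<bullet> x) * (x \<bullet> b)\<^sup>2\<bar>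
        \<le> \<bar>Z (x \<bullet> x)\<bar> + \<bar>f (x \<bullet> x) - real DIM('a) * Z (x \<bullet> x)\<bar>" by linarith
    then have "\<bar>field_component' b x\<bar> \<le> g x" unfolding field_component'_def g_def
      by (intro order_trans[OF abs_triangle_ineq] add_mono)
        (auto simp: abs_mult intro!: mult_left_mono)
    then show ?thesis using C[OF True] by simp
  qed (simp add: field_component'_eq_0)
  then show ?thesis by blast
qed

lemma integral_field_component':
  assumes b: "b \<in> Basis"
  shows "integrable lborel (field_component' b)" "(\<integral>x. field_component' b x \<partial>lborel) = 0"
proof -
  have support: "field_component b x = 0" if "norm x \<ge> 1" for x
    using field_component_eq_0 closed_support_subset[OF test] that by (force simp: hyp_ball_def)
  obtain C where C: "\<And>x. \<bar>field_component' b x\<bar> \<le> C" using bounded_field_component'[OF b] by blast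
  show "integrable lborel (field_component' b)"
    by (rule integral_directional_derivative(1)[OF field_component_deriv[OF b] C support integrable_field_component])
  show "(\<integral>x. field_component' b x \<partial>lborel) = 0"
    by (rule integral_directional_derivative(2)[OF field_component_deriv[OF b] C support integrable_field_component])
qed

lemma radial_divergence: "(\<integral>x. Z (x \<bullet> x) * (x \<bullet> egrad \<phi> x) + f (x \<bullet> x) * \<phi> x \<partial>lborel) = 0"
proof -
  have "Z (x \<bullet> x) * (x \<bullet> egrad \<phi> x) + f (x \<bullet> x) * \<phi> x = (\<Sum>b\<in>Basis. field_component' b x)" for x
  proof (cases "x \<in> closed_support \<phi>")
    case True
    show ?thesis unfolding field_component'_def divergence_sum_radial euclidean_representation
        divergence[OF inner_self_closed_support[OF True]] by simp
  qed (simp add: field_component'_eq_0 eq_0_off_closed_support egrad_eq_0_off_closed_support)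
  then have "(\<integral>x. Z (x \<bullet> x) * (x \<bullet> egrad \<phi> x) + f (x \<bullet> x) * \<phi> x \<partial>lborel)
      = (\<Sum>b\<in>Basis. \<integral>x. field_component' b x \<partial>lborel)"
    by (simp only:) (rule Bochner_Integration.integral_sum, use integral_field_component' in auto)
  then show ?thesis by (simp add: integral_field_component')
qed

end

section \<open>The weak equation for radial functions\<close>

lemma integral_hyp_vol_compact_support:
  fixes f :: "'a::euclidean_space \<Rightarrow> real"
  assumes f: "continuous_on hyp_ball f" and K: "compact K" "K \<subseteq> hyp_ball" and zero:
    "\<And>x. x \<notin> K \<Longrightarrow> f x = 0"
  shows "integrable hyp_vol f" "integrable lborel (\<lambda>x. hyp_conf x ^ DIM('a) * f x)"
    "(\<integral>x. f x \<partial>hyp_vol) = (\<integral>x. hyp_conf x ^ DIM('a) * f x \<partial>lborel)"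
proof -
  let ?g = "\<lambda>x. hyp_conf x ^ DIM('a) * f x"
  have "continuous_on K ?g" using K(2) f continuous_on_hyp_conf
    by (intro continuous_intros) (auto intro: continuous_on_subset)
  then show g: "integrable lborel ?g"
    by (rule integrable_if_continuous_on_compact_support[OF K(1)]) (simp add: zero)
  then have "?g \<in> borel_measurable lborel" by (rule borel_measurable_integrable)
  with g have g_lebesgue: "integrable lebesgue ?g" "(\<integral>x. ?g x \<partial>lebesgue) = (\<integral>x. ?g x \<partial>lborel)"
    by (auto simp: integrable_completion integral_completion)
  have f_measurable: "f \<in> borel_measurable (lebesgue_on hyp_ball)"
    by (rule continuous_imp_measurable_on_sets_lebesgue[OF f hyp_ball_sets])
  have nonneg: "AE x in lebesgue_on (hyp_ball :: 'a set). 0 \<le> hyp_conf x ^ DIM('a)"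
    by (rule AE_I2) (auto intro!: zero_le_power less_imp_le[OF hyp_conf_pos])
  have g_eq: "(\<lambda>x. indicator hyp_ball x *\<^sub>R (hyp_conf x ^ DIM('a) *\<^sub>R f x)) = ?g"
    using K(2) zero by (auto simp: fun_eq_iff indicator_def)
  have ball: "(hyp_ball :: 'a set) \<inter> space lebesgue \<in> sets lebesgue" using hyp_ball_sets by simp
  note hyp_vol_lebesgue = hyp_vol_def integrable_density[OF f_measurable
      borel_measurable_hyp_conf_power nonneg]
    integral_density[OF f_measurable borel_measurable_hyp_conf_power nonneg]
    integrable_restrict_space[OF ball] integral_restrict_space[OF ball] g_eq
  show "integrable hyp_vol f" unfolding hyp_vol_lebesgue by (rule g_lebesgue)
  show "(\<integral>x. f x \<partial>hyp_vol) = (\<integral>x. ?g x \<partial>lborel)" unfolding hyp_vol_lebesgue by (rule g_lebesgue)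
qed

text \<open>Here - Z (x . x) x is the gradient of u (x . x) times the conformal factor to the power
  DIM('a) - 2, so the last assumption is the equation in divergence form.\<close>

context
  fixes u u' g Z Z' :: "real \<Rightarrow> real" and lam :: real
  assumes u: "continuous_on {0..<1} u" "continuous_on {0..<1} u'" and g: "continuous_on {0..<1} g"
    and Z: "continuous_on {0..<1} Z" "\<And>s. s \<in> {0<..<1} \<Longrightarrow> (Z has_real_derivative Z' s) (at s)"
    and field: "\<And>s. s \<in> {0..<1} \<Longrightarrow>
      (2 / (1 - s)) ^ DIM('a::euclidean_space) * (((1 - s) / 2)\<^sup>2 * (2 * u' s)) = - Z s"
    and equation: "\<And>s. s \<in> {0..<1} \<Longrightarrow>
      2 * s * Z' s + real DIM('a) * Z s = (2 / (1 - s)) ^ DIM('a) * (lam * u s + g s)"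
begin

definition gradient_pairing :: "('a \<Rightarrow> real) \<Rightarrow> 'a \<Rightarrow> real" where
  "gradient_pairing \<phi> x = ((1 - (norm x)\<^sup>2) / 2)\<^sup>2 * ((2 * u' (x \<bullet> x)) *\<^sub>R x \<bullet> egrad \<phi> x)"

lemma hyp_conf_gradient_pairing:
  assumes "x \<in> hyp_ball"
  shows "hyp_conf x ^ DIM('a) * gradient_pairing \<phi> x = - Z (x \<bullet> x) * (x \<bullet> egrad \<phi> x)"
proof -
  have s: "x \<bullet> x \<in> {0..<1}" using assms by (simp add: in_hyp_ball)
  have "hyp_conf x ^ DIM('a) * gradient_pairing \<phi> x
      = (2 / (1 - x \<bullet> x)) ^ DIM('a) * (((1 - x \<bullet> x) / 2)\<^sup>2 * (2 * u' (x \<bullet> x))) * (x \<bullet> egrad \<phi> x)"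
    unfolding hyp_conf_def gradient_pairing_def power2_norm_eq_inner by simp
  then show ?thesis by (simp only: field[OF s])
qed

lemma weak_equation_radial:
  assumes test: "test_fun \<phi>"
  shows "integrable hyp_vol (gradient_pairing \<phi>)" "integrable hyp_vol (\<lambda>x::'a. u (x \<bullet> x) * \<phi> x)"
    "integrable hyp_vol (\<lambda>x::'a. g (x \<bullet> x) * \<phi> x)"
    "(\<integral>x. gradient_pairing \<phi> x \<partial>hyp_vol) - lam * (\<integral>x. u (x \<bullet> x) * \<phi> x \<partial>hyp_vol)
        = (\<integral>x. g (x \<bullet> x) * \<phi> x \<partial>hyp_vol)"
proof -
  have sq: "x \<bullet> x \<in> {0..<1}" if "x \<in> hyp_ball" for x :: 'a using that by (simp add: in_hyp_ball)
  note continuous_ball = continuous_on_test_fun[OF test] continuous_on_egrad_test_fun[OF test]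
    continuous_on_inner_self_compose[OF u(1) sq] continuous_on_inner_self_compose[OF u(2) sq]
    continuous_on_inner_self_compose[OF g sq]
  note integral = integral_hyp_vol_compact_support[OF _ compact_closed_support[OF test]
      closed_support_subset[OF test]]
  note off_support = eq_0_off_closed_support[of _ \<phi>] egrad_eq_0_off_closed_support[of _ \<phi>]
  show integrable: "integrable hyp_vol (gradient_pairing \<phi>)"
    "integrable hyp_vol (\<lambda>x::'a. u (x \<bullet> x) * \<phi> x)"
    "integrable hyp_vol (\<lambda>x::'a. g (x \<bullet> x) * \<phi> x)"
    unfolding gradient_pairing_def[abs_def]
    by ((rule integral(1), (intro continuous_intros continuous_ball; simp), simp add: off_support)+)
  define f where "f s = (2 / (1 - s)) ^ DIM('a) * (lam * u s + g s)" for s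
  have f: "continuous_on {0..<1} f" unfolding f_def[abs_def] by (intro continuous_intros u g) auto
  define J where "J x = gradient_pairing \<phi> x - lam * (u (x \<bullet> x) * \<phi> x) - g (x \<bullet> x) * \<phi> x" for x
  have J_eq: "hyp_conf x ^ DIM('a) * J x = - (Z (x \<bullet> x) * (x \<bullet> egrad \<phi> x) + f (x \<bullet> x) * \<phi> x)" for x
  proof (cases "x \<in> closed_support \<phi>")
    case True
    then have "x \<in> hyp_ball" using closed_support_subset[OF test] by auto
    then show ?thesis unfolding J_def right_diff_distrib hyp_conf_gradient_pairing[OF \<open>x \<in> hyp_ball\<close>]
      by (simp add: f_def hyp_conf_def power2_norm_eq_inner algebra_simps)
  qed (simp add: J_def gradient_pairing_def off_support)
  have "continuous_on hyp_ball J" unfolding J_def[abs_def] gradient_pairing_def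
    by (intro continuous_intros continuous_ball; simp)
  then have "(\<integral>x. J x \<partial>hyp_vol) = (\<integral>x. hyp_conf x ^ DIM('a) * J x \<partial>lborel)"
    by (rule integral(3)) (simp add: J_def gradient_pairing_def off_support)
  also have "\<dots> = 0"
    unfolding J_eq Bochner_Integration.integral_minus
    by (subst radial_divergence[OF test Z f]) (simp_all add: equation f_def)
  finally show "(\<integral>x. gradient_pairing \<phi> x \<partial>hyp_vol) - lam * (\<integral>x. u (x \<bullet> x) * \<phi> x \<partial>hyp_vol)
      = (\<integral>x. g (x \<bullet> x) * \<phi> x \<partial>hyp_vol)"
    by (simp add: J_def integrable)
qed

lemma weak_solution_radial:
  assumes "H1_with_grad (\<lambda>x::'a. u (x \<bullet> x)) (\<lambda>x. (2 * u' (x \<bullet> x)) *\<^sub>R x)"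
    and "\<And>s. g s = \<bar>u s\<bar> powr (crit_exp DIM('a) - 2) * u s"
  shows "weak_solution lam (\<lambda>x::'a. u (x \<bullet> x))"
  unfolding weak_solution_def assms(2)[symmetric]
  using assms(1) weak_equation_radial[unfolded gradient_pairing_def[abs_def]] by blast

end

section \<open>Sign changes almost everywhere\<close>

lemma AE_hyp_vol_iff:
  "(AE x in (hyp_vol :: 'a::euclidean_space measure). P x) \<longleftrightarrow> (AE x in lebesgue. x \<in> hyp_ball \<longrightarrow> P x)"
proof -
  have "(AE x in (hyp_vol :: 'a measure). P x)
      \<longleftrightarrow> (AE x in lebesgue_on hyp_ball. 0 < ennreal (hyp_conf (x::'a) ^ DIM('a)) \<longrightarrow> P x)"
    unfolding hyp_vol_def by (rule AE_density) simp
  also have "\<dots> \<longleftrightarrow> (AE x in lebesgue. x \<in> hyp_ball \<longrightarrow> P x)"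
    using hyp_ball_sets hyp_conf_pos
      by (subst AE_restrict_space_iff) (auto intro!: AE_cong zero_less_power)
  finally show ?thesis .
qed

lemma AE_hyp_vol_eq_0_imp_eq_0:
  fixes f :: "'a::euclidean_space \<Rightarrow> real"
  assumes "continuous_on hyp_ball f" "AE x in hyp_vol. f x = 0" "x \<in> hyp_ball"
  shows "f x = 0"
proof (rule ccontr)
  assume "f x \<noteq> 0"
  define S where "S = {x \<in> hyp_ball. f x \<noteq> 0}"
  have "open S" using continuous_open_preimage[OF assms(1) open_hyp_ball, of "- {0}"]
    by (simp add: S_def vimage_def Int_def open_Compl)
  moreover have "AE x in lebesgue. x \<notin> S" using assms(2) unfolding AE_hyp_vol_iff
    by eventually_elim (simp add: S_def)
  ultimately have "negligible S" by (simp add: negligible_iff_null_sets AE_iff_null_sets)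
  then have "S = {}" using open_not_negligible \<open>open S\<close> by blast
  then show False using assms(3) \<open>f x \<noteq> 0\<close> by (auto simp: S_def)
qed

lemma emeasure_hyp_vol_positive_part:
  fixes f :: "'a::euclidean_space \<Rightarrow> real"
  assumes "continuous_on hyp_ball f" "x \<in> hyp_ball" "f x > 0"
  shows "emeasure hyp_vol {x \<in> space hyp_vol. f x > 0} > 0"
proof (rule ccontr)
  assume "\<not> ?thesis"
  moreover have "f \<in> borel_measurable hyp_vol" using assms(1)
    by (rule borel_measurable_hyp_vol_if_continuous)
  ultimately have "AE x in hyp_vol. \<not> f x > 0" by (subst AE_iff_null) (auto simp: null_sets_def)
  then have "AE x in hyp_vol. max (f x) 0 = 0" by eventually_elim simp
  then have "max (f x) 0 = 0"
    by (rule AE_hyp_vol_eq_0_imp_eq_0[where f = "\<lambda>x. max (f x) 0", rotated])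
      (intro continuous_intros assms)+
  then show False using assms(3) by simp
qed

definition radial_lift :: "(real \<Rightarrow> real) \<Rightarrow> 'a::euclidean_space \<Rightarrow> real" where
  "radial_lift w x = w (hyp_radius (x \<bullet> x))"

lemma radial_lift_is_radial: "radial (radial_lift w)"
  by (simp add: radial_def radial_lift_def norm_eq_sqrt_inner)

lemma continuous_on_radial_lift: "continuous_on {0..} w \<Longrightarrow> continuous_on hyp_ball (radial_lift w)"
  unfolding radial_lift_def[abs_def]
  by (rule continuous_on_inner_self_compose[OF continuous_on_compose2[OF _ continuous_on_hyp_radius hyp_radius_image]])
     (simp_all add: in_hyp_ball)

lemma radial_lift_attains:
  assumes "r \<ge> 0"
  obtains x :: "'a::euclidean_space" where "x \<in> hyp_ball" "radial_lift w x = w r"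
proof -
  obtain b :: 'a where "b \<in> Basis" using nonempty_Basis by blast
  then have "(tanh (r / 2) *\<^sub>R b) \<bullet> (tanh (r / 2) *\<^sub>R b) = (tanh (r / 2))\<^sup>2"
    by (simp add: power2_eq_square inner_same_Basis)
  then show ?thesis using assms
    by (intro that[of "tanh (r / 2) *\<^sub>R b"])
       (simp_all add: in_hyp_ball radial_lift_def hyp_radius_tanh tanh_half_sq_less_1)
qed

lemma alternates_sign_change:
  assumes "alternates w (Suc k) r"
  obtains s t where "s \<ge> 0" "w s > 0" "t \<ge> 0" "w t < 0"
proof -
  have pos: "r > 0" if "alternates w k r" for k r using that by (induction k arbitrary: r) force+
  obtain s where "alternates w k s" "s < r" "w r * w s < 0" using assms by auto
  then show ?thesis using that[of r s] that[of s r] pos[of k s] by (auto simp: mult_less_0_iff)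
qed

lemma radial_lift_sign_changing:
  assumes w: "continuous_on {0..} w" and "alternates w (Suc k) r"
  shows "sign_changing (radial_lift w :: 'a::euclidean_space \<Rightarrow> real)"
    "nontrivial (radial_lift w :: 'a \<Rightarrow> real)"
proof -
  obtain s t where st: "s \<ge> 0" "w s > 0" "t \<ge> 0" "w t < 0" using alternates_sign_change[OF assms(2)] .
  obtain x y :: 'a where x: "x \<in> hyp_ball" "radial_lift w x = w s" and y: "y \<in> hyp_ball"
    "radial_lift w y = w t"
    using radial_lift_attains[OF st(1), of w] radial_lift_attains[OF st(3), of w] by metis
  note continuous = continuous_on_radial_lift[OF w]
  show "sign_changing (radial_lift w :: 'a \<Rightarrow> real)" unfolding sign_changing_def
    using emeasure_hyp_vol_positive_part[OF continuous x(1)]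
      emeasure_hyp_vol_positive_part[OF continuous_on_minus[OF continuous] y(1)] x y st by simp
  show "nontrivial (radial_lift w :: 'a \<Rightarrow> real)" unfolding nontrivial_def
    using AE_hyp_vol_eq_0_imp_eq_0[OF continuous _ x(1)] x(2) st(2) by auto
qed

lemma radial_lift_AE_eqD:
  assumes "continuous_on {0..} v" "continuous_on {0..} w"
    and "AE x in hyp_vol. radial_lift v (x::'a::euclidean_space) = radial_lift w x"
  shows "v 0 = w 0"
proof -
  have "continuous_on hyp_ball (\<lambda>x::'a. radial_lift v x - radial_lift w x)"
    by (intro continuous_intros continuous_on_radial_lift assms(1,2))
  then have "radial_lift v (0::'a) - radial_lift w (0::'a) = 0"
    by (rule AE_hyp_vol_eq_0_imp_eq_0[where f = "\<lambda>x::'a. radial_lift v x - radial_lift w x"])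
      (use assms(3) in \<open>auto simp: in_hyp_ball\<close>)
  then show ?thesis by (simp add: radial_lift_def)
qed

section \<open>From fast solutions to weak solutions\<close>

context radial_equation begin

definition flux_ratio :: "(real \<Rightarrow> real) \<Rightarrow> (real \<Rightarrow> real) \<Rightarrow> real \<Rightarrow> real" where
  "flux_ratio w z r = (if r = 0 then nonlin (w 0) / real (Suc d) else velocity z r / sinh r)"

definition profile :: "(real \<Rightarrow> real) \<Rightarrow> real \<Rightarrow> real" where
  "profile w s = w (hyp_radius s)"

definition profile' :: "(real \<Rightarrow> real) \<Rightarrow> (real \<Rightarrow> real) \<Rightarrow> real \<Rightarrow> real" where
  "profile' w z s = - 2 * flux_ratio w z (hyp_radius s) / (1 - s)\<^sup>2"

definition radial_field :: "(real \<Rightarrow> real) \<Rightarrow> (real \<Rightarrow> real) \<Rightarrow> real \<Rightarrow> real" where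
  "radial_field w z s = (2 / (1 - s)) ^ Suc d * flux_ratio w z (hyp_radius s)"

definition radial_field' :: "(real \<Rightarrow> real) \<Rightarrow> (real \<Rightarrow> real) \<Rightarrow> real \<Rightarrow> real" where
  "radial_field' w z s = ((2 / (1 - s)) ^ Suc d * nonlin (profile w s)
      - real (Suc d) * radial_field w z s) / (2 * s)"

context
  fixes w z :: "real \<Rightarrow> real"
  assumes sol: "shooting_solution w z"
begin

lemma flux_ratio_eq: "r > 0 \<Longrightarrow> flux_ratio w z r = z r / sinh r ^ Suc d"
  by (simp add: flux_ratio_def velocity_def)

lemma flux_ratio_tendsto_0: "(flux_ratio w z \<longlongrightarrow> flux_ratio w z 0) (at_right 0)"
proof -
  have pos: "\<forall>\<^sub>F r in at_right (0::real). r > 0" by (auto simp: eventually_at_filter)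
  have "((\<lambda>r. z r / sinh r ^ Suc d) \<longlongrightarrow> nonlin (w 0) / real (Suc d)) (at_right 0)"
  proof (rule lhopital_right_0[where f' = "\<lambda>r. sinh r ^ d * nonlin (w r)"
        and g' = "\<lambda>r. real (Suc d) * sinh r ^ d * cosh r"])
    show "(z \<longlongrightarrow> 0) (at_right 0)"
      using continuous_on_z[OF sol] z_0[OF sol]
        by (auto simp: continuous_on_def at_within_Ici_at_right dest!: bspec[of _ _ 0])
    show "((\<lambda>r::real. sinh r ^ Suc d) \<longlongrightarrow> 0) (at_right 0)" by (auto intro!: tendsto_eq_intros)
    show "\<forall>\<^sub>F r in at_right (0::real). sinh r ^ Suc d \<noteq> 0"
      "\<forall>\<^sub>F r in at_right (0::real). real (Suc d) * sinh r ^ d * cosh r \<noteq> 0"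
      using pos by (eventually_elim, simp)+
    show "\<forall>\<^sub>F r in at_right 0. (z has_real_derivative sinh r ^ d * nonlin (w r)) (at r)"
      using pos by eventually_elim (rule z_deriv[OF sol])
    show "\<forall>\<^sub>F r in at_right (0::real). ((\<lambda>r. sinh r ^ Suc d)
        has_real_derivative real (Suc d) * sinh r ^ d * cosh r) (at r)"
      by (rule always_eventually) (auto intro!: derivative_eq_intros simp del: power_Suc)
    have "((\<lambda>r. nonlin (w r)) \<longlongrightarrow> nonlin (w 0)) (at_right 0)"
      using continuous_on_nonlin_w[OF sol]
        by (auto simp: continuous_on_def at_within_Ici_at_right dest!: bspec[of _ _ 0])
    then have "((\<lambda>r. nonlin (w r) / (real (Suc d) * cosh r)) \<longlongrightarrow> nonlin (w 0)
        / (real (Suc d) * cosh 0)) (at_right 0)"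
      by (intro tendsto_intros) auto
    moreover have "\<forall>\<^sub>F r in at_right 0. nonlin (w r) / (real (Suc d) * cosh r)
        = sinh r ^ d * nonlin (w r) / (real (Suc d) * sinh r ^ d * cosh r)"
      using pos by eventually_elim simp
    ultimately show "((\<lambda>r. sinh r ^ d * nonlin (w r) / (real (Suc d) * sinh r ^ d * cosh r))
        \<longlongrightarrow> nonlin (w 0) / real (Suc d)) (at_right 0)"
      by (simp add: Lim_transform_eventually)
  qed
  moreover have "\<forall>\<^sub>F r in at_right 0. z r / sinh r ^ Suc d = flux_ratio w z r"
    using pos by eventually_elim (simp add: flux_ratio_eq)
  ultimately have "(flux_ratio w z \<longlongrightarrow> nonlin (w 0) / real (Suc d)) (at_right 0)"
    by (rule Lim_transform_eventually)
  then show ?thesis by (simp add: flux_ratio_def)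
qed

lemma continuous_on_flux_ratio: "continuous_on {0..} (flux_ratio w z)"
  unfolding continuous_on_eq_continuous_within
proof
  fix r :: real assume "r \<in> {0..}"
  show "continuous (at r within {0..}) (flux_ratio w z)"
  proof (cases "r = 0")
    case True
    then show ?thesis using flux_ratio_tendsto_0
      by (simp add: continuous_within at_within_Ici_at_right)
  next
    case False
    have "continuous_on {0<..} (\<lambda>r. z r / sinh r ^ Suc d)"
      by (intro continuous_intros continuous_on_subset[OF continuous_on_z[OF sol]]) auto
    then have "continuous_on {0<..} (flux_ratio w z)"
      by (rule continuous_on_eq) (simp add: flux_ratio_eq)
    then have "isCont (flux_ratio w z) r"
      using False \<open>r \<in> {0..}\<close> by (simp add: continuous_on_eq_continuous_at)
    then show ?thesis by (rule continuous_at_imp_continuous_at_within)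
  qed
qed

lemma continuous_on_flux_ratio_hyp_radius: "continuous_on {0..<1} (\<lambda>s. flux_ratio w z (hyp_radius s))"
  by (rule continuous_on_compose2[OF continuous_on_flux_ratio continuous_on_hyp_radius hyp_radius_image])

lemma continuous_on_profile: "continuous_on {0..<1} (profile w)"
  unfolding profile_def[abs_def]
  by (rule continuous_on_compose2[OF continuous_on_w[OF sol] continuous_on_hyp_radius hyp_radius_image])

lemma continuous_on_profile': "continuous_on {0..<1} (profile' w z)"
  unfolding profile'_def[abs_def]
    by (intro continuous_intros continuous_on_flux_ratio_hyp_radius) auto

lemma continuous_on_radial_field: "continuous_on {0..<1} (radial_field w z)"
  unfolding radial_field_def[abs_def]
    by (intro continuous_intros continuous_on_flux_ratio_hyp_radius) auto

lemma profile'_eq: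
  assumes "s \<in> {0<..<1}"
  shows "profile' w z s = - velocity z (hyp_radius s) / (sqrt s * (1 - s))"
proof -
  define v T x where "v = velocity z (hyp_radius s)" and "T = 1 - s" and "x = sqrt s"
  have "x > 0" "T > 0" "hyp_radius s > 0" using assms hyp_radius_pos[of s] by (auto simp: x_def T_def)
  then show ?thesis unfolding profile'_def flux_ratio_def sinh_hyp_radius
    by (simp add: v_def[symmetric] T_def[symmetric] x_def[symmetric] power2_eq_square)
qed

lemma profile_deriv:
  assumes "s \<in> {0<..<1}"
  shows "(profile w has_real_derivative profile' w z s) (at s)"
proof -
  have s: "0 < s" "s < 1" using assms by auto
  have "(profile w has_real_derivative - velocity z (hyp_radius s) * (1 / (sqrt s * (1 - s)))) (at s)"
    unfolding profile_def[abs_def]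
      by (rule DERIV_chain2[OF w_deriv[OF sol hyp_radius_pos[OF s]] hyp_radius_deriv[OF s]])
  then show ?thesis by (simp add: profile'_eq[OF assms])
qed

lemma radial_field_eq:
  assumes "s \<in> {0<..<1}"
  shows "radial_field w z s = z (hyp_radius s) / sqrt s ^ Suc d"
  using assms hyp_radius_pos[of s]
  by (simp add: radial_field_def flux_ratio_eq sinh_hyp_radius power_divide power_mult_distrib
      del: power_Suc)

lemma radial_field_equation:
  assumes "s \<in> {0..<1}"
  shows "2 * s * radial_field' w z s + real (Suc d) * radial_field w z s
      = (2 / (1 - s)) ^ Suc d * nonlin (profile w s)"
proof (cases "s = 0")
  case True
  then show ?thesis by (simp add: radial_field_def flux_ratio_def profile_def del: of_nat_Suc)
qed (simp add: radial_field'_def)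

lemma radial_field_deriv:
  assumes s: "s \<in> {0<..<1}"
  shows "(radial_field w z has_real_derivative radial_field' w z s) (at s)"
proof -
  define x T H Y where "x = sqrt s" and "T = 1 - s" and "H = nonlin (w (hyp_radius s))"
    and "Y = z (hyp_radius s)"
  have pos: "x > 0" "T > 0" "x\<^sup>2 = s" using s by (auto simp: x_def T_def)
  have "((\<lambda>s. z (hyp_radius s)) has_real_derivative (sinh (hyp_radius s) ^ d * H) * (1 / (x * T))) (at s)"
    unfolding H_def x_def T_def
    by (rule DERIV_chain2[OF z_deriv[OF sol hyp_radius_pos] hyp_radius_deriv]) (use s in auto)
  moreover have "((\<lambda>s. sqrt s ^ Suc d) has_real_derivative real (Suc d) * x ^ d * (inverse x / 2)) (at s)"
    unfolding x_def using s by (auto intro!: derivative_eq_intros simp del: power_Suc)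
  ultimately have "((\<lambda>s. z (hyp_radius s) / sqrt s ^ Suc d) has_real_derivative
      ((sinh (hyp_radius s) ^ d * H) * (1 / (x * T)) * x ^ Suc d - Y *
          (real (Suc d) * x ^ d * (inverse x / 2)))
        / (x ^ Suc d * x ^ Suc d)) (at s)"
    unfolding x_def Y_def by (rule DERIV_divide) (use s in simp)
  moreover have "((sinh (hyp_radius s) ^ d * H) * (1 / (x * T)) * x ^ Suc d
      - Y * (real (Suc d) * x ^ d * (inverse x / 2)))
        / (x ^ Suc d * x ^ Suc d) = radial_field' w z s"
  proof -
    have "((P * A / B * H) * (1 / (x * T)) * (x * A) - Y * (n * A * (inverse x / 2)))
        / ((x * A) * (x * A))
        = ((2 * P) / (T * B) * H - n * (Y / (x * A))) / (2 * x\<^sup>2)" if "A > 0" "B >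
          0" for A B P n :: real
      using pos(1,2) that by (simp add: divide_simps power2_eq_square) algebra
    from this[of "x ^ d" "T ^ d" "2 ^ d" "real (Suc d)"] show ?thesis
      using pos
        unfolding radial_field'_def radial_field_eq[OF s] profile_def H_def[symmetric]
          Y_def[symmetric]
      by (simp add: sinh_hyp_radius x_def[symmetric] T_def[symmetric] power_divide power_mult_distrib
          del: of_nat_Suc)
  qed
  ultimately have "((\<lambda>s. z (hyp_radius s) / sqrt s ^ Suc d)
      has_real_derivative radial_field' w z s) (at s)" by simp
  then show ?thesis
    by (rule has_field_derivative_transform_within_open[of _ _ _ "{0<..<1}"])
      (use s radial_field_eq in auto)
qed

end

end

context coercive_radial_equation begin

lemma exp_decay_hyp_radius:
  assumes "s \<in> {0..<1}"
  shows "exp (- decay_rate * hyp_radius s) \<le> (1 - s) powr decay_rate"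
proof -
  have "exp (- decay_rate * hyp_radius s) = exp (- hyp_radius s) powr decay_rate"
    by (simp add: powr_def)
  also have "\<dots> \<le> (1 - s) powr decay_rate"
    using exp_minus_hyp_radius_le[of s] assms decay_rate_pos by (intro powr_mono2) auto
  finally show ?thesis .
qed

lemma profile_decay:
  assumes decay: "\<And>r. r \<ge> 0 \<Longrightarrow> \<bar>w r\<bar> \<le> C * exp (- decay_rate * r)" and "C \<ge> 0" and s: "s \<in> {0..<1}"
  shows "\<bar>profile w s\<bar> \<le> C * (1 - s) powr decay_rate"
  unfolding profile_def
  using decay[of "hyp_radius s"] mult_left_mono[OF exp_decay_hyp_radius[OF s] \<open>C \<ge> 0\<close>]
    hyp_radius_nonneg[of s] s
  by simp

lemma profile'_decay:
  assumes sol: "shooting_solution w z"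
    and decay: "\<And>r. r \<ge> 0 \<Longrightarrow> \<bar>velocity z r\<bar> \<le> C * exp (- decay_rate * r)" and "C \<ge> 0"
  shows "\<exists>C'\<ge>C. \<forall>s\<in>{0..<1}. \<bar>profile' w z s\<bar> * (1 - s) \<le> C' * (1 - s) powr decay_rate"
proof -
  have "compact (profile' w z ` {0..1/4})"
    by (intro compact_continuous_image continuous_on_subset[OF continuous_on_profile'[OF sol]]) auto
  then have "bounded (profile' w z ` {0..1/4})" by (rule compact_imp_bounded)
  then obtain M where M: "\<And>s. s \<in> {0..1/4} \<Longrightarrow> \<bar>profile' w z s\<bar> \<le> M" unfolding bounded_iff by fastforce
  have "M \<ge> 0" using M[of 0] by simp
  define C' where "C' = 2 * C + M / (3 / 4) powr decay_rate"
  have C': "C \<le> C'" "2 * C \<le> C'" "M \<le> C' * (3 / 4) powr decay_rate"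
    using \<open>C \<ge> 0\<close> \<open>M \<ge> 0\<close> by (auto simp: C'_def field_simps)
  have "\<bar>profile' w z s\<bar> * (1 - s) \<le> C' * (1 - s) powr decay_rate" if s: "s \<in> {0..<1}" for s
  proof (cases "s \<le> 1 / 4")
    case True
    have "\<bar>profile' w z s\<bar> * (1 - s) \<le> M * 1" using M[of s] s True \<open>M \<ge> 0\<close> by (intro mult_mono) auto
    also have "\<dots> \<le> C' * (3 / 4) powr decay_rate" using C'(3) by simp
    also have "\<dots> \<le> C' * (1 - s) powr decay_rate"
      using True decay_rate_pos C'(1) \<open>C \<ge> 0\<close> by (intro mult_left_mono powr_mono2) auto
    finally show ?thesis .
  next
    case False
    then have "1 / 4 < s" "0 < s" by simp_all
    then have "sqrt (1 / 4) \<le> sqrt s" by (intro real_sqrt_le_mono) simp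
    then have half: "1 / 2 \<le> sqrt s" by (simp add: real_sqrt_divide)
    have "\<bar>profile' w z s\<bar> * (1 - s) = \<bar>velocity z (hyp_radius s)\<bar> / sqrt s"
      using profile'_eq[OF sol, of s] s \<open>0 < s\<close> by (simp add: abs_mult)
    also have "\<dots> \<le> \<bar>velocity z (hyp_radius s)\<bar> / (1 / 2)" using half \<open>0 < s\<close>
      by (intro divide_left_mono) auto
    also have "\<dots> \<le> 2 * C * (1 - s) powr decay_rate"
      using decay[of "hyp_radius s"] mult_left_mono[OF exp_decay_hyp_radius[OF s] \<open>C \<ge> 0\<close>]
        hyp_radius_nonneg[of s] s
      by simp
    also have "\<dots> \<le> C' * (1 - s) powr decay_rate" using C'(2) by (intro mult_right_mono) auto
    finally show ?thesis .
  qed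
  then show ?thesis using C'(1) by blast
qed

lemma fast_solution_H1_with_grad:
  assumes fast: "fast_solution w z" and "DIM('a::euclidean_space) = Suc d"
  shows "H1_with_grad (\<lambda>x::'a. profile w (x \<bullet> x)) (\<lambda>x. (2 * profile' w z (x \<bullet> x)) *\<^sub>R x)"
proof -
  have sol: "shooting_solution w z" using fast by (simp add: fast_solution_def)
  obtain C where C: "\<And>r. r \<ge> 0 \<Longrightarrow> \<bar>w r\<bar> \<le> C * exp (- decay_rate * r)"
    "\<And>r. r \<ge> 0 \<Longrightarrow> \<bar>velocity z r\<bar> \<le> C * exp (- decay_rate * r)"
    using fast by (auto simp: fast_solution_def)
  have "C \<ge> 0" using C(1)[of 0] by simp
  obtain C' where C': "C' \<ge> C" "\<And>s. s \<in> {0..<1} \<Longrightarrow> \<bar>profile' w z s\<bar> * (1 - s)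
      \<le> C' * (1 - s) powr decay_rate"
    using profile'_decay[OF sol C(2) \<open>C \<ge> 0\<close>] by blast
  have "\<bar>profile w s\<bar> \<le> C' * (1 - s) powr decay_rate" if "s \<in> {0..<1}" for s
    using profile_decay[OF C(1) \<open>C \<ge> 0\<close> that] mult_right_mono[OF C'(1), of "(1 - s) powr decay_rate"]
      by simp
  then show ?thesis
    by (intro H1_with_grad_radial[OF _ continuous_on_profile[OF sol] continuous_on_profile'[OF sol] profile_deriv[OF sol] _ C'(2)])
       (use decay_rate_gt assms(2) in auto)
qed

lemma weak_solution_radial_lift:
  assumes "fast_solution w z" and dim: "DIM('a::euclidean_space) = Suc d" and crit:
    "crit_exp DIM('a) - 2 = q"
  shows "weak_solution lam (radial_lift w :: 'a \<Rightarrow> real)"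
proof -
  have sol: "shooting_solution w z" using assms(1) by (simp add: fast_solution_def)
  have nonlin: "nonlin v = lam * v + \<bar>v\<bar> powr (crit_exp DIM('a) - 2) * v" for v
    by (simp add: nonlin_def crit)
  have "continuous_on {0..<1} (\<lambda>s. nonlin (profile w s) - lam * profile w s)"
    by (intro continuous_intros continuous_on_profile[OF sol]
        continuous_on_compose2[OF continuous_on_nonlin[of UNIV]]) auto
  then have power: "continuous_on {0..<1} (\<lambda>s. \<bar>profile w s\<bar> powr (crit_exp DIM('a) - 2) * profile w s)"
    by (simp add: nonlin)
  have "weak_solution lam (\<lambda>x::'a. profile w (x \<bullet> x))"
  proof (rule weak_solution_radial[OF continuous_on_profile[OF sol] continuous_on_profile'[OF sol] power
        continuous_on_radial_field[OF sol] radial_field_deriv[OF sol] _ _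
          fast_solution_H1_with_grad[OF assms(1,2)] refl])
    fix s :: real assume s: "s \<in> {0..<1}"
    show "(2 / (1 - s)) ^ DIM('a) * (((1 - s) / 2)\<^sup>2 * (2 * profile' w z s)) = - radial_field w z s"
      using s by (simp add: radial_field_def profile'_def dim power2_eq_square del: power_Suc)
    show "2 * s * radial_field' w z s + real DIM('a) * radial_field w z s = (2 / (1 - s)) ^ DIM('a)
        * (lam * profile w s + \<bar>profile w s\<bar> powr (crit_exp DIM('a) - 2) * profile w s)"
      using radial_field_equation[OF sol s] by (simp only: dim nonlin)
  qed
  then show ?thesis by (simp add: profile_def radial_lift_def[abs_def])
qed

lemma infinitely_many_fast_solutions:
  assumes oscillation: "\<And>k. \<exists>A>0. \<forall>w z. shooting_solution w z \<and> w 0 \<ge> A \<longrightarrow> (\<exists>r. alternates w k r)"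
  obtains W :: "nat \<Rightarrow> real \<Rightarrow> real" where "\<And>n. \<exists>z. fast_solution (W n) z"
    "\<And>n. \<exists>r. alternates (W n) k r"
    "strict_mono (\<lambda>n. W n 0)"
proof -
  obtain A where A: "A > 0" "\<And>w z. shooting_solution w z \<Longrightarrow> w 0 \<ge> A \<Longrightarrow> \<exists>r. alternates w k r"
    using oscillation by blast
  have above: "\<exists>w z. fast_solution w z \<and> w 0 \<ge> max A M" for M
    by (rule fast_solutions_unbounded) (use oscillation A(1)
        in \<open>blast | simp add: less_max_iff_disj\<close>)+
  have "\<exists>W. \<forall>n. ((\<exists>z. fast_solution (W n) z) \<and> W n 0 \<ge> A) \<and> W n 0 < W (Suc n) 0"
  proof (rule dependent_nat_choice)
    show "\<exists>w. (\<exists>z. fast_solution w z) \<and> w 0 \<ge> A" using above[of A] by auto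
    show "\<exists>w. ((\<exists>z. fast_solution w z) \<and> w 0 \<ge> A) \<and> v 0 < w 0" for v using above[of "v 0 + 1"]
      by force
  qed
  then obtain W where W: "\<And>n. \<exists>z. fast_solution (W n) z" "\<And>n. W n 0 \<ge> A" "\<And>n. W n 0 < W (Suc n) 0"
    by blast
  show ?thesis
  proof (rule that[OF W(1)])
    show "\<exists>r. alternates (W n) k r" for n using W(1,2)[of n] A(2) by (auto simp: fast_solution_def)
    show "strict_mono (\<lambda>n. W n 0)" using W(3) by (simp add: strict_mono_Suc_iff)
  qed
qed

end

theorem theorem1p3:
  fixes lam :: real
  assumes "DIM('a::euclidean_space) \<ge> 7"
    and "real DIM('a) * (real DIM('a) - 2) / 4 < lam"
    and "lam < ((real DIM('a) - 1) / 2)\<^sup>2"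
  shows "\<exists>U :: nat \<Rightarrow> 'a \<Rightarrow> real.
           (\<forall>k. weak_solution lam (U k) \<and> nontrivial (U k) \<and> radial (U k) \<and> sign_changing (U k)) \<and>
           (\<forall>i j. i \<noteq> j \<longrightarrow> \<not> (AE x in hyp_vol. U i x = U j x))"
proof -
  define d where "d = DIM('a) - 1"
  define m where "m = (real DIM('a) - 2) / 2"
  have d: "real d = real DIM('a) - 1" "DIM('a) = Suc d" using assms(1) by (auto simp: d_def)
  have "m > 2" using assms(1) by (simp add: m_def)
  have "m * (m + 1) < lam" using assms(2) by (simp add: m_def field_simps)
  moreover from this have "lam > 0" by (rule less_trans[rotated]) (use \<open>m > 2\<close> in simp)
  moreover have "real d = 2 * m + 1" using d(1) by (simp add: m_def field_simps)
  ultimately interpret critical_radial_equation d "2 / m" lam m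
    by unfold_locales (use \<open>m > 2\<close> in auto)
  interpret coercive_radial_equation d "2 / m" lam by unfold_locales (use assms(3) d(1) in simp)
  obtain W :: "nat \<Rightarrow> real \<Rightarrow> real" where
    W: "\<And>k. \<exists>z. fast_solution (W k) z" "\<And>k. \<exists>r. alternates (W k) (Suc 0) r"
    and mono: "strict_mono (\<lambda>k. W k 0)"
    using infinitely_many_fast_solutions[OF many_sign_changes, of "Suc 0"] by blast
  have continuous: "continuous_on {0..} (W k)" for k
    using W(1)[of k] continuous_on_w by (auto simp: fast_solution_def)
  have "crit_exp DIM('a) - 2 = 2 / m" using assms(1) by (simp add: crit_exp_def m_def field_simps)
  then have "weak_solution lam (radial_lift (W k) :: 'a \<Rightarrow> real)" for k
    using W(1) weak_solution_radial_lift d(2) by blast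
  moreover have "\<not> (AE x in hyp_vol. radial_lift (W i) (x::'a) = radial_lift (W j) x)"
    if "i \<noteq> j" for i j
    using radial_lift_AE_eqD[OF continuous continuous] strict_mono_eq[OF mono] that by blast
  moreover have "sign_changing (radial_lift (W k) :: 'a \<Rightarrow> real)"
    "nontrivial (radial_lift (W k) :: 'a \<Rightarrow> real)" for k
    using radial_lift_sign_changing[OF continuous] W(2)[of k] by blast+
  ultimately show ?thesis
    by (intro exI[of _ "\<lambda>k. radial_lift (W k)"]) (simp add: radial_lift_is_radial)
qed

end
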